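(* Consider the automorphisms of $F_4\otimes\mathbb{Q}(\zeta_8)$: $\theta_1\colon[X:Y:Z]\mapsto[\zeta_4X:Y:Z]$, $\theta_2\colon[X:Y:Z]\mapsto[Y:X:Z]$, $\theta_3\colon[X:Y:Z]\mapsto[\zeta_8^7Y:\zeta_4^3Z:X]$, acting on $\mathrm{Jac}(F_4)[4]$ by push-forward of divisors. With respect to the basis $e_1,e_2,e_3,e_4,e_5,e'_6$ (the $j$-th column giving the coordinates of the image of the $j$-th basis vector), $\theta_1,\theta_2,\theta_3$ act by the matrices $$\begin{pmatrix}1&0&0&0&3&1\\0&1&0&0&1&1\\3&3&3&2&2&1\\0&0&1&3&1&2\\0&0&0&0&3&1\\0&0&0&0&2&3\end{pmatrix},\quad\begin{pmatrix}2&2&3&2&1&2\\3&3&3&0&0&1\\3&2&2&2&1&2\\3&0&3&3&0&1\\0&0&0&0&3&0\\0&0&0&0&2&1\end{pmatrix},\quad\begin{pmatrix}3&2&3&0&3&1\\2&3&3&2&2&2\\2&1&2&2&2&3\\1&2&1&1&2&3\\1&3&0&0&0&1\\0&2&0&0&0&3\end{pmatrix}$$ respectively.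
   Context: Fix $\overline{\mathbb{Q}}\subset\mathbb{C}$; $\zeta_n=\exp(2\pi i/n)$, $2^{1/4}$ the positive real fourth root of $2$. $F_4\subset\mathbb{P}^2$ is the Fermat quartic $X^4+Y^4=Z^4$ over $\mathbb{Q}$; $[D]$ is a linear equivalence class in $\mathrm{Jac}(F_4)(\overline{\mathbb{Q}})=\mathrm{Pic}^0(F_4\otimes\overline{\mathbb{Q}})$. Points: $A_i=[0:\zeta_4^i:1]$, $B_i=[\zeta_4^i:0:1]$, $C_i=[\zeta_8\zeta_4^i:1:0]$, $P_1=[2^{1/4}\zeta_4:\zeta_8:1]$, $P_2=[\zeta_8:2^{1/4}\zeta_4:1]$, $P_3=[2^{-1/4}:2^{-1/4}:1]$; $e_1=[A_1-B_0]$, $e_2=[A_2-B_0]$, $e_3=[B_1-B_0]$, $e_4=[B_2-B_0]$, $e_5=[C_1-B_0]$, $e'_6=[P_1+P_2+P_3-3B_0]$; these form a $\mathbb{Z}/4\mathbb{Z}$-basis of $\mathrm{Jac}(F_4)[4]$. *)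

theory Defs
  imports
    "HOL-Computational_Algebra.Polynomial"
    "HOL-Algebra.Free_Abelian_Groups"
    "Jordan_Normal_Form.Matrix"
    Complex_Main
begin

section \<open>The Fermat quartic over the algebraic numbers\<close>

definition Qbar :: "complex set" where
  "Qbar = {z. \<exists>p :: rat poly. p \<noteq> 0 \<and> poly (map_poly of_rat p) z = 0}"

type_synonym triple = "complex \<times> complex \<times> complex"

text \<open>A point of the projective plane is the set of all its homogeneous coordinate vectors.\<close>

type_synonym point = "triple set"

definition proj :: "triple \<Rightarrow> point" where
  "proj = (\<lambda>(x, y, z). {(c * x, c * y, c * z) | c. c \<in> Qbar \<and> c \<noteq> 0})"

definition F4_coords :: "triple set" where
  "F4_coords = {(x, y, z). x \<in> Qbar \<and> y \<in> Qbar \<and> z \<in> Qbar \<and> (x, y, z) \<noteq> (0, 0, 0) \<and>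
                           x ^ 4 + y ^ 4 = z ^ 4}"

definition F4 :: "point set" where
  "F4 = proj ` F4_coords"


section \<open>Rational functions on the curve and their orders\<close>

text \<open>Forms of degree \<open>d\<close> over \<^const>\<open>Qbar\<close>; as the field is infinite, a form may be identified
  with the function it defines.\<close>

definition form :: "nat \<Rightarrow> (triple \<Rightarrow> complex) \<Rightarrow> bool" where
  "form d G \<longleftrightarrow> (\<exists>a :: nat \<Rightarrow> nat \<Rightarrow> complex. (\<forall>i j. a i j \<in> Qbar) \<and>
     G = (\<lambda>(x, y, z). \<Sum>i\<le>d. \<Sum>j\<le>d - i. a i j * x ^ i * y ^ j * z ^ (d - i - j)))"

text \<open>Rational functions are represented by quotients of two forms of equal degree, with the value
  0 wherever the denominator vanishes.  Two representatives define the same element of the function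
  field iff they agree on a nonempty (hence, the curve being irreducible, dense) basic open
  subset.\<close>

definition rat_eq :: "(triple \<Rightarrow> complex) \<Rightarrow> (triple \<Rightarrow> complex) \<Rightarrow> bool" where
  "rat_eq f g \<longleftrightarrow> (\<exists>d E. form d E \<and> (\<exists>v\<in>F4_coords. E v \<noteq> 0) \<and>
     (\<forall>v\<in>F4_coords. E v \<noteq> 0 \<longrightarrow> f v = g v))"

definition nonzero_rat_funs :: "(triple \<Rightarrow> complex) set" where
  "nonzero_rat_funs = {\<lambda>v. G v / H v | G H. \<exists>d. form d G \<and> form d H \<and>
     (\<exists>v\<in>F4_coords. G v \<noteq> 0) \<and> (\<exists>v\<in>F4_coords. H v \<noteq> 0)}"

text \<open>The local ring at \<open>P\<close>, its maximal ideal and its unit group.\<close>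

definition local_ring :: "point \<Rightarrow> (triple \<Rightarrow> complex) set" where
  "local_ring P = {\<lambda>v. G v / H v | G H. \<exists>d. form d G \<and> form d H \<and> (\<forall>v\<in>P. H v \<noteq> 0)}"

definition max_ideal :: "point \<Rightarrow> (triple \<Rightarrow> complex) set" where
  "max_ideal P = {f \<in> local_ring P. \<forall>v\<in>P. f v = 0}"

definition local_units :: "point \<Rightarrow> (triple \<Rightarrow> complex) set" where
  "local_units P = {f \<in> local_ring P. \<forall>v\<in>P. f v \<noteq> 0}"

definition uniformizer :: "point \<Rightarrow> (triple \<Rightarrow> complex) \<Rightarrow> bool" where
  "uniformizer P t \<longleftrightarrow> t \<in> max_ideal P \<and>
     (\<forall>g\<in>max_ideal P. \<exists>h\<in>local_ring P. rat_eq g (\<lambda>v. t v * h v))"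

text \<open>The valuation of the discrete valuation ring at \<open>P\<close>, as a relation.\<close>

definition has_ord :: "(triple \<Rightarrow> complex) \<Rightarrow> point \<Rightarrow> int \<Rightarrow> bool" where
  "has_ord f P n \<longleftrightarrow>
     (\<exists>t u. uniformizer P t \<and> u \<in> local_units P \<and> rat_eq f (\<lambda>v. u v * t v powi n))"


section \<open>Divisors and the Jacobian\<close>

type_synonym divisor = "point \<Rightarrow>\<^sub>0 int"

abbreviation Div :: "divisor monoid" where
  "Div \<equiv> free_Abelian_group F4"

definition Prin :: "divisor set" where
  "Prin = {D \<in> carrier Div. \<exists>f\<in>nonzero_rat_funs. \<forall>P\<in>F4. has_ord f P (Poly_Mapping.lookup D P)}"

definition deg :: "divisor \<Rightarrow> int" where
  "deg D = (\<Sum>P\<in>Poly_Mapping.keys D. Poly_Mapping.lookup D P)"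

definition cls :: "divisor \<Rightarrow> divisor set" where
  "cls D = Prin #>\<^bsub>Div\<^esub> D"

definition Jac :: "divisor set monoid" where
  "Jac = (Div Mod Prin)\<lparr>carrier := {cls D | D. D \<in> carrier Div \<and> deg D = 0}\<rparr>"

definition torsion :: "('a, 'b) monoid_scheme \<Rightarrow> nat \<Rightarrow> ('a, 'b) monoid_scheme" where
  "torsion G n = G\<lparr>carrier := {x \<in> carrier G. x [^]\<^bsub>G\<^esub> n = \<one>\<^bsub>G\<^esub>}\<rparr>"

text \<open>A map \<open>\<theta>\<close> given on coordinate vectors by a linear substitution acts on points by taking the
  image of the set of coordinate vectors, on divisors by additive extension, and on divisor
  classes by taking the image of the coset.\<close>

definition push_div :: "(triple \<Rightarrow> triple) \<Rightarrow> divisor \<Rightarrow> divisor" where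
  "push_div \<theta> = frag_extend (\<lambda>P. frag_of (\<theta> ` P))"

definition push_cls :: "(triple \<Rightarrow> triple) \<Rightarrow> divisor set \<Rightarrow> divisor set" where
  "push_cls \<theta> c = push_div \<theta> ` c"

text \<open>The endomorphism \<open>\<phi>\<close> of the abelian group \<open>A\<close> (written multiplicatively) is given by \<open>M\<close> with
  respect to \<open>e 0, \<dots>, e (n - 1)\<close>: the \<open>j\<close>-th column of \<open>M\<close> contains the coordinates of the image
  of \<open>e j\<close>.  If \<open>A\<close> is killed by \<open>m\<close>, the entries only matter modulo \<open>m\<close>.\<close>

definition acts_by_matrix ::
  "('a, 'b) monoid_scheme \<Rightarrow> nat \<Rightarrow> (nat \<Rightarrow> 'a) \<Rightarrow> ('a \<Rightarrow> 'a) \<Rightarrow> int mat \<Rightarrow> bool" where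
  "acts_by_matrix A n e \<phi> M \<longleftrightarrow>
     M \<in> carrier_mat n n \<and> \<phi> \<in> hom A A \<and> (\<forall>j<n. e j \<in> carrier A) \<and>
     (\<forall>j<n. \<phi> (e j) = (\<Otimes>\<^bsub>A\<^esub>i\<in>{..<n}. e i [^]\<^bsub>A\<^esub> (M $$ (i, j))))"


section \<open>The points, classes and automorphisms\<close>

definition zeta :: "nat \<Rightarrow> complex" where
  "zeta n = exp (2 * of_real pi * \<i> / of_nat n)"

definition r2 :: complex where
  "r2 = of_real (root 4 2)"

definition ptA :: "nat \<Rightarrow> point" where "ptA i = proj (0, zeta 4 ^ i, 1)"
definition ptB :: "nat \<Rightarrow> point" where "ptB i = proj (zeta 4 ^ i, 0, 1)"
definition ptC :: "nat \<Rightarrow> point" where "ptC i = proj (zeta 8 * zeta 4 ^ i, 1, 0)"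

definition P1 :: point where "P1 = proj (r2 * zeta 4, zeta 8, 1)"
definition P2 :: point where "P2 = proj (zeta 8, r2 * zeta 4, 1)"
definition P3 :: point where "P3 = proj (inverse r2, inverse r2, 1)"

text \<open>Indexed from 0: \<open>e_basis 0, \<dots>, e_basis 5\<close> are the classes
  \<open>e\<^sub>1, e\<^sub>2, e\<^sub>3, e\<^sub>4, e\<^sub>5, e'\<^sub>6\<close>.\<close>

definition e_basis :: "nat \<Rightarrow> divisor set" where
  "e_basis j =
    [cls (frag_of (ptA 1) - frag_of (ptB 0)),
     cls (frag_of (ptA 2) - frag_of (ptB 0)),
     cls (frag_of (ptB 1) - frag_of (ptB 0)),
     cls (frag_of (ptB 2) - frag_of (ptB 0)),
     cls (frag_of (ptC 1) - frag_of (ptB 0)),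
     cls (frag_of P1 + frag_of P2 + frag_of P3 - frag_cmul 3 (frag_of (ptB 0)))] ! j"

definition theta1 :: "triple \<Rightarrow> triple" where
  "theta1 = (\<lambda>(x, y, z). (zeta 4 * x, y, z))"

definition theta2 :: "triple \<Rightarrow> triple" where
  "theta2 = (\<lambda>(x, y, z). (y, x, z))"

definition theta3 :: "triple \<Rightarrow> triple" where
  "theta3 = (\<lambda>(x, y, z). (zeta 8 ^ 7 * y, zeta 4 ^ 3 * z, x))"

end

theory Submission
  imports Defs "HOL-Complex_Analysis.Conformal_Mappings"
begin

text \<open>A divisor relation of degree 0 is verified by writing it as an integral combination of
  intersection divisors of the quartic with plane curves.  The flex tangents at \<open>A0\<close> and \<open>B0\<close>, the
  line \<open>x = 0\<close>, one conic and one cubic suffice: the cubic passes through \<open>P1, P2, P3\<close>, three of their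
  conjugates and six of the points \<open>Ai, Bi\<close>, and the images of these divisors under the group
  generated by the three automorphisms generate all relations needed, both for the columns of the
  matrices and for the vanishing of \<open>4 e\<^sub>j\<close>.  The divisor of a form is found from an identity
  on the curve: multiplied by a conjugate form, it becomes a product of linear forms.  Linear
  forms vanishing but not tangent at a point are local parameters there, and orders are
  well defined because the curve is irreducible.\<close>

section \<open>The field of algebraic numbers\<close>

text \<open>The reference divisor is 4 B0, which a flex tangent cuts out. A section D by a plane
  curve of degree d satisfies D ~ 4d B0, and 4 theta(B0) ~ 4 B0 holds for each of the three
  automorphisms. So the sections generate a group that is stable under the automorphisms and whose
  members of degree 0 are principal; what remains is to compare integer coefficients on finitely
  many labelled points. The obstacle is that an order is an existence statement about some
  uniformizer, valid only up to equality in the function field. Combining two orders means comparing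
  arbitrary uniformizers, hence cancelling forms on the curve. Orders are therefore computed for
  forms, with all denominators cleared and degrees recorded, and turned into orders of functions at
  the end. Points have coordinates in \<open>Qbar\<close>, while the identity theorem lives over the
  complex numbers; algebraic points of an analytic arc that accumulate inside its domain connect the
  two.\<close>

lemma Qbar_iff_algebraic: "z \<in> Qbar \<longleftrightarrow> algebraic z"
proof
  assume "z \<in> Qbar"
  then obtain p :: "rat poly" where p: "p \<noteq> 0" "poly (map_poly of_rat p) z = 0"
    by (auto simp: Qbar_def)
  have "map_poly of_rat p \<noteq> (0 :: complex poly)"
    using p(1) by (auto simp: poly_eq_iff coeff_map_poly)
  with p(2) show "algebraic z"
    by (intro algebraicI'[of "map_poly of_rat p"]) (auto simp: coeff_map_poly)
next
  assume "algebraic z"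
  then obtain p :: "int poly" where p: "p \<noteq> 0" "poly (map_poly of_int p) z = 0"
    by (rule algebraicE')
  have "map_poly of_rat (map_poly of_int p) = (map_poly of_int p :: complex poly)"
    by (intro poly_eqI) (simp add: coeff_map_poly)
  moreover have "map_poly of_int p \<noteq> (0 :: rat poly)"
    using p(1) by (auto simp: poly_eq_iff coeff_map_poly)
  ultimately show "z \<in> Qbar"
    using p(2) by (auto simp: Qbar_def intro!: exI[of _ "map_poly of_int p"])
qed

interpretation Q_vs: vector_space "\<lambda>(q::rat) (z::complex). of_rat q * z"
  by unfold_locales (auto simp: algebra_simps of_rat_add of_rat_mult)

lemma span_mult:
  assumes "a \<in> Q_vs.span B" "b \<in> Q_vs.span C"
  shows "a * b \<in> Q_vs.span {x * y | x y. x \<in> B \<and> y \<in> C}" (is "_ \<in> Q_vs.span ?BC")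
proof -
  have 1: "x * b \<in> Q_vs.span ?BC" if "x \<in> B" for x
    using assms(2)
  proof (induction rule: Q_vs.span_induct_alt)
    case base show ?case by (simp add: Q_vs.span_zero)
  next
    case (step c y z)
    have "x * (of_rat c * y + z) = of_rat c * (x * y) + x * z" by (simp add: algebra_simps)
    moreover have "x * y \<in> Q_vs.span ?BC" using that step.hyps by (intro Q_vs.span_base) blast
    ultimately show ?case using step.IH by (simp add: Q_vs.span_add Q_vs.span_scale)
  qed
  show ?thesis
    using assms(1)
  proof (induction rule: Q_vs.span_induct_alt)
    case base show ?case by (simp add: Q_vs.span_zero)
  next
    case (step c x z)
    have "(of_rat c * x + z) * b = of_rat c * (x * b) + z * b" by (simp add: algebra_simps)
    then show ?case using step.IH 1[OF step.hyps] by (simp add: Q_vs.span_add Q_vs.span_scale)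
  qed
qed

text \<open>Finite dimension of the algebra generated by z, phrased with a spanning set. In this
  form algebraicity passes to sums and products: the powers of x + y and x * y lie in the span of
  the pairwise products of the two spanning sets.\<close>

lemma Qbar_iff_powers_span:
  "z \<in> Qbar \<longleftrightarrow> (\<exists>B. finite B \<and> (\<forall>k. z ^ k \<in> Q_vs.span B))"
proof
  assume "z \<in> Qbar"
  then obtain p :: "rat poly" where p: "p \<noteq> 0" "poly (map_poly of_rat p) z = 0"
    by (auto simp: Qbar_def)
  define n where "n = degree p"
  define B where "B = (\<lambda>i. z ^ i) ` {..<n}"
  have deg: "degree (map_poly of_rat p :: complex poly) = n"
    by (simp add: n_def degree_map_poly)
  have lc: "coeff p n \<noteq> 0" using p(1) by (simp add: n_def)
  have "(\<Sum>i\<le>n. of_rat (coeff p i) * z ^ i) = 0"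
    using p(2) by (simp add: poly_altdef deg coeff_map_poly)
  then have "of_rat (coeff p n) * z ^ n = - (\<Sum>i<n. of_rat (coeff p i) * z ^ i)"
    by (simp add: lessThan_Suc_atMost[symmetric] eq_neg_iff_add_eq_0 add.commute)
  then have "z ^ n = - (\<Sum>i<n. of_rat (coeff p i) * z ^ i) / of_rat (coeff p n)"
    using lc by (subst nonzero_eq_divide_eq) (auto simp: mult.commute)
  then have zn: "z ^ n = (\<Sum>i<n. of_rat (- coeff p i / coeff p n) * z ^ i)"
    by (simp add: of_rat_divide of_rat_minus sum_divide_distrib sum_negf)
  have "z ^ k \<in> Q_vs.span B" for k
  proof (induction k rule: less_induct)
    case (less k)
    show ?case
    proof (cases "k < n")
      case True
      then show ?thesis by (auto simp: B_def intro: Q_vs.span_base)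
    next
      case False
      then have "z ^ k = z ^ n * z ^ (k - n)" by (simp flip: power_add)
      also have "\<dots> = (\<Sum>i<n. of_rat (- coeff p i / coeff p n) * z ^ (i + (k - n)))"
        unfolding zn by (simp only: sum_distrib_right power_add mult.assoc)
      also have "\<dots> \<in> Q_vs.span B"
        using less False by (intro Q_vs.span_sum Q_vs.span_scale) auto
      finally show ?thesis .
    qed
  qed
  then show "\<exists>B. finite B \<and> (\<forall>k. z ^ k \<in> Q_vs.span B)"
    by (intro exI[of _ B]) (auto simp: B_def)
next
  assume "\<exists>B. finite B \<and> (\<forall>k. z ^ k \<in> Q_vs.span B)"
  then obtain B where B: "finite B" "\<And>k. z ^ k \<in> Q_vs.span B" by auto
  define N where "N = card B"
  define S where "S = (\<lambda>k. z ^ k) ` {..N}"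
  show "z \<in> Qbar"
  proof (cases "inj_on (\<lambda>k. z ^ k) {..N}")
    \<comment> \<open>If two powers coincide, the set of powers is too small for the dimension
      count, but the difference of the two monomials already annihilates z.\<close>
    case False
    then obtain i j where ij: "i \<noteq> j" "z ^ i = z ^ j" by (auto simp: inj_on_def)
    have "coeff (monom 1 i - monom 1 j) i \<noteq> (0 :: complex)"
      using ij(1) by simp
    then have "monom 1 i - monom 1 j \<noteq> (0 :: complex poly)"
      by force
    then have "algebraic z"
      using ij by (intro algebraicI[of "monom 1 i - monom 1 j"]) (auto simp: poly_monom)
    then show ?thesis by (simp add: Qbar_iff_algebraic)
  next
    case True
    then have "card S = Suc N" by (simp add: S_def card_image)
    moreover have "S \<subseteq> Q_vs.span B" using B by (auto simp: S_def)
    ultimately have "Q_vs.dependent S"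
      using Q_vs.independent_span_bound[OF B(1), of S] by (auto simp: N_def)
    moreover have "finite S" by (simp add: S_def)
    ultimately obtain u v where u: "v \<in> S" "u v \<noteq> 0" "(\<Sum>w\<in>S. of_rat (u w) * w) = 0"
      using Q_vs.dependent_finite by blast
    define p where "p = (\<Sum>k\<le>N. monom (of_rat (u (z ^ k)) :: complex) k)"
    have co: "coeff p k = (if k \<le> N then of_rat (u (z ^ k)) else 0)" for k
      by (auto simp: p_def coeff_sum)
    have "poly p z = (\<Sum>k\<le>N. of_rat (u (z ^ k)) * z ^ k)"
      by (simp add: p_def poly_sum poly_monom)
    also have "\<dots> = (\<Sum>w\<in>S. of_rat (u w) * w)"
      unfolding S_def using True by (subst sum.reindex) auto
    finally have "poly p z = 0" using u by simp
    moreover have "p \<noteq> 0"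
    proof -
      obtain k where "k \<le> N" "v = z ^ k" using u by (auto simp: S_def)
      then have "coeff p k \<noteq> 0" using u co by simp
      then show ?thesis by auto
    qed
    ultimately have "algebraic z" by (intro algebraicI'[of p]) (auto simp: co)
    then show ?thesis by (simp add: Qbar_iff_algebraic)
  qed
qed

lemma Qbar_add [intro]: "x + y \<in> Qbar"
  and Qbar_mult [intro]: "x * y \<in> Qbar" if "x \<in> Qbar" "y \<in> Qbar"
proof -
  obtain B C where B: "finite B" "\<And>k. x ^ k \<in> Q_vs.span B"
    and C: "finite C" "\<And>k. y ^ k \<in> Q_vs.span C"
    using \<open>x \<in> Qbar\<close> \<open>y \<in> Qbar\<close> by (auto simp: Qbar_iff_powers_span)
  let ?BC = "{b * c | b c. b \<in> B \<and> c \<in> C}"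
  have "?BC = (\<lambda>(b, c). b * c) ` (B \<times> C)" by auto
  then have "finite ?BC"
    using B(1) C(1) by simp
  moreover have xy: "x ^ i * y ^ j \<in> Q_vs.span ?BC" for i j
    using B C by (intro span_mult)
  moreover have "(x + y) ^ k \<in> Q_vs.span ?BC" for k
  proof -
    have "(x + y) ^ k = (\<Sum>i\<le>k. of_rat (of_nat (k choose i)) * (x ^ i * y ^ (k - i)))"
      by (simp add: binomial_ring mult_ac)
    also have "\<dots> \<in> Q_vs.span ?BC" using xy by (intro Q_vs.span_sum Q_vs.span_scale)
    finally show ?thesis .
  qed
  moreover have "(x * y) ^ k \<in> Q_vs.span ?BC" for k
    using xy by (simp add: power_mult_distrib)
  ultimately show "x + y \<in> Qbar" "x * y \<in> Qbar"
    by (auto simp: Qbar_iff_powers_span)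
qed

lemma Qbar_minus [intro]: "x \<in> Qbar \<Longrightarrow> - x \<in> Qbar"
  and Qbar_inverse [intro]: "x \<in> Qbar \<Longrightarrow> inverse x \<in> Qbar"
  and Qbar_0 [simp, intro]: "0 \<in> Qbar"
  and Qbar_1 [simp, intro]: "1 \<in> Qbar"
  and Qbar_numeral [simp, intro]: "numeral n \<in> Qbar"
  and Qbar_of_nat [simp, intro]: "of_nat k \<in> Qbar"
  and Qbar_ii [simp, intro]: "\<i> \<in> Qbar"
  by (auto simp: Qbar_iff_algebraic)

lemma Qbar_diff [intro]: "x \<in> Qbar \<Longrightarrow> y \<in> Qbar \<Longrightarrow> x - y \<in> Qbar"
  using Qbar_add[of x "- y"] by auto

lemma Qbar_divide [intro]: "x \<in> Qbar \<Longrightarrow> y \<in> Qbar \<Longrightarrow> x / y \<in> Qbar"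
  by (auto simp: divide_inverse)

lemma Qbar_power [intro]: "x \<in> Qbar \<Longrightarrow> x ^ n \<in> Qbar"
  by (induction n) auto

text \<open>For numbers known through a power only: \<open>zeta 8\<close>, \<open>r2\<close> and the
  values of \<open>branch\<close> below.\<close>

lemma Qbar_powerD:
  assumes "x ^ n \<in> Qbar" "n > 0" shows "x \<in> Qbar"
  unfolding Qbar_iff_algebraic
proof (rule algebraic_root)
  show "algebraic (x ^ n)" using assms(1) by (simp add: Qbar_iff_algebraic)
  show "poly (monom 1 n) x = x ^ n" by (simp add: poly_monom)
qed (use assms(2) in \<open>auto simp: degree_monom_eq\<close>)

section \<open>Forms\<close>

abbreviation form_sum :: "nat \<Rightarrow> (nat \<Rightarrow> nat \<Rightarrow> complex) \<Rightarrow> complex \<Rightarrow> complex \<Rightarrow> complex \<Rightarrow> complex" where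
  "form_sum d a x y z \<equiv> \<Sum>i\<le>d. \<Sum>j\<le>d - i. a i j * x ^ i * y ^ j * z ^ (d - i - j)"

abbreviation nonvanishing :: "(triple \<Rightarrow> complex) \<Rightarrow> bool" where
  "nonvanishing G \<equiv> \<exists>v\<in>F4_coords. G v \<noteq> 0"

lemma form_cong: "form d G \<Longrightarrow> (\<And>x y z. G (x, y, z) = H (x, y, z)) \<Longrightarrow> form d H"
  by (subgoal_tac "G = H") (auto simp: fun_eq_iff)

lemma form_0_iff: "form 0 G \<longleftrightarrow> (\<exists>c\<in>Qbar. G = (\<lambda>_. c))"
  unfolding form_def
proof safe
  fix a :: "nat \<Rightarrow> nat \<Rightarrow> complex" assume "\<forall>i j. a i j \<in> Qbar"
  then show "\<exists>c\<in>Qbar. (\<lambda>(x, y, z). \<Sum>i\<le>0. \<Sum>j\<le>0 - i. a i j * x ^ i * y ^ j * z ^ (0 - i - j)) = (\<lambda>_. c)"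
    by (auto simp: fun_eq_iff)
next
  fix c :: complex assume "c \<in> Qbar"
  then show "\<exists>a. (\<forall>i j. a i j \<in> Qbar) \<and>
    (\<lambda>_. c) = (\<lambda>(x, y, z). \<Sum>i\<le>0. \<Sum>j\<le>0 - i. a i j * x ^ i * y ^ j * z ^ (0 - i - j))"
    by (intro exI[of _ "\<lambda>_ _. c"]) (auto simp: fun_eq_iff)
qed

lemma formE:
  assumes "form d G"
  obtains a :: "nat \<Rightarrow> nat \<Rightarrow> complex" where "\<forall>i j. a i j \<in> Qbar"
    "\<forall>x y z. G (x, y, z) = form_sum d a x y z"
proof -
  from assms obtain a :: "nat \<Rightarrow> nat \<Rightarrow> complex" where a: "\<forall>i j. a i j \<in> Qbar"
    "G = (\<lambda>(x, y, z). \<Sum>i\<le>d. \<Sum>j\<le>d - i. a i j * x ^ i * y ^ j * z ^ (d - i - j))"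
    unfolding form_def by blast
  show ?thesis by (rule that[of a]) (simp_all add: a)
qed

lemma formI:
  fixes a :: "nat \<Rightarrow> nat \<Rightarrow> complex"
  assumes "\<And>i j. a i j \<in> Qbar"
    "\<And>x y z. G (x, y, z) = form_sum d a x y z"
  shows "form d G"
  unfolding form_def using assms by (intro exI[of _ a]) (simp add: fun_eq_iff)

lemma form_add:
  assumes "form d G" "form d H"
  shows "form d (\<lambda>v. G v + H v)"
proof -
  obtain a where a: "\<forall>i j. a i j \<in> Qbar"
    "\<forall>x y z. G (x, y, z) = form_sum d a x y z"
    by (rule formE[OF assms(1)])
  obtain b where b: "\<forall>i j. b i j \<in> Qbar"
    "\<forall>x y z. H (x, y, z) = form_sum d b x y z"
    by (rule formE[OF assms(2)])
  show ?thesis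
    by (rule formI[of "\<lambda>i j. a i j + b i j"])
      (simp_all add: a b Qbar_add sum.distrib distrib_right)
qed

lemma form_scale:
  assumes "c \<in> Qbar" "form d G"
  shows "form d (\<lambda>v. c * G v)"
proof -
  obtain a where a: "\<forall>i j. a i j \<in> Qbar"
    "\<forall>x y z. G (x, y, z) = form_sum d a x y z"
    by (rule formE[OF assms(2)])
  show ?thesis
    by (rule formI[of "\<lambda>i j. c * a i j"])
      (simp_all add: a assms Qbar_mult sum_distrib_left mult.assoc)
qed

lemma form_zero: "form d (\<lambda>_. 0)"
  unfolding form_def by (rule exI[of _ "\<lambda>_ _. 0"]) auto

lemma form_X_mult:
  assumes "form d G" shows "form (Suc d) (\<lambda>(x, y, z). x * G (x, y, z))"
proof -
  obtain a where a: "\<forall>i j. a i j \<in> Qbar"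
    "\<forall>x y z. G (x, y, z) = form_sum d a x y z"
    by (rule formE[OF assms])
  show ?thesis
    by (rule formI[of "\<lambda>i j. if i = 0 then 0 else a (i - 1) j"])
       (simp_all add: a sum.atMost_Suc_shift sum_distrib_left mult_ac del: sum.atMost_Suc)
qed

lemma form_Y_mult:
  assumes "form d G" shows "form (Suc d) (\<lambda>(x, y, z). y * G (x, y, z))"
proof -
  obtain a where a: "\<forall>i j. a i j \<in> Qbar"
    "\<forall>x y z. G (x, y, z) = form_sum d a x y z"
    by (rule formE[OF assms])
  let ?b = "\<lambda>i j. if j = 0 then 0 else a i (j - 1)"
  have "(\<Sum>i\<le>Suc d. \<Sum>j\<le>Suc d - i. ?b i j * x ^ i * y ^ j * z ^ (Suc d - i - j)) = y * G (x, y, z)" for x y z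
  proof -
    have "(\<Sum>j\<le>Suc d - i. ?b i j * x ^ i * y ^ j * z ^ (Suc d - i - j)) =
      y * (\<Sum>j\<le>d - i. a i j * x ^ i * y ^ j * z ^ (d - i - j))" if "i \<le> d" for i
      unfolding Suc_diff_le[OF that]
      by (subst sum.atMost_Suc_shift) (auto simp: sum_distrib_left mult_ac)
    then show ?thesis by (simp add: a sum_distrib_left)
  qed
  then show ?thesis
    using a(1) by (intro formI[of ?b]) simp_all
qed

lemma form_Z_mult:
  assumes "form d G" shows "form (Suc d) (\<lambda>(x, y, z). z * G (x, y, z))"
proof -
  obtain a where a: "\<forall>i j. a i j \<in> Qbar"
    "\<forall>x y z. G (x, y, z) = form_sum d a x y z"
    by (rule formE[OF assms])
  \<comment> \<open>The diagonal i + j = d + 1 consists of the monomials without z, whose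
    coefficients have to vanish.\<close>
  let ?b = "\<lambda>i j. if i + j \<le> d then a i j else 0"
  have "(\<Sum>i\<le>Suc d. \<Sum>j\<le>Suc d - i. ?b i j * x ^ i * y ^ j * z ^ (Suc d - i - j)) = z * G (x, y, z)" for x y z
  proof -
    have "(\<Sum>j\<le>Suc d - i. ?b i j * x ^ i * y ^ j * z ^ (Suc d - i - j)) =
      z * (\<Sum>j\<le>d - i. a i j * x ^ i * y ^ j * z ^ (d - i - j))" if "i \<le> d" for i
    proof -
      have "(\<Sum>j\<le>d - i. ?b i j * x ^ i * y ^ j * z ^ (Suc (d - i) - j)) =
        (\<Sum>j\<le>d - i. z * (a i j * x ^ i * y ^ j * z ^ (d - i - j)))"
        using that by (intro sum.cong) (auto simp: Suc_diff_le)
      then show ?thesis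
        using that by (simp add: Suc_diff_le sum_distrib_left)
    qed
    then show ?thesis by (simp add: a sum_distrib_left)
  qed
  then show ?thesis
    using a(1) by (intro formI[of ?b]) simp_all
qed

text \<open>The induction principle for forms: products, homogeneity, substitution, normal forms and
  holomorphy along the arc are all derived from it, without further work on double sums. G1 collects
  the monomials divisible by x, G2 those free of x but divisible by y, and G3 is the rest, a
  multiple of a power of z.\<close>

lemma form_SucE:
  assumes "form (Suc d) G"
  obtains G1 G2 G3 where "form d G1" "form d G2" "form d G3"
    "\<forall>x y z. G (x, y, z) = x * G1 (x, y, z) + y * G2 (x, y, z) + z * G3 (x, y, z)"
proof -
  obtain a where a: "\<forall>i j. a i j \<in> Qbar"
    "\<forall>x y z. G (x, y, z) = form_sum (Suc d) a x y z"
    by (rule formE[OF assms])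
  define G1 where "G1 = (\<lambda>(x, y, z). \<Sum>i\<le>d. \<Sum>j\<le>d - i. a (Suc i) j * x ^ i * y ^ j * z ^ (d - i - j))"
  define G2 where "G2 = (\<lambda>(x::complex, y, z). \<Sum>i\<le>d. \<Sum>j\<le>d - i. (if i = 0 then a 0 (Suc j) else 0) * x ^ i * y ^ j * z ^ (d - i - j))"
  define G3 where "G3 = (\<lambda>(x::complex, y::complex, z). \<Sum>i\<le>d. \<Sum>j\<le>d - i. (if i = 0 \<and> j = 0 then a 0 0 else 0) * x ^ i * y ^ j * z ^ (d - i - j))"
  have f: "form d G1" "form d G2" "form d G3"
    unfolding G1_def G2_def G3_def
    by (rule formI[of "\<lambda>i j. a (Suc i) j"] formI[of "\<lambda>i j. if i = 0 then a 0 (Suc j) else 0"]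
      formI[of "\<lambda>i j. if i = 0 \<and> j = 0 then a 0 0 else 0"]; simp add: a)+
  have 2: "G2 (x, y, z) = (\<Sum>j\<le>d. a 0 (Suc j) * y ^ j * z ^ (d - j))" for x y z
    by (simp add: G2_def sum.atMost_shift[of _ d])
  have 3: "G3 (x, y, z) = a 0 0 * z ^ d" for x y z
    by (simp add: G3_def sum.atMost_shift)
  have "G (x, y, z) = x * G1 (x, y, z) + y * G2 (x, y, z) + z * G3 (x, y, z)" for x y z
    unfolding 2 3 G1_def a(2)[rule_format]
    by (simp add: sum.atMost_Suc_shift sum_distrib_left mult_ac add_ac del: sum.atMost_Suc)
  then show ?thesis by (intro that[OF f]) blast
qed

lemma form_mult: "form d G \<Longrightarrow> form e H \<Longrightarrow> form (d + e) (\<lambda>v. G v * H v)"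
proof (induction d arbitrary: G)
  case 0
  then show ?case by (auto simp: form_0_iff intro: form_scale)
next
  case (Suc d)
  from Suc.prems(1) obtain G1 G2 G3 where f: "form d G1" "form d G2" "form d G3"
    and G: "\<forall>x y z. G (x, y, z) = x * G1 (x, y, z) + y * G2 (x, y, z) + z * G3 (x, y, z)"
    by (rule form_SucE)
  have f': "form (d + e) (\<lambda>v. G1 v * H v)" "form (d + e) (\<lambda>v. G2 v * H v)"
    "form (d + e) (\<lambda>v. G3 v * H v)"
    by (rule Suc.IH[OF _ Suc.prems(2)], rule f)+
  have "form (Suc (d + e)) (\<lambda>v. (case v of (x, y, z) \<Rightarrow> x * (G1 (x, y, z) * H (x, y, z))) +
     (case v of (x, y, z) \<Rightarrow> y * (G2 (x, y, z) * H (x, y, z))) +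
     (case v of (x, y, z) \<Rightarrow> z * (G3 (x, y, z) * H (x, y, z))))"
    by (intro form_add form_X_mult[OF f'(1)] form_Y_mult[OF f'(2)] form_Z_mult[OF f'(3)])
  then have "form (Suc (d + e)) (\<lambda>v. G v * H v)"
    by (rule form_cong) (simp add: G algebra_simps)
  then show ?case by simp
qed

lemma form_power: "form d G \<Longrightarrow> form (n * d) (\<lambda>v. G v ^ n)"
proof (induction n)
  case 0
  then show ?case by (auto simp: form_0_iff)
next
  case (Suc n)
  then show ?case using form_mult[of d G "n * d" "\<lambda>v. G v ^ n"] by simp
qed

lemma form_const: "c \<in> Qbar \<Longrightarrow> form 0 (\<lambda>_. c)"
  by (auto simp: form_0_iff)

lemma form_linear:
  assumes "a \<in> Qbar" "b \<in> Qbar" "c \<in> Qbar"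
  shows "form (Suc 0) (\<lambda>(x, y, z). a * x + b * y + c * z)"
proof -
  have "form (Suc 0) (\<lambda>v. (case v of (x, y, z) \<Rightarrow> x * a) + (case v of (x, y, z) \<Rightarrow> y * b) + (case v of (x, y, z) \<Rightarrow> z * c))"
    using assms
    by (intro form_add form_X_mult[where G = "\<lambda>_. a"] form_Y_mult[where G = "\<lambda>_. b"]
        form_Z_mult[where G = "\<lambda>_. c"] form_const)
  then show ?thesis by (rule form_cong) (simp add: algebra_simps)
qed

lemma form_homogeneous: "form d G \<Longrightarrow> G (c * x, c * y, c * z) = c ^ d * G (x, y, z)"
proof (induction d arbitrary: G)
  case 0
  then show ?case by (auto simp: form_0_iff)
next
  case (Suc d)
  from Suc.prems obtain G1 G2 G3 where f: "form d G1" "form d G2" "form d G3"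
    and G: "\<forall>x y z. G (x, y, z) = x * G1 (x, y, z) + y * G2 (x, y, z) + z * G3 (x, y, z)"
    by (rule form_SucE)
  from Suc.IH[OF f(1)] Suc.IH[OF f(2)] Suc.IH[OF f(3)] show ?case
    by (simp add: G algebra_simps)
qed

section \<open>Irreducibility of the curve\<close>

abbreviation bform_sum :: "nat \<Rightarrow> (nat \<Rightarrow> complex) \<Rightarrow> complex \<Rightarrow> complex \<Rightarrow> complex" where
  "bform_sum m c y z \<equiv> \<Sum>j\<le>m. c j * y ^ j * z ^ (m - j)"

text \<open>Binary forms in y and z: the coefficients of 1, x, x^2, x^3 when a form is reduced
  modulo the equation of the curve.\<close>

definition bform :: "nat \<Rightarrow> (complex \<Rightarrow> complex \<Rightarrow> complex) \<Rightarrow> bool" where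
  "bform m a \<longleftrightarrow> (\<exists>c :: nat \<Rightarrow> complex. \<forall>y z. a y z = bform_sum m c y z)"

lemma bform_zero: "bform m (\<lambda>_ _. 0)"
  unfolding bform_def by (rule exI[of _ "\<lambda>_. 0"]) simp

lemma bform_add:
  assumes "bform m a" "bform m b" shows "bform m (\<lambda>y z. a y z + b y z)"
proof -
  obtain c where c: "\<forall>y z. a y z = bform_sum m c y z"
    using assms(1) unfolding bform_def by blast
  obtain d where d: "\<forall>y z. b y z = bform_sum m d y z"
    using assms(2) unfolding bform_def by blast
  show ?thesis
    unfolding bform_def
    by (rule exI[of _ "\<lambda>j. c j + d j"]) (simp add: c d sum.distrib distrib_right)
qed

lemma bform_scale:
  assumes "bform m a" shows "bform m (\<lambda>y z. k * a y z)"
proof -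
  obtain c where c: "\<forall>y z. a y z = bform_sum m c y z"
    using assms(1) unfolding bform_def by blast
  show ?thesis
    unfolding bform_def
    by (rule exI[of _ "\<lambda>j. k * c j"]) (simp add: c sum_distrib_left mult.assoc)
qed

lemma bform_y_mult:
  assumes "bform m a" shows "bform (Suc m) (\<lambda>y z. y * a y z)"
proof -
  obtain c where c: "\<forall>y z. a y z = bform_sum m c y z"
    using assms(1) unfolding bform_def by blast
  show ?thesis
    unfolding bform_def
    by (rule exI[of _ "\<lambda>j. if j = 0 then 0 else c (j - 1)"])
      (simp add: c sum.atMost_Suc_shift sum_distrib_left mult_ac del: sum.atMost_Suc)
qed

lemma bform_z_mult:
  assumes "bform m a" shows "bform (Suc m) (\<lambda>y z. z * a y z)"
proof -
  obtain c where c: "\<forall>y z. a y z = bform_sum m c y z"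
    using assms(1) unfolding bform_def by blast
  have "(\<Sum>j\<le>m. c j * y ^ j * z ^ (Suc m - j)) = (\<Sum>j\<le>m. z * (c j * y ^ j * z ^ (m - j)))" for y z
    by (rule sum.cong) (auto simp: Suc_diff_le)
  then show ?thesis
    unfolding bform_def
    by (intro exI[of _ "\<lambda>j. if j \<le> m then c j else 0"]) (simp add: c sum_distrib_left)
qed

lemma bform_eq_0:
  assumes "bform m a" "infinite {y. a y 1 = 0}" shows "a y z = 0"
proof -
  obtain c where c: "\<forall>y z. a y z = bform_sum m c y z"
    using assms(1) unfolding bform_def by blast
  define p where "p = (\<Sum>j\<le>m. monom (c j) j)"
  have "poly p y = a y 1" for y
    by (simp add: p_def c poly_sum poly_monom)
  then have "p = 0"
    using assms(2) poly_roots_finite[of p] by auto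
  moreover have "coeff p j = c j" if "j \<le> m" for j
    using that by (simp add: p_def coeff_sum)
  ultimately have "c j = 0" if "j \<le> m" for j
    using that by simp
  then show ?thesis by (simp add: c)
qed

definition normal_form where
  "normal_form d M G a0 a1 a2 a3 \<longleftrightarrow> bform (d + 3) a0 \<and> bform (d + 2) a1 \<and> bform (d + 1) a2 \<and> bform d a3 \<and>
    (\<forall>x y z. x ^ 4 + y ^ 4 = z ^ 4 \<longrightarrow>
       M y z * G (x, y, z) = a0 y z + a1 y z * x + a2 y z * x ^ 2 + a3 y z * x ^ 3)"

lemma normal_formD:
  assumes "normal_form d M G a0 a1 a2 a3"
  shows "bform (d + 3) a0" "bform (d + 2) a1" "bform (d + 1) a2" "bform d a3"
    "\<forall>x y z. x ^ 4 + y ^ 4 = z ^ 4 \<longrightarrow>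
       M y z * G (x, y, z) = a0 y z + a1 y z * x + a2 y z * x ^ 2 + a3 y z * x ^ 3"
  using assms by (simp_all add: normal_form_def)

text \<open>Multiplying by \<open>y\<^sup>3\<close> or \<open>z\<^sup>3\<close> first makes room for the normal form modulo
  \<open>x\<^sup>4 = z\<^sup>4 - y\<^sup>4\<close> when the degree is below 3.\<close>

lemma form_normal_form:
  assumes "form d G" "bform 3 M"
  shows "\<exists>a0 a1 a2 a3. normal_form d M G a0 a1 a2 a3"
  using assms(1)
proof (induction d arbitrary: G)
  case 0
  then obtain c where c: "G = (\<lambda>_. c)" by (auto simp: form_0_iff)
  show ?case
    using assms(2)
    by (intro exI[of _ "\<lambda>y z. c * M y z"] exI[of _ "\<lambda>_ _. 0"])
      (simp add: normal_form_def c bform_zero bform_scale)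
next
  case (Suc d)
  obtain G1 G2 G3 where f: "form d G1" "form d G2" "form d G3"
    and G: "\<forall>x y z. G (x, y, z) = x * G1 (x, y, z) + y * G2 (x, y, z) + z * G3 (x, y, z)"
    using Suc.prems by (rule form_SucE)
  obtain a0 a1 a2 a3 where a: "normal_form d M G1 a0 a1 a2 a3"
    using Suc.IH[OF f(1)] by blast
  note a = normal_formD[OF a]
  obtain b0 b1 b2 b3 where b: "normal_form d M G2 b0 b1 b2 b3"
    using Suc.IH[OF f(2)] by blast
  note b = normal_formD[OF b]
  obtain c0 c1 c2 c3 where c: "normal_form d M G3 c0 c1 c2 c3"
    using Suc.IH[OF f(3)] by blast
  note c = normal_formD[OF c]
  \<comment> \<open>Multiplication by x moves a3 to x^4 = z^4 - y^4, which returns to the constant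
    coefficient. Powers are written as nested products to match \<open>bform_y_mult\<close> and
    \<open>bform_z_mult\<close>.\<close>
  define e0 where "e0 = (\<lambda>y z. (z * (z * (z * (z * a3 y z))) + (-1) * (y * (y * (y * (y * a3 y z))))) + (y * b0 y z + z * c0 y z))"
  define e1 where "e1 = (\<lambda>y z. a0 y z + (y * b1 y z + z * c1 y z))"
  define e2 where "e2 = (\<lambda>y z. a1 y z + (y * b2 y z + z * c2 y z))"
  define e3 where "e3 = (\<lambda>y z. a2 y z + (y * b3 y z + z * c3 y z))"
  have "bform (Suc d + 3) e0"
  proof -
    have "bform (Suc (Suc (Suc (Suc d)))) (\<lambda>y z. z * (z * (z * (z * a3 y z))) + (-1) * (y * (y * (y * (y * a3 y z)))))"
      by (intro bform_add bform_scale bform_y_mult bform_z_mult a(4))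
    moreover have "Suc (Suc (Suc (Suc d))) = Suc d + 3" by simp
    ultimately have 1: "bform (Suc d + 3) (\<lambda>y z. z * (z * (z * (z * a3 y z))) + (-1) * (y * (y * (y * (y * a3 y z)))))"
      by metis
    have "bform (Suc (d + 3)) (\<lambda>y z. y * b0 y z + z * c0 y z)"
      by (intro bform_add bform_y_mult bform_z_mult b c)
    then have 2: "bform (Suc d + 3) (\<lambda>y z. y * b0 y z + z * c0 y z)"
      by simp
    show ?thesis
      unfolding e0_def by (rule bform_add[OF 1 2])
  qed
  moreover have "bform (Suc d + 2) e1"
  proof -
    have "bform (Suc (d + 2)) (\<lambda>y z. y * b1 y z + z * c1 y z)"
      by (intro bform_add bform_y_mult bform_z_mult b c)
    then have "bform (Suc d + 2) (\<lambda>y z. y * b1 y z + z * c1 y z)" by simp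
    moreover have "bform (Suc d + 2) a0" using a(1) by (simp add: numeral_3_eq_3)
    ultimately show ?thesis
      unfolding e1_def by (intro bform_add[of _ a0])
  qed
  moreover have "bform (Suc d + 1) e2"
  proof -
    have "bform (Suc (d + 1)) (\<lambda>y z. y * b2 y z + z * c2 y z)"
      by (intro bform_add bform_y_mult bform_z_mult b c)
    then have "bform (Suc d + 1) (\<lambda>y z. y * b2 y z + z * c2 y z)" by simp
    moreover have "bform (Suc d + 1) a1" using a(2) by simp
    ultimately show ?thesis
      unfolding e2_def by (intro bform_add[of _ a1])
  qed
  moreover have "bform (Suc d) e3"
    unfolding e3_def using a(3) by (intro bform_add bform_y_mult bform_z_mult b c) simp
  moreover have "M y z * G (x, y, z) = e0 y z + e1 y z * x + e2 y z * x ^ 2 + e3 y z * x ^ 3"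
    if h: "x ^ 4 + y ^ 4 = z ^ 4" for x y z
  proof -
    have "M y z * G (x, y, z) = x * (M y z * G1 (x, y, z)) + y * (M y z * G2 (x, y, z)) + z * (M y z * G3 (x, y, z))"
      by (simp add: G algebra_simps)
    also have "\<dots> = x * (a0 y z + a1 y z * x + a2 y z * x ^ 2 + a3 y z * x ^ 3)
      + y * (b0 y z + b1 y z * x + b2 y z * x ^ 2 + b3 y z * x ^ 3)
      + z * (c0 y z + c1 y z * x + c2 y z * x ^ 2 + c3 y z * x ^ 3)"
      using h a(5) b(5) c(5) by simp
    also have "\<dots> = e0 y z + e1 y z * x + e2 y z * x ^ 2 + e3 y z * x ^ 3 + a3 y z * (x ^ 4 + y ^ 4 - z ^ 4)"
      unfolding e0_def e1_def e2_def e3_def by (simp add: algebra_simps eval_nat_numeral)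
    finally show ?thesis using h by simp
  qed
  ultimately show ?case unfolding normal_form_def by blast
qed

text \<open>Irreducibility comes from the analytic arc \<open>(x, branch x, 1)\<close>, on which the product of two
  nonzero holomorphic functions is nonzero, and which determines a form on the whole curve.\<close>

definition branch :: "complex \<Rightarrow> complex" where
  "branch x = (1 - x ^ 4) powr (1 / 4)"

lemma one_minus_power4_nz: "norm x < 1 \<Longrightarrow> 1 - x ^ 4 \<noteq> (0 :: complex)"
  using power_strict_mono[of "norm x" 1 4] by (auto simp flip: norm_power)

lemma branch_power4: "norm x < 1 \<Longrightarrow> x ^ 4 + branch x ^ 4 = 1"
  using one_minus_power4_nz[of x]
  by (simp add: branch_def powr_def flip: exp_of_nat_mult)

lemma branch_holomorphic: "branch holomorphic_on ball 0 1"
proof -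
  have "1 - x ^ 4 \<notin> \<real>\<^sub>\<le>\<^sub>0" if "x \<in> ball 0 1" for x :: complex
  proof -
    have "norm (x ^ 4) < 1"
      using that by (simp add: norm_power power_less_one_iff)
    then have "Re (x ^ 4) < 1"
      using complex_Re_le_cmod[of "x ^ 4"] by linarith
    then show ?thesis by (auto simp: complex_nonpos_Reals_iff)
  qed
  then show ?thesis
    unfolding branch_def by (intro holomorphic_intros) auto
qed

lemma form_branch_holomorphic:
  "form d G \<Longrightarrow> (\<lambda>x. G (x, branch x, 1)) holomorphic_on ball 0 1"
proof (induction d arbitrary: G)
  case 0
  then obtain c where "G = (\<lambda>_. c)" by (auto simp: form_0_iff)
  then show ?case by simp
next
  case (Suc d)
  obtain G1 G2 G3 where f: "form d G1" "form d G2" "form d G3"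
    and G: "\<forall>x y z. G (x, y, z) = x * G1 (x, y, z) + y * G2 (x, y, z) + z * G3 (x, y, z)"
    using Suc.prems by (rule form_SucE)
  show ?case
    unfolding G[rule_format]
    by (intro holomorphic_intros branch_holomorphic Suc.IH f)
qed

text \<open>Fourier inversion on Z/4: the values at x, -x, \<i> x, -\<i> x determine the four
  coefficients, which suitable sums and differences isolate one after another.\<close>

lemma four_rotations_zero:
  fixes x :: complex
  assumes "\<And>w. w ^ 4 = x ^ 4 \<Longrightarrow> a + b * w + c * w ^ 2 + d * w ^ 3 = 0" "x \<noteq> 0"
  shows "a = 0 \<and> b = 0 \<and> c = 0 \<and> d = 0"
proof -
  have p: "\<i> ^ 4 = 1" "\<i> ^ 3 = - \<i>" by (simp_all add: power4_eq_xxxx power3_eq_cube)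
  have 1: "a + b * x + c * x ^ 2 + d * x ^ 3 = 0"
    by (rule assms) simp
  have 2: "a - b * x + c * x ^ 2 - d * x ^ 3 = 0"
    using assms(1)[of "- x"] by simp
  have 3: "a + b * (\<i> * x) - c * x ^ 2 - d * (\<i> * x ^ 3) = 0"
    using assms(1)[of "\<i> * x"] by (simp add: power_mult_distrib p)
  have 4: "a - b * (\<i> * x) - c * x ^ 2 + d * (\<i> * x ^ 3) = 0"
    using assms(1)[of "- (\<i> * x)"] by (simp add: power_mult_distrib p)
  have "4 * a = (a + b * x + c * x ^ 2 + d * x ^ 3) + (a - b * x + c * x ^ 2 - d * x ^ 3) +
    (a + b * (\<i> * x) - c * x ^ 2 - d * (\<i> * x ^ 3)) + (a - b * (\<i> * x) - c * x ^ 2 + d * (\<i> * x ^ 3))"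
    by (simp add: algebra_simps)
  then have a: "a = 0" by (simp only: 1 2 3 4) simp
  have "2 * (c * x ^ 2) = (a + b * x + c * x ^ 2 + d * x ^ 3) + (a - b * x + c * x ^ 2 - d * x ^ 3) - 2 * a"
    by (simp add: algebra_simps)
  then have "2 * (c * x ^ 2) = 0" unfolding 1 2 by (simp add: a)
  then have c: "c * x ^ 2 = 0" by simp
  have "2 * (b * x + d * x ^ 3) = (a + b * x + c * x ^ 2 + d * x ^ 3) - (a - b * x + c * x ^ 2 - d * x ^ 3)"
    by (simp add: algebra_simps)
  then have "2 * (b * x + d * x ^ 3) = 0" by (simp only: 1 2 diff_self)
  then have 5: "b * x + d * x ^ 3 = 0" by (metis mult_eq_0_iff zero_neq_numeral)
  have "2 * \<i> * (b * x - d * x ^ 3) = (a + b * (\<i> * x) - c * x ^ 2 - d * (\<i> * x ^ 3)) -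
     (a - b * (\<i> * x) - c * x ^ 2 + d * (\<i> * x ^ 3))"
    by (simp add: algebra_simps)
  then have "b * x - d * x ^ 3 = 0" by (simp only: 3 4) simp
  with 5 have "b * x = 0 \<and> d * x ^ 3 = 0" by simp
  with a c show ?thesis using assms(2) by simp
qed

text \<open>\<open>branch\<close> depends on x only through x^4, so for 0 < t < 1 the four points
  (\<i>^k t, branch t, 1) all lie on the arc. The normal form thus vanishes at four rotated values
  of x, which kills its four coefficients at y = branch t. This happens for infinitely many y, so
  the coefficients are zero as binary forms.\<close>

lemma form_zero_of_branch_zero:
  assumes "form d G" and zero: "\<And>x. norm x < 1 \<Longrightarrow> G (x, branch x, 1) = 0"
    and v: "x ^ 4 + y ^ 4 = z ^ 4"
  shows "G (x, y, z) = 0"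
proof -
  have MG: "M y z * G (x, y, z) = 0" if M: "bform 3 M" for M
  proof -
    obtain a0 a1 a2 a3 where a: "normal_form d M G a0 a1 a2 a3"
      using form_normal_form[OF assms(1) M] by blast
    note a = normal_formD[OF a]
    define Y where "Y = (\<lambda>t. branch (of_real t)) ` {0<..<1::real}"
    have "inj_on (\<lambda>t. branch (of_real t)) {0<..<1::real}"
    proof (rule inj_onI)
      fix s t :: real
      assume st: "s \<in> {0<..<1}" "t \<in> {0<..<1}" "branch (of_real s) = branch (of_real t)"
      then have "(of_real s :: complex) ^ 4 + branch (of_real t) ^ 4 = of_real t ^ 4 + branch (of_real t) ^ 4"
        using branch_power4[of "of_real s"] branch_power4[of "of_real t"] by simp
      then have "(of_real s :: complex) ^ 4 = of_real t ^ 4"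
        by (rule add_right_imp_eq)
      then have "s ^ 4 = t ^ 4" by (simp flip: of_real_power)
      with st show "s = t" by (simp add: power_eq_iff_eq_base)
    qed
    then have Y: "infinite Y"
      by (simp add: Y_def finite_image_iff)
    have van: "a0 y 1 = 0 \<and> a1 y 1 = 0 \<and> a2 y 1 = 0 \<and> a3 y 1 = 0" if "y \<in> Y" for y
    proof -
      obtain t :: real where t: "0 < t" "t < 1" "y = branch (of_real t)"
        using \<open>y \<in> Y\<close> by (auto simp: Y_def)
      show ?thesis
      proof (rule four_rotations_zero)
        show "(of_real t :: complex) \<noteq> 0" using t by simp
        fix w :: complex assume w: "w ^ 4 = of_real t ^ 4"
        then have "norm w ^ 4 = t ^ 4"
          using t by (metis norm_power norm_of_real abs_of_pos)
        then have "norm w = t" using t by (simp add: power_eq_iff_eq_base)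
        moreover have "branch w = y" using w t by (simp add: branch_def)
        ultimately have "G (w, y, 1) = 0" "w ^ 4 + y ^ 4 = 1"
          using zero[of w] branch_power4[of w] t by auto
        then show "a0 y 1 + a1 y 1 * w + a2 y 1 * w ^ 2 + a3 y 1 * w ^ 3 = 0"
          using a(5) by (metis mult_zero_right power_one)
      qed
    qed
    have sub: "Y \<subseteq> {y. a0 y 1 = 0}" "Y \<subseteq> {y. a1 y 1 = 0}" "Y \<subseteq> {y. a2 y 1 = 0}" "Y \<subseteq> {y. a3 y 1 = 0}"
      using van by auto
    have "a0 y z = 0" "a1 y z = 0" "a2 y z = 0" "a3 y z = 0"
      using bform_eq_0[OF a(1)] bform_eq_0[OF a(2)] bform_eq_0[OF a(3)] bform_eq_0[OF a(4)]
        infinite_super[OF sub(1) Y] infinite_super[OF sub(2) Y] infinite_super[OF sub(3) Y]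
        infinite_super[OF sub(4) Y] by auto
    then show ?thesis using a(5) v by simp
  qed
  have one: "bform 0 (\<lambda>_ _. 1)"
    unfolding bform_def by (rule exI[of _ "\<lambda>_. 1"]) simp
  have "bform 3 (\<lambda>y z. y * (y * (y * 1)))" "bform 3 (\<lambda>y z. z * (z * (z * 1)))"
    unfolding numeral_3_eq_3 by (intro bform_y_mult bform_z_mult one)+
  from MG[OF this(1)] MG[OF this(2)] have "y = 0 \<and> z = 0 \<or> G (x, y, z) = 0" by auto
  moreover have "G (0, 0, 0) = 0"
  proof (cases d)
    case 0
    then obtain c where "G = (\<lambda>_. c)" using assms(1) by (auto simp: form_0_iff)
    with zero[of 0] show ?thesis by simp
  next
    case (Suc e)
    with form_homogeneous[OF assms(1), of 0 0 0 0] show ?thesis by simp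
  qed
  ultimately show ?thesis using v by auto
qed

lemma F4_coordsD: "(x, y, z) \<in> F4_coords \<Longrightarrow> x ^ 4 + y ^ 4 = z ^ 4"
  by (simp add: F4_coords_def)

lemma branch_F4_coords:
  assumes "norm x < 1" "x \<in> Qbar" shows "(x, branch x, 1) \<in> F4_coords"
proof -
  have e: "branch x ^ 4 = 1 - x ^ 4"
    using branch_power4[OF assms(1)] by (simp add: algebra_simps)
  have "branch x ^ 4 \<in> Qbar"
    unfolding e using assms(2) by (intro Qbar_diff Qbar_power Qbar_1)
  then have "branch x \<in> Qbar" by (rule Qbar_powerD) simp
  then show ?thesis using assms e by (simp add: F4_coords_def)
qed

text \<open>One of the two factors vanishes at infinitely many points of a convergent sequence on
  the arc, hence on the arc by the identity theorem, hence on the curve by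
  \<open>form_zero_of_branch_zero\<close>.\<close>

lemma F4_irreducible:
  assumes "form d G" "form e H" "\<And>v. v \<in> F4_coords \<Longrightarrow> G v * H v = 0"
  shows "(\<forall>v\<in>F4_coords. G v = 0) \<or> (\<forall>v\<in>F4_coords. H v = 0)"
proof -
  \<comment> \<open>Rational parameters, because the hypothesis speaks of algebraic points only. The
    limit 0 is interior to the domain of \<open>branch\<close>, and the offset 2 keeps the first
    term inside the open disc.\<close>
  define u :: "nat \<Rightarrow> complex" where "u n = 1 / of_nat (n + 2)" for n
  have u: "norm (u n) < 1" "u n \<in> Qbar" "u n \<noteq> 0" for n
  proof -
    have "norm (u n) = 1 / real (n + 2)" by (simp only: u_def norm_divide norm_one norm_of_nat)
    then show "norm (u n) < 1" by simp
    have "of_nat (n + 2) \<noteq> (0 :: complex)" unfolding of_nat_eq_0_iff by simp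
    then show "u n \<noteq> 0" by (simp only: u_def divide_eq_0_iff one_neq_zero) simp
    show "u n \<in> Qbar" unfolding u_def by (intro Qbar_divide Qbar_1 Qbar_of_nat)
  qed
  have inj: "inj u" by (auto simp: inj_def u_def)
  have lim: "u \<longlonglongrightarrow> 0"
    unfolding u_def using LIMSEQ_ignore_initial_segment[OF lim_inverse_n, of 2]
    by (simp add: inverse_eq_divide)
  define NG where "NG = {n. G (u n, branch (u n), 1) = 0}"
  define NH where "NH = {n. H (u n, branch (u n), 1) = 0}"
  have "NG \<union> NH = UNIV"
    using assms(3)[OF branch_F4_coords[OF u(1,2)]] by (auto simp: NG_def NH_def)
  then have "infinite NG \<or> infinite NH"
    by (metis finite_UnI infinite_UNIV_nat)
  moreover have key: "\<forall>v\<in>F4_coords. K v = 0"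
    if K: "form k K" and N: "infinite {n. K (u n, branch (u n), 1) = 0}" for k K
  proof -
    let ?N = "{n. K (u n, branch (u n), 1) = 0}"
    have "0 islimpt u ` ?N"
      unfolding islimpt_sequential
    proof (intro exI[of _ "u \<circ> enumerate ?N"] conjI allI)
      show "(u \<circ> enumerate ?N) \<longlonglongrightarrow> 0"
        using lim strict_mono_enumerate[OF N] by (rule LIMSEQ_subseq_LIMSEQ)
      show "(u \<circ> enumerate ?N) n \<in> u ` ?N - {0}" for n
        using enumerate_in_set[OF N, of n] u(3) by simp
    qed
    moreover have "u ` ?N \<subseteq> ball 0 1" using u(1) by (auto simp: image_subset_iff)
    ultimately have "K (x, branch x, 1) = 0" if "norm x < 1" for x
      using that by (intro analytic_continuation[OF form_branch_holomorphic[OF K], of "u ` ?N" 0 x]) auto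
    then show ?thesis
      using form_zero_of_branch_zero[OF K] F4_coordsD by auto
  qed
  ultimately show ?thesis
    using key[OF assms(1)] key[OF assms(2)] unfolding NG_def NH_def by blast
qed

section \<open>Local rings and orders\<close>

lemma form_diff: "form d G \<Longrightarrow> form d H \<Longrightarrow> form d (\<lambda>v. G v - H v)"
  using form_add[of d G "\<lambda>v. (-1) * H v"] form_scale[of "-1" d H] Qbar_minus[OF Qbar_1] by simp

lemma forms_nonzero_mult:
  assumes "form d G" "form e H" "nonvanishing G" "nonvanishing H"
  shows "nonvanishing (\<lambda>v. G v * H v)"
  using F4_irreducible[OF assms(1,2)] assms(3,4) by blast

lemma form_cancel:
  assumes "form d G" "nonvanishing G" "form e A" "form e B"
    "\<And>v. v \<in> F4_coords \<Longrightarrow> G v * A v = G v * B v" "v \<in> F4_coords"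
  shows "A v = B v"
proof -
  have "\<And>v. v \<in> F4_coords \<Longrightarrow> G v * (A v - B v) = 0"
    using assms(5) by (simp add: algebra_simps)
  then show ?thesis
    using F4_irreducible[OF assms(1) form_diff[OF assms(3,4)]] assms(2,6) by auto
qed

lemma proj_self: "v \<in> proj v"
  by (cases v) (auto simp: proj_def intro: exI[of _ 1])

lemma projE:
  assumes "w \<in> proj (x, y, z)"
  obtains c where "c \<in> Qbar" "c \<noteq> 0" "w = (c * x, c * y, c * z)"
  using assms by (auto simp: proj_def)

lemma form_zero_proj: "form d G \<Longrightarrow> w \<in> proj v \<Longrightarrow> G w = 0 \<longleftrightarrow> G v = 0"
  by (cases v) (auto elim!: projE simp: form_homogeneous)

lemma F4E:
  assumes "P \<in> F4" obtains v where "v \<in> F4_coords" "P = proj v"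
  using assms by (auto simp: F4_def)

lemma proj_in_F4: "v \<in> F4_coords \<Longrightarrow> proj v \<in> F4"
  by (auto simp: F4_def)

lemma F4_coords_scale:
  assumes "(x, y, z) \<in> F4_coords" "c \<in> Qbar" "c \<noteq> 0"
  shows "(c * x, c * y, c * z) \<in> F4_coords"
  using assms by (auto simp: F4_coords_def power_mult_distrib simp flip: distrib_left)

lemma proj_scale:
  assumes "c \<in> Qbar" "c \<noteq> 0" shows "proj (c * x, c * y, c * z) = proj (x, y, z)"
proof -
  have "\<exists>d. (e * (c * x), e * (c * y), e * (c * z)) = (d * x, d * y, d * z) \<and> d \<in> Qbar \<and> d \<noteq> 0"
    if "e \<in> Qbar" "e \<noteq> 0" for e
    using that assms by (intro exI[of _ "e * c"]) auto
  moreover have "\<exists>d. (e * x, e * y, e * z) = (d * (c * x), d * (c * y), d * (c * z)) \<and> d \<in> Qbar \<and> d \<noteq> 0"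
    if "e \<in> Qbar" "e \<noteq> 0" for e
    using that assms by (intro exI[of _ "e / c"]) auto
  ultimately show ?thesis
    unfolding proj_def by (simp only: prod.case) blast
qed

subsection \<open>Rational functions\<close>

lemma rat_eqI:
  assumes "form d E" "nonvanishing E" "\<And>v. v \<in> F4_coords \<Longrightarrow> E v \<noteq> 0 \<Longrightarrow> f v = g v"
  shows "rat_eq f g"
  using assms unfolding rat_eq_def by blast

lemma F4_coords_nonempty: "(0, 1, 1) \<in> F4_coords"
  by (simp add: F4_coords_def)

lemma rat_eq_refl: "(\<And>v. f v = g v) \<Longrightarrow> rat_eq f g"
  using F4_coords_nonempty by (intro rat_eqI[OF form_const[OF Qbar_1]]) auto

text \<open>Irreducibility enters here: two nonempty basic open sets meet. This makes
  \<open>rat_eq\<close> transitive and compatible with products.\<close>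

lemma rat_eq_common:
  assumes "rat_eq f g" "rat_eq f' g'"
  obtains d E where "form d E" "nonvanishing E"
    "\<forall>v\<in>F4_coords. E v \<noteq> 0 \<longrightarrow> f v = g v \<and> f' v = g' v"
proof -
  obtain d E where E: "form d E" "nonvanishing E" "\<forall>v\<in>F4_coords. E v \<noteq> 0 \<longrightarrow> f v = g v"
    using assms(1) unfolding rat_eq_def by blast
  obtain d' E' where E': "form d' E'" "nonvanishing E'" "\<forall>v\<in>F4_coords. E' v \<noteq> 0 \<longrightarrow> f' v = g' v"
    using assms(2) unfolding rat_eq_def by blast
  show ?thesis
    by (rule that[OF form_mult[OF E(1) E'(1)] forms_nonzero_mult[OF E(1) E'(1) E(2) E'(2)]])
      (use E(3) E'(3) in auto)
qed

lemma rat_eq_trans: "rat_eq f g \<Longrightarrow> rat_eq g h \<Longrightarrow> rat_eq f h"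
  by (erule (1) rat_eq_common, rule rat_eqI) auto

lemma rat_eq_mult: "rat_eq f g \<Longrightarrow> rat_eq f' g' \<Longrightarrow> rat_eq (\<lambda>v. f v * f' v) (\<lambda>v. g v * g' v)"
  by (erule (1) rat_eq_common, rule rat_eqI) auto

lemma rat_eq_powi: "rat_eq f g \<Longrightarrow> rat_eq (\<lambda>v. f v powi n) (\<lambda>v. g v powi n)"
  unfolding rat_eq_def by metis

lemma local_ringI:
  "form d G \<Longrightarrow> form d H \<Longrightarrow> \<forall>v\<in>P. H v \<noteq> 0 \<Longrightarrow> (\<lambda>v. G v / H v) \<in> local_ring P"
  unfolding local_ring_def by blast

lemma local_ringE:
  assumes "f \<in> local_ring P"
  obtains d G H where "form d G" "form d H" "\<forall>v\<in>P. H v \<noteq> 0" "f = (\<lambda>v. G v / H v)"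
  using assms unfolding local_ring_def by blast

lemma local_unitsI:
  "form d G \<Longrightarrow> form d H \<Longrightarrow> \<forall>v\<in>P. H v \<noteq> 0 \<Longrightarrow> \<forall>v\<in>P. G v \<noteq> 0 \<Longrightarrow> (\<lambda>v. G v / H v) \<in> local_units P"
  unfolding local_units_def using local_ringI[of d G H P] by simp

lemma local_unitsE:
  assumes "f \<in> local_units P"
  obtains d G H where "form d G" "form d H" "\<forall>v\<in>P. H v \<noteq> 0" "\<forall>v\<in>P. G v \<noteq> 0" "f = (\<lambda>v. G v / H v)"
  using assms unfolding local_units_def by (auto elim!: local_ringE)

lemma local_units_mult:
  assumes "f \<in> local_units P" "g \<in> local_units P" shows "(\<lambda>v. f v * g v) \<in> local_units P"
proof -
  obtain d G H where f: "form d G" "form d H" "\<forall>v\<in>P. H v \<noteq> 0" "\<forall>v\<in>P. G v \<noteq> 0" "f = (\<lambda>v. G v / H v)"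
    using assms(1) by (rule local_unitsE)
  obtain d' G' H' where g: "form d' G'" "form d' H'" "\<forall>v\<in>P. H' v \<noteq> 0" "\<forall>v\<in>P. G' v \<noteq> 0" "g = (\<lambda>v. G' v / H' v)"
    using assms(2) by (rule local_unitsE)
  show ?thesis
    using local_unitsI[OF form_mult[OF f(1) g(1)] form_mult[OF f(2) g(2)]] f g
    by simp
qed

lemma local_units_one: "(\<lambda>_. 1) \<in> local_units P"
  using local_unitsI[OF form_const[OF Qbar_1] form_const[OF Qbar_1]] by simp

lemma local_units_inverse:
  assumes "f \<in> local_units P" shows "(\<lambda>v. inverse (f v)) \<in> local_units P"
proof -
  obtain d G H where f: "form d G" "form d H" "\<forall>v\<in>P. H v \<noteq> 0" "\<forall>v\<in>P. G v \<noteq> 0" "f = (\<lambda>v. G v / H v)"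
    using assms by (rule local_unitsE)
  then show ?thesis using local_unitsI[OF f(2,1)] by simp
qed

lemma local_units_power: "f \<in> local_units P \<Longrightarrow> (\<lambda>v. f v ^ n) \<in> local_units P"
  by (induction n) (simp_all add: local_units_one local_units_mult)

lemma local_units_powi: "f \<in> local_units P \<Longrightarrow> (\<lambda>v. f v powi n) \<in> local_units P"
  by (cases "n \<ge> 0") (simp_all add: power_int_def local_units_power local_units_inverse)

subsection \<open>Linear forms as local parameters\<close>

text \<open>Says that l generates the maximal ideal at v, with denominators cleared: U is a unit at
  v, and the degree equation makes U G = l H homogeneous. Nonvanishing of l on the curve is what
  permits cancelling it later.\<close>

definition unif :: "triple \<Rightarrow> (triple \<Rightarrow> complex) \<Rightarrow> bool" where
  "unif v l \<longleftrightarrow> form (Suc 0) l \<and> l v = 0 \<and> nonvanishing l \<and>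
    (\<forall>d G. form d G \<and> G v = 0 \<longrightarrow>
      (\<exists>e h U H. form e U \<and> form h H \<and> e + d = Suc h \<and> U v \<noteq> 0 \<and>
        (\<forall>w\<in>F4_coords. U w * G w = l w * H w)))"

lemma unifD: "unif v l \<Longrightarrow> form (Suc 0) l" "unif v l \<Longrightarrow> l v = 0" "unif v l \<Longrightarrow> nonvanishing l"
  by (auto simp: unif_def)

lemma unifE:
  assumes "unif v l" "form d G" "G v = 0"
  obtains e h U H where "form e U" "form h H" "e + d = Suc h" "U v \<noteq> 0"
    "\<forall>w\<in>F4_coords. U w * G w = l w * H w"
  using assms unfolding unif_def by blast

lemma power4_diff_factor: "(u - t) * (u ^ 3 + u ^ 2 * t + u * t ^ 2 + t ^ 3) = u ^ 4 - (t :: complex) ^ 4"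
  by (simp add: algebra_simps eval_nat_numeral)

text \<open>On the diagonal the cofactor becomes the derivative of the fourth power. This is how the
  gradient of the curve, and with it the tangent direction, enters
  \<open>unif_chart\<close>.\<close>

lemma power4_diff_cofactor_diag:
  "(t * u) ^ 3 + (t * u) ^ 2 * (u * t) + t * u * (u * t) ^ 2 + (u * t) ^ 3 = 4 * (t * u :: complex) ^ 3"
  by (simp add: algebra_simps eval_nat_numeral)

abbreviation linear_comb :: "(triple \<Rightarrow> complex) \<Rightarrow> (triple \<Rightarrow> complex) \<Rightarrow> (triple \<Rightarrow> complex) \<Rightarrow> nat \<Rightarrow>
    (triple \<Rightarrow> complex) \<Rightarrow> bool" where
  "linear_comb p q r d G \<equiv> \<exists>G1 G2 G3. form d G1 \<and> form d G2 \<and> form d G3 \<and>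
    (\<forall>w. G w = p w * G1 w + q w * G2 w + r w * G3 w)"

text \<open>In the chart \<open>r \<noteq> 0\<close> the linear forms \<open>r0 p - p0 r\<close> and \<open>r0 q - q0 r\<close> generate the forms
  vanishing at \<open>v\<close>, up to a power of the constant \<open>r0\<close>.\<close>

lemma form_vanishing_decomp:
  fixes p q r :: "triple \<Rightarrow> complex"
  assumes pqr: "form (Suc 0) p" "form (Suc 0) q" "form (Suc 0) r"
    and Qb: "p v \<in> Qbar" "q v \<in> Qbar" "r v \<in> Qbar"
    and dec: "\<And>d G. form (Suc d) G \<Longrightarrow> linear_comb p q r d G"
  shows "form (Suc d) G \<Longrightarrow> \<exists>A B. form d A \<and> form d B \<and>
     (\<forall>w. r v ^ Suc d * G w = (r v * p w - p v * r w) * A w + (r v * q w - q v * r w) * B w + r w ^ Suc d * G v)"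
proof (induction d arbitrary: G)
  case 0
  obtain G1 G2 G3 where G: "form 0 G1" "form 0 G2" "form 0 G3"
    "\<forall>w. G w = p w * G1 w + q w * G2 w + r w * G3 w"
    using dec[OF 0] by blast
  obtain c1 c2 c3 where "G1 = (\<lambda>_. c1)" "G2 = (\<lambda>_. c2)" "G3 = (\<lambda>_. c3)"
    using G(1-3) by (auto simp: form_0_iff)
  then have "r v ^ Suc 0 * G w = (r v * p w - p v * r w) * G1 w + (r v * q w - q v * r w) * G2 w + r w ^ Suc 0 * G v" for w
    unfolding G(4)[rule_format, of w] G(4)[rule_format, of v] by (simp add: algebra_simps)
  then show ?case using G(1,2) by blast
next
  case (Suc d)
  obtain G1 G2 G3 where G: "form (Suc d) G1" "form (Suc d) G2" "form (Suc d) G3"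
    "\<forall>w. G w = p w * G1 w + q w * G2 w + r w * G3 w"
    using dec[OF Suc.prems] by blast
  \<comment> \<open>Freezing the linear factors at v lowers the degree by one:
    \<open>r v * G - r * K\<close> is a combination of the two generators, and K and G agree at
    v.\<close>
  define K where "K = (\<lambda>w. p v * G1 w + q v * G2 w + r v * G3 w)"
  have "form (Suc d) K"
    unfolding K_def by (intro form_add form_scale Qb G(1-3))
  then obtain A B where AB: "form d A" "form d B"
    "\<forall>w. r v ^ Suc d * K w = (r v * p w - p v * r w) * A w + (r v * q w - q v * r w) * B w + r w ^ Suc d * K v"
    using Suc.IH by blast
  have r1: "form (Suc d) (\<lambda>w. r w * A w)" "form (Suc d) (\<lambda>w. r w * B w)"
    using form_mult[OF pqr(3) AB(1)] form_mult[OF pqr(3) AB(2)] by simp_all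
  have e: "r v ^ Suc (Suc d) * G w = (r v * p w - p v * r w) * (r v ^ Suc d * G1 w + r w * A w) +
     (r v * q w - q v * r w) * (r v ^ Suc d * G2 w + r w * B w) + r w ^ Suc (Suc d) * G v" for w
  proof -
    have "r v ^ Suc (Suc d) * G w = (r v * p w - p v * r w) * (r v ^ Suc d * G1 w) +
       (r v * q w - q v * r w) * (r v ^ Suc d * G2 w) + r w * (r v ^ Suc d * K w)"
      by (simp add: G(4)[rule_format, of w] K_def algebra_simps)
    also have "r v ^ Suc d * K w = (r v * p w - p v * r w) * A w + (r v * q w - q v * r w) * B w + r w ^ Suc d * G v"
      using AB(3)[rule_format, of w] by (simp only: K_def G(4)[rule_format, of v])
    finally show ?thesis by (simp add: algebra_simps)
  qed
  show ?case
    by (rule exI[of _ "\<lambda>w. r v ^ Suc d * G1 w + r w * A w"], rule exI[of _ "\<lambda>w. r v ^ Suc d * G2 w + r w * B w"])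
      (intro conjI form_add form_scale Qbar_power Qb G(1,2) r1 allI e)
qed

text \<open>\<open>W\<close> is the resultant of the linear form with the equation
  \<open>\<alpha> (r0 p - p0 r) S + \<beta> (r0 q - q0 r) T = 0\<close> of the curve;
  it does not vanish at \<open>v\<close> unless the linear form is tangent there.\<close>

lemma unif_chart:
  fixes p q r :: "triple \<Rightarrow> complex"
  assumes pqr: "form (Suc 0) p" "form (Suc 0) q" "form (Suc 0) r"
    and Qb: "p v \<in> Qbar" "q v \<in> Qbar" "r v \<in> Qbar"
    and dec: "\<And>d G. form (Suc d) G \<Longrightarrow> linear_comb p q r d G"
    and eq: "\<And>w. w \<in> F4_coords \<Longrightarrow> \<alpha> * p w ^ 4 + \<beta> * q w ^ 4 + \<gamma> * r w ^ 4 = 0"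
    and v: "v \<in> F4_coords" "r v \<noteq> 0"
    and ab: "a \<in> Qbar" "b \<in> Qbar" "\<alpha> \<in> Qbar" "\<beta> \<in> Qbar"
    and nt: "a * \<beta> * q v ^ 3 \<noteq> b * \<alpha> * p v ^ 3"
    and nz: "w0 \<in> F4_coords" "a * (r v * p w0 - p v * r w0) + b * (r v * q w0 - q v * r w0) \<noteq> 0"
  shows "unif v (\<lambda>w. a * (r v * p w - p v * r w) + b * (r v * q w - q v * r w))"
proof -
  define l1 where "l1 = (\<lambda>w. r v * p w - p v * r w)"
  define l2 where "l2 = (\<lambda>w. r v * q w - q v * r w)"
  define M where "M = (\<lambda>w. a * l1 w + b * l2 w)"
  define S where "S = (\<lambda>w. (r v * p w) ^ 3 + (r v * p w) ^ 2 * (p v * r w) + (r v * p w) * (p v * r w) ^ 2 + (p v * r w) ^ 3)"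
  define T where "T = (\<lambda>w. (r v * q w) ^ 3 + (r v * q w) ^ 2 * (q v * r w) + (r v * q w) * (q v * r w) ^ 2 + (q v * r w) ^ 3)"
  define W where "W = (\<lambda>w. a * (\<beta> * T w) - b * (\<alpha> * S w))"
  have pw: "form k (\<lambda>w. (c * f w) ^ k)" if "c \<in> Qbar" "form (Suc 0) f" for k c f
    using form_power[OF form_scale[OF that], of k] by simp
  have lin: "form (Suc 0) (\<lambda>w. c * f w)" if "c \<in> Qbar" "form (Suc 0) f" for c f
    using form_scale[OF that] .
  have "form 3 (\<lambda>w. (r v * f w) ^ 2 * (f v * r w))" if "form (Suc 0) f" "f v \<in> Qbar" for f
    using form_mult[OF pw[OF Qb(3) that(1), of 2] lin[OF that(2) pqr(3)]] by (simp add: numeral_3_eq_3)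
  moreover have "form 3 (\<lambda>w. (r v * f w) * (f v * r w) ^ 2)" if "form (Suc 0) f" "f v \<in> Qbar" for f
    using form_mult[OF lin[OF Qb(3) that(1)] pw[OF that(2) pqr(3), of 2]] by (simp add: numeral_3_eq_3)
  ultimately have ST: "form 3 S" "form 3 T"
    unfolding S_def T_def using pqr Qb by (auto intro!: form_add pw)
  have W: "form 3 W"
    unfolding W_def by (intro form_diff form_scale ab ST)
  have M: "form (Suc 0) M"
    unfolding M_def l1_def l2_def by (intro form_add form_diff form_scale ab Qb pqr)
  have rel: "\<alpha> * (l1 w * S w) + \<beta> * (l2 w * T w) = 0" if "w \<in> F4_coords" for w
  proof -
    have "l1 w * S w = (r v * p w) ^ 4 - (p v * r w) ^ 4" "l2 w * T w = (r v * q w) ^ 4 - (q v * r w) ^ 4"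
      unfolding l1_def l2_def S_def T_def by (rule power4_diff_factor)+
    then have "\<alpha> * (l1 w * S w) + \<beta> * (l2 w * T w) =
      r v ^ 4 * (\<alpha> * p w ^ 4 + \<beta> * q w ^ 4 + \<gamma> * r w ^ 4) - r w ^ 4 * (\<alpha> * p v ^ 4 + \<beta> * q v ^ 4 + \<gamma> * r v ^ 4)"
      by (simp add: power_mult_distrib ring_distribs mult_ac)
    then show ?thesis using eq[OF that] eq[OF v(1)] by simp
  qed
  \<comment> \<open>Cramer's rule for the two linear equations M = a l1 + b l2 and 0 = \<alpha> S l1
    + \<beta> T l2 in l1 and l2: W is their determinant, so W l1 and W l2 are multiples of M on the
    curve.\<close>
  have W1: "W w * l1 w = M w * (\<beta> * T w)" if "w \<in> F4_coords" for w
  proof -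
    have "W w * l1 w = M w * (\<beta> * T w) - b * (\<alpha> * (l1 w * S w) + \<beta> * (l2 w * T w))"
      unfolding W_def M_def by (simp add: algebra_simps)
    then show ?thesis using rel[OF that] by simp
  qed
  have W2: "W w * l2 w = - (M w * (\<alpha> * S w))" if "w \<in> F4_coords" for w
  proof -
    have "W w * l2 w = a * (\<alpha> * (l1 w * S w) + \<beta> * (l2 w * T w)) - M w * (\<alpha> * S w)"
      unfolding W_def M_def by (simp add: algebra_simps)
    then show ?thesis using rel[OF that] by simp
  qed
  have "S v = 4 * (r v * p v) ^ 3" "T v = 4 * (r v * q v) ^ 3"
    unfolding S_def T_def by (rule power4_diff_cofactor_diag)+
  then have "W v = 4 * r v ^ 3 * (a * \<beta> * q v ^ 3 - b * \<alpha> * p v ^ 3)"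
    by (simp add: W_def power_mult_distrib algebra_simps)
  then have Wv: "W v \<noteq> 0" using nt v(2) by simp
  have "unif v M"
    unfolding unif_def
  proof (intro conjI allI impI)
    show "form (Suc 0) M" by (rule M)
    show "M v = 0" by (simp add: M_def l1_def l2_def)
    show "nonvanishing M" using nz by (auto simp: M_def l1_def l2_def)
    fix d G assume "form d G \<and> G v = 0"
    then have G: "form d G" "G v = 0" by auto
    show "\<exists>e h U H. form e U \<and> form h H \<and> e + d = Suc h \<and> U v \<noteq> 0 \<and> (\<forall>w\<in>F4_coords. U w * G w = M w * H w)"
    proof (cases d)
      case 0
      then have "G = (\<lambda>_. 0)" using G by (auto simp: form_0_iff)
      \<comment> \<open>H has degree e + 0 - 1, so U needs degree 1; the form \<open>r\<close> is
        available and nonzero at v.\<close>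
      then show ?thesis
        using pqr(3) v(2) 0 form_zero[of 0]
        by (rule_tac exI[of _ "Suc 0"], rule_tac exI[of _ 0], rule_tac exI[of _ r], rule_tac exI[of _ "\<lambda>_. 0"]) simp
    next
      case (Suc k)
      obtain A B where AB: "form k A" "form k B"
        "\<forall>w. r v ^ Suc k * G w = (r v * p w - p v * r w) * A w + (r v * q w - q v * r w) * B w + r w ^ Suc k * G v"
        using form_vanishing_decomp[OF pqr Qb dec] G(1) Suc by blast
      have "form (3 + k) (\<lambda>w. (\<beta> * T w) * A w - (\<alpha> * S w) * B w)"
        by (intro form_diff form_mult form_scale ST AB ab)
      moreover have "form 3 (\<lambda>w. r v ^ Suc k * W w)"
        by (intro form_scale Qbar_power Qb W)
      moreover have "(r v ^ Suc k * W w) * G w = M w * ((\<beta> * T w) * A w - (\<alpha> * S w) * B w)" if "w \<in> F4_coords" for w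
      proof -
        have "r v ^ Suc k * G w = l1 w * A w + l2 w * B w"
          using AB(3)[rule_format, of w] G(2) by (simp add: l1_def l2_def)
        then have "(r v ^ Suc k * W w) * G w = W w * l1 w * A w + W w * l2 w * B w"
          by (metis (no_types, lifting) distrib_left mult.assoc mult.commute)
        also have "\<dots> = M w * ((\<beta> * T w) * A w - (\<alpha> * S w) * B w)"
          unfolding W1[OF that] W2[OF that] by (simp add: algebra_simps)
        finally show ?thesis .
      qed
      ultimately show ?thesis
        using Suc v(2) Wv
        by (rule_tac exI[of _ 3], rule_tac exI[of _ "3 + k"], rule_tac exI[of _ "\<lambda>w. r v ^ Suc k * W w"],
            rule_tac exI[of _ "\<lambda>w. (\<beta> * T w) * A w - (\<alpha> * S w) * B w"]) simp
    qed
  qed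
  then show ?thesis by (simp add: M_def l1_def l2_def)
qed

text \<open>Three noncollinear points of the curve suffice.\<close>

lemma linear_form_nonzero:
  assumes "(a, b, c) \<noteq> (0, 0, 0)"
  shows "nonvanishing (\<lambda>w. (\<lambda>(x, y, z). a * x + b * y + c * z) w)"
proof (rule ccontr)
  assume "\<not> ?thesis"
  then have z: "\<forall>w\<in>F4_coords. (\<lambda>(x, y, z). a * x + b * y + c * z) w = 0" by blast
  have "(0, 1, 1) \<in> F4_coords" "(0, -1, 1) \<in> F4_coords" "(1, 0, 1) \<in> F4_coords"
    by (auto simp: F4_coords_def)
  with z have "b + c = 0" "c - b = 0" "a + c = 0" by fastforce+
  moreover have "2 * c = (b + c) + (c - b)" by simp
  ultimately have "c = 0" by (simp only:) simp
  with \<open>b + c = 0\<close> \<open>a + c = 0\<close> assms show False by simp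
qed

lemma form_coords: "form (Suc 0) fst" "form (Suc 0) (\<lambda>v. fst (snd v))" "form (Suc 0) (\<lambda>v. snd (snd v))"
  using form_linear[OF Qbar_1 Qbar_0 Qbar_0] form_linear[OF Qbar_0 Qbar_1 Qbar_0]
    form_linear[OF Qbar_0 Qbar_0 Qbar_1]
  by (auto intro: form_cong)

lemma F4_coords_Qbar: "(x, y, z) \<in> F4_coords \<Longrightarrow> x \<in> Qbar" "(x, y, z) \<in> F4_coords \<Longrightarrow> y \<in> Qbar"
  "(x, y, z) \<in> F4_coords \<Longrightarrow> z \<in> Qbar"
  by (auto simp: F4_coords_def)

lemma form_SucE':
  assumes "form (Suc d) G"
  shows "linear_comb fst (\<lambda>v. fst (snd v)) (\<lambda>v. snd (snd v)) d G"
  by (rule form_SucE[OF assms]) auto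

text \<open>The gradient at v is proportional to (x0^3, y0^3) in the affine coordinates, so
  \<open>nt\<close> says that the line through v is not the tangent. The constant z0 in front comes
  from the chart, where the generators are z0 x - x0 z and z0 y - y0 z.\<close>

lemma unif_affine:
  assumes v: "(x0, y0, z0) \<in> F4_coords" and ab: "a \<in> Qbar" "b \<in> Qbar" and "z0 \<noteq> 0"
    and nt: "a * y0 ^ 3 \<noteq> b * x0 ^ 3" and c: "c * z0 = - (a * x0 + b * y0)"
  shows "unif (x0, y0, z0) (\<lambda>(x, y, z). z0 * (a * x + b * y + c * z))"
proof -
  let ?v = "(x0, y0, z0)"
  define p q r where pqr: "p = (fst :: triple \<Rightarrow> complex)" "q = (\<lambda>v :: triple. fst (snd v))"
    "r = (\<lambda>v :: triple. snd (snd v))"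
  have e: "a * (r ?v * p w - p ?v * r w) + b * (r ?v * q w - q ?v * r w) =
    (\<lambda>(x, y, z). z0 * (a * x + b * y + c * z)) w" for w
  proof -
    obtain x y z where w: "w = (x, y, z)" by (cases w)
    have "z0 * (a * x + b * y + c * z) = z0 * (a * x + b * y) + (c * z0) * z" by (simp add: algebra_simps)
    then show ?thesis unfolding c w by (simp add: pqr algebra_simps)
  qed
  have "(a, b, c) \<noteq> (0, 0, 0)" using nt by auto
  then obtain w0 where w0: "w0 \<in> F4_coords" "(\<lambda>(x, y, z). a * x + b * y + c * z) w0 \<noteq> 0"
    using linear_form_nonzero by blast
  have "unif ?v (\<lambda>w. a * (r ?v * p w - p ?v * r w) + b * (r ?v * q w - q ?v * r w))"
  proof (rule unif_chart[where \<alpha> = 1 and \<beta> = 1 and \<gamma> = "-1"])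
    show "form (Suc 0) p" "form (Suc 0) q" "form (Suc 0) r"
      unfolding pqr by (rule form_coords)+
    show "p ?v \<in> Qbar" "q ?v \<in> Qbar" "r ?v \<in> Qbar"
      using F4_coords_Qbar[OF v] by (auto simp: pqr)
    show "linear_comb p q r d G"
      if "form (Suc d) G" for d G
      unfolding pqr using form_SucE'[OF that] .
    show "1 * p w ^ 4 + 1 * q w ^ 4 + - 1 * r w ^ 4 = 0" if "w \<in> F4_coords" for w
      using that by (auto simp: F4_coords_def pqr)
    show "a * (r ?v * p w0 - p ?v * r w0) + b * (r ?v * q w0 - q ?v * r w0) \<noteq> 0"
      unfolding e using w0(2) \<open>z0 \<noteq> 0\<close> by (simp add: split_beta)
  qed (use assms w0 in \<open>auto simp: pqr\<close>)
  then show ?thesis unfolding e .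
qed

text \<open>The chart y \<noteq> 0 with coordinates x and z, where the curve reads x^4 - z^4 + y^4 =
  0. The line z = 0 is transverse because x0 \<noteq> 0.\<close>

lemma unif_infinity:
  assumes v': "(x0, y0, z0) \<in> F4_coords" and True: "z0 = 0"
  shows "unif (x0, y0, z0) (\<lambda>(x, y, z). y0 * z)"
proof -
  have nz: "x0 \<noteq> 0" "y0 \<noteq> 0" using v' True by (auto simp: F4_coords_def)
  note Qb = F4_coords_Qbar[OF v']
  define v where v: "v = (x0, y0, z0)"
  have assms: "v \<in> F4_coords" using v' by (simp add: v)
  define p q r where pqr: "p = (fst :: triple \<Rightarrow> complex)" "q = (\<lambda>v :: triple. snd (snd v))"
    "r = (\<lambda>v :: triple. fst (snd v))"
  have "unif v (\<lambda>w. 0 * (r v * p w - p v * r w) + 1 * (r v * q w - q v * r w))"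
  proof (rule unif_chart[where \<alpha> = 1 and \<beta> = "-1" and \<gamma> = 1])
    show "form (Suc 0) p" "form (Suc 0) q" "form (Suc 0) r"
      unfolding pqr by (rule form_coords)+
    show "p v \<in> Qbar" "q v \<in> Qbar" "r v \<in> Qbar"
      using Qb by (auto simp: pqr v)
    show "linear_comb p q r d G"
      if dG: "form (Suc d) G" for d G
    proof -
      obtain G1 G2 G3 where "form d G1" "form d G2" "form d G3"
        "\<forall>w. G w = fst w * G1 w + fst (snd w) * G2 w + snd (snd w) * G3 w"
        using form_SucE'[OF dG] by blast
      then show ?thesis
        unfolding pqr by (rule_tac exI[of _ G1], rule_tac exI[of _ G3], rule_tac exI[of _ G2]) simp
    qed
    show "1 * p w ^ 4 + - 1 * q w ^ 4 + 1 * r w ^ 4 = 0" if "w \<in> F4_coords" for w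
    proof -
      obtain x y z where w: "w = (x, y, z)" by (cases w)
      have "z ^ 4 = x ^ 4 + y ^ 4" using F4_coordsD that w by simp
      then show ?thesis by (simp add: pqr w)
    qed
    show "(0, 1, 1) \<in> F4_coords" by (rule F4_coords_nonempty)
    show "0 * (r v * p (0, 1, 1) - p v * r (0, 1, 1)) + 1 * (r v * q (0, 1, 1) - q v * r (0, 1, 1)) \<noteq> 0"
      using nz True by (simp add: pqr v)
  qed (use nz assms Qbar_minus[OF Qbar_1] in \<open>auto simp: pqr v\<close>)
  moreover have "(\<lambda>w. 0 * (r v * p w - p v * r w) + 1 * (r v * q w - q v * r w)) = (\<lambda>(x, y, z). y0 * z)"
    by (auto simp: pqr v True)
  ultimately show ?thesis by (simp add: v)
qed

lemma unif_exists:
  assumes "v \<in> F4_coords" shows "\<exists>l. unif v l"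
proof -
  obtain x0 y0 z0 where v: "v = (x0, y0, z0)" by (cases v)
  note v' = assms[unfolded v]
  note Qb = F4_coords_Qbar[OF v']
  show ?thesis
  proof (cases "z0 = 0")
    case False
    show ?thesis
    proof (cases "y0 = 0")
      case True
      then have "x0 \<noteq> 0" using v' False by (auto simp: F4_coords_def)
      then show ?thesis
        unfolding v by (intro exI, rule_tac unif_affine[OF v' Qbar_0 Qbar_1 False, of "- (y0 / z0)"])
          (use False in auto)
    next
      case y0: False
      show ?thesis
        unfolding v by (intro exI, rule_tac unif_affine[OF v' Qbar_1 Qbar_0 False, of "- (x0 / z0)"])
          (use y0 False in auto)
    qed
  next
    case True
    then show ?thesis using unif_infinity[OF v'] v by blast
  qed
qed

text \<open>Each parameter divides the other up to the units U and U'. Cancelling l' gives U U' = H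
  H' on the curve, so H cannot vanish at v.\<close>

lemma unif_change:
  assumes "unif v l" "unif v l'" "v \<in> F4_coords"
  obtains e U H where "form e U" "form e H" "U v \<noteq> 0" "H v \<noteq> 0"
    "\<forall>w\<in>F4_coords. U w * l' w = l w * H w"
proof -
  obtain e h U H where 1: "form e U" "form h H" "e + Suc 0 = Suc h" "U v \<noteq> 0"
    "\<forall>w\<in>F4_coords. U w * l' w = l w * H w"
    using unifE[OF assms(1) unifD(1,2)[OF assms(2)]] .
  obtain e' h' U' H' where 2: "form e' U'" "form h' H'" "e' + Suc 0 = Suc h'" "U' v \<noteq> 0"
    "\<forall>w\<in>F4_coords. U' w * l w = l' w * H' w"
    using unifE[OF assms(2) unifD(1,2)[OF assms(1)]] .
  have "U v * U' v = H v * H' v"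
  proof (rule form_cancel[OF unifD(1,3)[OF assms(2)] _ _ _ assms(3)])
    show "form (e + e') (\<lambda>v. U v * U' v)" by (rule form_mult[OF 1(1) 2(1)])
    show "form (e + e') (\<lambda>v. H v * H' v)" using form_mult[OF 1(2) 2(2)] 1(3) 2(3) by simp
    fix w assume w: "w \<in> F4_coords"
    have "l' w * (U w * U' w) = (U w * l' w) * U' w" by simp
    also have "\<dots> = (U' w * l w) * H w" using 1(5) w by simp
    also have "\<dots> = l' w * (H w * H' w)" using 2(5) w by simp
    finally show "l' w * (U w * U' w) = l' w * (H w * H' w)" .
  qed
  then have "H v \<noteq> 0" using 1(4) 2(4) by auto
  then show ?thesis using that[of e U H] 1 by simp
qed

subsection \<open>Orders of forms\<close>

text \<open>The intersection multiplicity of the curve with G = 0 at v. The parameter is itself a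
  linear form, whence the degree equation; the degree d is an argument because it cannot be
  recovered from the function G on the curve.\<close>

definition ford :: "nat \<Rightarrow> (triple \<Rightarrow> complex) \<Rightarrow> triple \<Rightarrow> nat \<Rightarrow> bool" where
  "ford d G v n \<longleftrightarrow> (\<exists>l e a U A. unif v l \<and> form e U \<and> form a A \<and> e + d = n + a \<and> U v \<noteq> 0 \<and> A v \<noteq> 0 \<and>
     (\<forall>w\<in>F4_coords. U w * G w = l w ^ n * A w))"

lemma fordI:
  assumes "unif v l" "form e U" "form a A" "e + d = n + a" "U v \<noteq> 0" "A v \<noteq> 0"
    "\<And>w. w \<in> F4_coords \<Longrightarrow> U w * G w = l w ^ n * A w"
  shows "ford d G v n"
  unfolding ford_def using assms by blast

text \<open>The parameter hidden in \<open>ford\<close> may be replaced by any prescribed one, the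
  n-th power of the unit from \<open>unif_change\<close> being absorbed. Two orders at the same
  point can then be added.\<close>

lemma fordE:
  assumes "ford d G v n" "unif v l" "v \<in> F4_coords"
  obtains e a U A where "form e U" "form a A" "e + d = n + a" "U v \<noteq> 0" "A v \<noteq> 0"
    "\<forall>w\<in>F4_coords. U w * G w = l w ^ n * A w"
proof -
  obtain l' e a U A where l': "unif v l'" and 1: "form e U" "form a A" "e + d = n + a" "U v \<noteq> 0" "A v \<noteq> 0"
     "\<forall>w\<in>F4_coords. U w * G w = l' w ^ n * A w"
    using assms(1) unfolding ford_def by blast
  obtain k V H where 2: "form k V" "form k H" "V v \<noteq> 0" "H v \<noteq> 0"
    "\<forall>w\<in>F4_coords. V w * l' w = l w * H w"
    using unif_change[OF assms(2) l' assms(3)] .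
  show ?thesis
  proof (rule that)
    show "form (n * k + e) (\<lambda>w. V w ^ n * U w)" by (intro form_mult form_power 1 2)
    show "form (n * k + a) (\<lambda>w. H w ^ n * A w)" by (intro form_mult form_power 1 2)
    show "n * k + e + d = n + (n * k + a)" using 1(3) by simp
    show "\<forall>w\<in>F4_coords. (V w ^ n * U w) * G w = l w ^ n * (H w ^ n * A w)"
    proof
      fix w assume w: "w \<in> F4_coords"
      have "(V w ^ n * U w) * G w = (V w * l' w) ^ n * A w"
        using 1(6) w by (simp add: power_mult_distrib)
      also have "\<dots> = l w ^ n * (H w ^ n * A w)"
        using 2(5) w by (simp add: power_mult_distrib)
      finally show "(V w ^ n * U w) * G w = l w ^ n * (H w ^ n * A w)" .
    qed
  qed (use 1 2 in auto)
qed

lemma ford_mult: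
  assumes "ford d G v m" "ford e H v n" "v \<in> F4_coords"
  shows "ford (d + e) (\<lambda>w. G w * H w) v (m + n)"
proof -
  obtain l where l: "unif v l" using unif_exists[OF assms(3)] ..
  obtain i a U A where 1: "form i U" "form a A" "i + d = m + a" "U v \<noteq> 0" "A v \<noteq> 0"
     "\<forall>w\<in>F4_coords. U w * G w = l w ^ m * A w"
    using fordE[OF assms(1) l assms(3)] .
  obtain j b V B where 2: "form j V" "form b B" "j + e = n + b" "V v \<noteq> 0" "B v \<noteq> 0"
     "\<forall>w\<in>F4_coords. V w * H w = l w ^ n * B w"
    using fordE[OF assms(2) l assms(3)] .
  show ?thesis
  proof (rule fordI[OF l])
    show "form (i + j) (\<lambda>w. U w * V w)" "form (a + b) (\<lambda>w. A w * B w)"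
      using 1 2 by (auto intro: form_mult)
    show "(U w * V w) * (G w * H w) = l w ^ (m + n) * (A w * B w)" if "w \<in> F4_coords" for w
    proof -
      have "(U w * V w) * (G w * H w) = (U w * G w) * (V w * H w)" by simp
      also have "\<dots> = (l w ^ m * A w) * (l w ^ n * B w)" using 1(6) 2(6) that by simp
      finally show ?thesis by (simp add: power_add)
    qed
  qed (use 1 2 in auto)
qed

lemma ford_0: "v \<in> F4_coords \<Longrightarrow> form d G \<Longrightarrow> G v \<noteq> 0 \<Longrightarrow> ford d G v 0"
  using unif_exists[of v] form_const[OF Qbar_1] by (auto intro!: fordI[where U = "\<lambda>_. 1"])

lemma ford_power:
  assumes "ford d G v n" "v \<in> F4_coords" shows "ford (k * d) (\<lambda>w. G w ^ k) v (k * n)"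
proof (induction k)
  case 0
  then show ?case using ford_0[OF assms(2) form_const[OF Qbar_1]] by simp
next
  case (Suc k)
  then show ?case using ford_mult[OF assms(1) Suc assms(2)] by simp
qed

lemma ford_unif: "unif v l \<Longrightarrow> ford (Suc 0) l v (Suc 0)"
  using form_const[OF Qbar_1] by (auto intro!: fordI[where U = "\<lambda>_. 1" and A = "\<lambda>_. 1"])

lemma ford_cong:
  assumes "ford d G v n" "\<And>w. w \<in> F4_coords \<Longrightarrow> G w = H w"
  shows "ford d H v n"
proof -
  obtain l e a U A where "unif v l" "form e U" "form a A" "e + d = n + a" "U v \<noteq> 0" "A v \<noteq> 0"
     "\<forall>w\<in>F4_coords. U w * G w = l w ^ n * A w"
    using assms(1) unfolding ford_def by blast
  then show ?thesis using assms(2) by (intro fordI[of v l e U a A]) (auto simp del: split_paired_All)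
qed

text \<open>The step that removes an auxiliary factor, such as a conjugate form, after a product has
  been computed.\<close>

lemma ford_cofactor:
  assumes "ford (e + d) (\<lambda>w. V w * G w) v n" "form e V" "V v \<noteq> 0" "v \<in> F4_coords"
  shows "ford d G v n"
proof -
  obtain l where l: "unif v l" using unif_exists[OF assms(4)] ..
  obtain i a U A where 1: "form i U" "form a A" "i + (e + d) = n + a" "U v \<noteq> 0" "A v \<noteq> 0"
     "\<forall>w\<in>F4_coords. U w * (V w * G w) = l w ^ n * A w"
    using fordE[OF assms(1) l assms(4)] .
  show ?thesis
  proof (rule fordI[OF l])
    show "form (i + e) (\<lambda>w. U w * V w)" by (rule form_mult[OF 1(1) assms(2)])
    show "form a A" "A v \<noteq> 0" by (rule 1)+
    show "(U w * V w) * G w = l w ^ n * A w" if "w \<in> F4_coords" for w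
      using 1(6) that by (simp add: mult.assoc)
  qed (use 1 assms in auto)
qed

lemma nonvanishing_linear_form:
  assumes "v \<in> F4_coords" obtains L where "form (Suc 0) L" "L v \<noteq> 0"
proof -
  obtain x y z where v: "v = (x, y, z)" by (cases v)
  then have "x \<noteq> 0 \<or> y \<noteq> 0 \<or> z \<noteq> 0" using assms by (auto simp: F4_coords_def)
  then show ?thesis
    using that[OF form_coords(1)] that[OF form_coords(2)] that[OF form_coords(3)] by (auto simp: v)
qed

text \<open>From U G = l K one obtains G / H = (l / L) (K L / (U H)), where the second factor is
  regular at v; L serves to give the quotient degree 0.\<close>

lemma uniformizer_quotient:
  assumes l: "unif v l" and L: "form (Suc 0) L" "L v \<noteq> 0" and v: "v \<in> F4_coords"
  shows "uniformizer (proj v) (\<lambda>w. l w / L w)"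
  unfolding uniformizer_def
proof (intro conjI ballI)
  have Lp: "\<forall>w\<in>proj v. L w \<noteq> 0" using form_zero_proj[OF L(1)] L(2) by blast
  have lp: "\<forall>w\<in>proj v. l w = 0" using form_zero_proj[OF unifD(1)[OF l]] unifD(2)[OF l] by blast
  show "(\<lambda>w. l w / L w) \<in> max_ideal (proj v)"
    unfolding max_ideal_def using local_ringI[OF unifD(1)[OF l] L(1) Lp] lp by simp
  fix g assume "g \<in> max_ideal (proj v)"
  then have g: "g \<in> local_ring (proj v)" "g v = 0"
    unfolding max_ideal_def using proj_self[of v] by auto
  obtain d G H where GH: "form d G" "form d H" "\<forall>w\<in>proj v. H w \<noteq> 0" "g = (\<lambda>w. G w / H w)"
    using g(1) by (rule local_ringE)
  have Hv: "H v \<noteq> 0" using GH(3) proj_self[of v] by blast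
  then have Gv: "G v = 0" using g(2) GH(4) by simp
  obtain e h U K where UK: "form e U" "form h K" "e + d = Suc h" "U v \<noteq> 0" "\<forall>w\<in>F4_coords. U w * G w = l w * K w"
    using unifE[OF l GH(1) Gv] .
  have f: "form (e + d) (\<lambda>w. K w * L w)" "form (e + d) (\<lambda>w. U w * H w)"
    using form_mult[OF UK(2) L(1)] form_mult[OF UK(1) GH(2)] UK(3) by simp_all
  have nz: "\<forall>w\<in>proj v. U w * H w \<noteq> 0"
    using form_zero_proj[OF UK(1)] UK(4) GH(3) by auto
  have "rat_eq g (\<lambda>w. l w / L w * (K w * L w / (U w * H w)))"
  proof (rule rat_eqI)
    show "form (e + d + Suc 0) (\<lambda>w. (U w * H w) * L w)" by (rule form_mult[OF f(2) L(1)])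
    show "nonvanishing (\<lambda>w. (U w * H w) * L w)" using v UK(4) Hv L(2) by auto
    fix w assume w: "w \<in> F4_coords" "(U w * H w) * L w \<noteq> 0"
    then show "g w = l w / L w * (K w * L w / (U w * H w))"
      using UK(5) GH(4) by (auto simp: divide_simps mult_ac)
  qed
  then show "\<exists>h\<in>local_ring (proj v). rat_eq g (\<lambda>w. l w / L w * h w)"
    using bexI[OF _ local_ringI[OF f nz], of "\<lambda>h. rat_eq g (\<lambda>w. l w / L w * h w)"] by simp
qed

text \<open>A quotient of local parameters is a unit: cancelling \<open>t = t h h'\<close> in the function field
  shows that \<open>h h'\<close> has the value 1 at the point.\<close>

lemma uniformizer_ratio:
  assumes t: "uniformizer P t" and l: "unif v l" and L: "form (Suc 0) L" "L v \<noteq> 0"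
    and v: "v \<in> F4_coords" "P = proj v"
  obtains u where "u \<in> local_units P" "rat_eq t (\<lambda>w. u w * (l w / L w))"
proof -
  define t0 where "t0 = (\<lambda>w. l w / L w)"
  have t0: "uniformizer P t0"
    unfolding t0_def v(2) by (rule uniformizer_quotient[OF l L v(1)])
  obtain h where h: "h \<in> local_ring P" "rat_eq t (\<lambda>w. t0 w * h w)"
    using t t0 unfolding uniformizer_def by blast
  obtain h' where h': "h' \<in> local_ring P" "rat_eq t0 (\<lambda>w. t w * h' w)"
    using t t0 unfolding uniformizer_def by blast
  obtain d A B where AB: "form d A" "form d B" "\<forall>v\<in>P. B v \<noteq> 0" "h = (\<lambda>w. A w / B w)"
    using h(1) by (rule local_ringE)
  obtain d' A' B' where AB': "form d' A'" "form d' B'" "\<forall>v\<in>P. B' v \<noteq> 0" "h' = (\<lambda>w. A' w / B' w)"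
    using h'(1) by (rule local_ringE)
  have vP: "v \<in> P" using proj_self v(2) by simp
  obtain e E where E: "form e E" "nonvanishing E"
    "\<forall>w\<in>F4_coords. E w \<noteq> 0 \<longrightarrow> t w = t0 w * h w \<and> t0 w = t w * h' w"
    using rat_eq_common[OF h(2) h'(2)] .
  \<comment> \<open>D collects everything that has to be nonzero for the equations t = t0 h and t0 =
    t h' to be cleared of denominators and cancelled. Where D vanishes the claimed identity is
    trivial, and D itself is then cancelled.\<close>
  define D where "D = (\<lambda>w. (E w * l w) * (L w * (B w * B' w)))"
  have "A v * A' v = B v * B' v"
  proof (rule form_cancel)
    show "form (e + Suc 0 + (Suc 0 + (d + d'))) D"
      unfolding D_def by (intro form_mult E unifD[OF l] L AB AB')
    show "nonvanishing D"
      unfolding D_def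
    proof (rule forms_nonzero_mult)
      show "form (e + Suc 0) (\<lambda>w. E w * l w)" by (intro form_mult E unifD[OF l])
      show "form (Suc 0 + (d + d')) (\<lambda>w. L w * (B w * B' w))" by (intro form_mult L AB AB')
      show "nonvanishing (\<lambda>w. E w * l w)"
        by (intro forms_nonzero_mult[OF E(1) unifD(1)[OF l]] E unifD[OF l])
      show "nonvanishing (\<lambda>w. L w * (B w * B' w))"
        using v(1) vP L AB(3) AB'(3) by auto
    qed
    show "form (d + d') (\<lambda>w. A w * A' w)" "form (d + d') (\<lambda>w. B w * B' w)"
      by (intro form_mult AB AB')+
    show "v \<in> F4_coords" by (rule v)
    fix w assume w: "w \<in> F4_coords"
    show "D w * (A w * A' w) = D w * (B w * B' w)"
    proof (cases "D w = 0")
      case False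
      then have nz: "E w \<noteq> 0" "l w \<noteq> 0" "L w \<noteq> 0" "B w \<noteq> 0" "B' w \<noteq> 0"
        by (auto simp: D_def)
      have t: "t w = t0 w * h w" and "t0 w = t w * h' w" using E(3) w nz(1) by blast+
      then have "t0 w = t0 w * (h w * h' w)" by (metis mult.assoc)
      then have "h w * h' w = 1" using nz by (simp add: t0_def)
      then have "A w * A' w = B w * B' w" using nz by (simp add: AB AB' divide_simps)
      then show ?thesis by simp
    qed simp
  qed
  then have "A v \<noteq> 0" using vP AB(3) AB'(3) by auto
  then have "\<forall>w\<in>P. A w \<noteq> 0" using form_zero_proj[OF AB(1)] v(2) by auto
  then have "h \<in> local_units P" unfolding AB(4) by (intro local_unitsI[OF AB(1-3)])
  moreover have "rat_eq t (\<lambda>w. h w * (l w / L w))" using h(2) by (simp add: t0_def mult.commute)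
  ultimately show ?thesis by (rule that)
qed

text \<open>The counterpart of \<open>fordE\<close> for functions: the unknown uniformizer is
  exchanged for l / L, and the n-th power of their ratio joins the unit.\<close>

lemma has_ordE:
  assumes f: "has_ord f P n" and l: "unif v l" and L: "form (Suc 0) L" "L v \<noteq> 0"
    and v: "v \<in> F4_coords" "P = proj v"
  obtains u where "u \<in> local_units P" "rat_eq f (\<lambda>w. u w * (l w / L w) powi n)"
proof -
  obtain t u where t: "uniformizer P t" "u \<in> local_units P" "rat_eq f (\<lambda>w. u w * t w powi n)"
    using f unfolding has_ord_def by blast
  obtain u0 where u0: "u0 \<in> local_units P" "rat_eq t (\<lambda>w. u0 w * (l w / L w))"
    using uniformizer_ratio[OF t(1) l L v] .
  have "rat_eq (\<lambda>w. u w * t w powi n) (\<lambda>w. u w * (u0 w * (l w / L w)) powi n)"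
    by (intro rat_eq_mult rat_eq_powi u0 rat_eq_refl) simp
  then have "rat_eq f (\<lambda>w. (u w * u0 w powi n) * (l w / L w) powi n)"
    using t(3) by (simp only: power_int_mult_distrib mult.assoc) (rule rat_eq_trans)
  then show ?thesis
    by (rule that[rotated]) (intro local_units_mult local_units_powi t u0)
qed

lemma has_ordI:
  assumes "unif v l" "form (Suc 0) L" "L v \<noteq> 0" "v \<in> F4_coords"
    "u \<in> local_units (proj v)" "rat_eq f (\<lambda>w. u w * (l w / L w) powi n)"
  shows "has_ord f (proj v) n"
  unfolding has_ord_def using uniformizer_quotient[OF assms(1-4)] assms(5,6) by blast

lemma has_ord_mult:
  assumes "has_ord f P m" "has_ord g P n" "P \<in> F4"
  shows "has_ord (\<lambda>w. f w * g w) P (m + n)"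
proof -
  obtain v where v: "v \<in> F4_coords" "P = proj v" using assms(3) by (rule F4E)
  obtain l where l: "unif v l" using unif_exists[OF v(1)] ..
  obtain L where L: "form (Suc 0) L" "L v \<noteq> 0" using nonvanishing_linear_form[OF v(1)] .
  obtain a where a: "a \<in> local_units P" "rat_eq f (\<lambda>w. a w * (l w / L w) powi m)"
    using has_ordE[OF assms(1) l L v] .
  obtain b where b: "b \<in> local_units P" "rat_eq g (\<lambda>w. b w * (l w / L w) powi n)"
    using has_ordE[OF assms(2) l L v] .
  have "rat_eq (\<lambda>w. (a w * (l w / L w) powi m) * (b w * (l w / L w) powi n))
     (\<lambda>w. (a w * b w) * (l w / L w) powi (m + n))"
  proof (rule rat_eqI)
    \<comment> \<open>Integer exponents add only where the base is nonzero, so the zeros of l are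
      excluded together with those of L.\<close>
    show "form (Suc 0 + Suc 0) (\<lambda>w. l w * L w)" by (rule form_mult[OF unifD(1)[OF l] L(1)])
    show "nonvanishing (\<lambda>w. l w * L w)"
      using forms_nonzero_mult[OF unifD(1)[OF l] L(1) unifD(3)[OF l]] L(2) v(1) by blast
    fix w assume "w \<in> F4_coords" "l w * L w \<noteq> 0"
    then have "l w / L w \<noteq> 0" by simp
    then show "(a w * (l w / L w) powi m) * (b w * (l w / L w) powi n) = (a w * b w) * (l w / L w) powi (m + n)"
      by (simp add: power_int_add)
  qed
  then have "rat_eq (\<lambda>w. f w * g w) (\<lambda>w. (a w * b w) * (l w / L w) powi (m + n))"
    using rat_eq_mult[OF a(2) b(2)] by (rule rat_eq_trans[rotated])
  moreover have "(\<lambda>w. a w * b w) \<in> local_units (proj v)"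
    using local_units_mult[OF a(1) b(1)] v(2) by simp
  ultimately show ?thesis
    unfolding v(2) by (intro has_ordI[OF l L v(1)])
qed

lemma has_ord_inverse:
  assumes "has_ord f P n" shows "has_ord (\<lambda>w. inverse (f w)) P (- n)"
proof -
  obtain t u where t: "uniformizer P t" "u \<in> local_units P" "rat_eq f (\<lambda>w. u w * t w powi n)"
    using assms unfolding has_ord_def by blast
  have "rat_eq (\<lambda>w. f w powi (-1)) (\<lambda>w. (u w * t w powi n) powi (-1))"
    using t(3) by (rule rat_eq_powi)
  then have "rat_eq (\<lambda>w. inverse (f w)) (\<lambda>w. inverse (u w) * t w powi (- n))"
    by (simp add: power_int_minus)
  then show ?thesis
    unfolding has_ord_def using t(1) local_units_inverse[OF t(2)] by blast
qed

text \<open>The bridge from forms to functions: dividing U G = l^m A by V H = l^n B leaves the unit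
  A V / (U B), corrected by a power of L.\<close>

lemma has_ord_quotient:
  assumes "ford d G v m" "ford d H v n" "form d H" "v \<in> F4_coords"
  shows "has_ord (\<lambda>w. G w / H w) (proj v) (int m - int n)"
proof -
  obtain l where l: "unif v l" using unif_exists[OF assms(4)] ..
  obtain L where L: "form (Suc 0) L" "L v \<noteq> 0" using nonvanishing_linear_form[OF assms(4)] .
  obtain i a U A where 1: "form i U" "form a A" "i + d = m + a" "U v \<noteq> 0" "A v \<noteq> 0"
     "\<forall>w\<in>F4_coords. U w * G w = l w ^ m * A w"
    using fordE[OF assms(1) l assms(4)] .
  obtain j b V B where 2: "form j V" "form b B" "j + d = n + b" "V v \<noteq> 0" "B v \<noteq> 0"
     "\<forall>w\<in>F4_coords. V w * H w = l w ^ n * B w"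
    using fordE[OF assms(2) l assms(4)] .
  \<comment> \<open>A V and U B have different degrees in general; multiplication by L^m and L^n
    brings both to i + j + d.\<close>
  have deg: "a + j + m * Suc 0 = i + j + d" "i + b + n * Suc 0 = i + j + d"
    using 1(3) 2(3) by simp_all
  have f: "form (i + j + d) (\<lambda>w. (A w * V w) * L w ^ m)" "form (i + j + d) (\<lambda>w. (U w * B w) * L w ^ n)"
    using form_mult[OF form_mult[OF 1(2) 2(1)] form_power[OF L(1), of m]]
      form_mult[OF form_mult[OF 1(1) 2(2)] form_power[OF L(1), of n]]
    unfolding deg by blast+
  have nz: "(A v * V v) * L v ^ m \<noteq> 0" "(U v * B v) * L v ^ n \<noteq> 0" using 1 2 L by auto
  show ?thesis
  proof (rule has_ordI[OF l L assms(4)])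
    show "(\<lambda>w. (A w * V w) * L w ^ m / ((U w * B w) * L w ^ n)) \<in> local_units (proj v)"
      using form_zero_proj[OF f(1)] form_zero_proj[OF f(2)] nz by (intro local_unitsI[OF f]) auto
    show "rat_eq (\<lambda>w. G w / H w) (\<lambda>w. (A w * V w) * L w ^ m / ((U w * B w) * L w ^ n) * (l w / L w) powi (int m - int n))"
    proof (rule rat_eqI)
      show "form (Suc 0 + (i + (j + (b + Suc 0)))) (\<lambda>w. l w * (U w * (V w * (B w * L w))))"
        by (intro form_mult unifD[OF l] 1 2 L)
      have "form (i + (j + (b + Suc 0))) (\<lambda>w. U w * (V w * (B w * L w)))"
        by (intro form_mult 1 2 L)
      then show "nonvanishing (\<lambda>w. l w * (U w * (V w * (B w * L w))))"
        by (rule forms_nonzero_mult[OF unifD(1)[OF l] _ unifD(3)[OF l]])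
          (use assms(4) 1 2 L in auto)
      fix w assume w: "w \<in> F4_coords" "l w * (U w * (V w * (B w * L w))) \<noteq> 0"
      then have nz: "l w \<noteq> 0" "U w \<noteq> 0" "V w \<noteq> 0" "B w \<noteq> 0" "L w \<noteq> 0" by auto
      have G: "G w = l w ^ m * A w / U w" using 1(6) w(1) nz by (simp add: divide_simps mult.commute)
      have H: "H w = l w ^ n * B w / V w" using 2(6) w(1) nz by (simp add: divide_simps mult.commute)
      show "G w / H w = (A w * V w) * L w ^ m / ((U w * B w) * L w ^ n) * (l w / L w) powi (int m - int n)"
        unfolding G H using nz by (simp add: power_int_diff divide_simps)
    qed
  qed
qed

section \<open>Principal divisors\<close>

abbreviation (input) support :: "divisor \<Rightarrow> point set" where "support \<equiv> Poly_Mapping.keys"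
abbreviation (input) lookup :: "divisor \<Rightarrow> point \<Rightarrow> int" where "lookup \<equiv> Poly_Mapping.lookup"

lemma nonzero_rat_funsI:
  "form d G \<Longrightarrow> form d H \<Longrightarrow> nonvanishing G \<Longrightarrow> nonvanishing H \<Longrightarrow>
    (\<lambda>v. G v / H v) \<in> nonzero_rat_funs"
  unfolding nonzero_rat_funs_def mem_Collect_eq
  by (rule exI[of _ G], rule exI[of _ H], intro conjI refl exI[of _ d])

lemma nonzero_rat_funsE:
  assumes "f \<in> nonzero_rat_funs"
  obtains d G H where "form d G" "form d H" "nonvanishing G" "nonvanishing H"
    "f = (\<lambda>v. G v / H v)"
proof -
  obtain G H d where "f = (\<lambda>v. G v / H v)"
    "form d G" "form d H" "nonvanishing G" "nonvanishing H"
    using assms unfolding nonzero_rat_funs_def mem_Collect_eq by (elim exE conjE)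
  then show ?thesis by (intro that[of d G H])
qed

lemma PrinI:
  assumes "support D \<subseteq> F4" "f \<in> nonzero_rat_funs"
    "\<And>P. P \<in> F4 \<Longrightarrow> has_ord f P (lookup D P)"
  shows "D \<in> Prin"
  unfolding Prin_def mem_Collect_eq carrier_free_Abelian_group_iff
  by (rule conjI, rule assms(1), rule bexI[of _ f], rule ballI, erule assms(3), rule assms(2))

lemma PrinE:
  assumes "D \<in> Prin"
  obtains f where "support D \<subseteq> F4" "f \<in> nonzero_rat_funs"
    "\<forall>P\<in>F4. has_ord f P (lookup D P)"
proof -
  obtain f where "D \<in> carrier Div" "f \<in> nonzero_rat_funs" "\<forall>P\<in>F4. has_ord f P (lookup D P)"
    using assms unfolding Prin_def by blast
  then show ?thesis by (intro that[of f]) simp_all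
qed

lemma Prin_0: "0 \<in> Prin"
proof (rule PrinI)
  show "(\<lambda>v. 1 / 1) \<in> nonzero_rat_funs"
    using F4_coords_nonempty by (intro nonzero_rat_funsI[OF form_const form_const]) auto
  fix P assume "P \<in> F4"
  then obtain v where v: "v \<in> F4_coords" "P = proj v" by (rule F4E)
  have "ford 0 (\<lambda>_. 1) v 0" by (rule ford_0[OF v(1) form_const]) auto
  from has_ord_quotient[OF this this form_const[OF Qbar_1] v(1)]
  show "has_ord (\<lambda>v. 1 / 1) P (lookup 0 P)" by (simp add: v(2))
qed simp

lemma Prin_add:
  assumes "D \<in> Prin" "E \<in> Prin" shows "D + E \<in> Prin"
proof -
  obtain f where f: "support D \<subseteq> F4" "f \<in> nonzero_rat_funs" "\<forall>P\<in>F4. has_ord f P (lookup D P)"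
    using assms(1) by (rule PrinE)
  obtain g where g: "support E \<subseteq> F4" "g \<in> nonzero_rat_funs" "\<forall>P\<in>F4. has_ord g P (lookup E P)"
    using assms(2) by (rule PrinE)
  obtain d G H where GH: "form d G" "form d H" "nonvanishing G" "nonvanishing H"
    "f = (\<lambda>v. G v / H v)" using f(2) by (rule nonzero_rat_funsE)
  obtain e K M where KM: "form e K" "form e M" "nonvanishing K" "nonvanishing M"
    "g = (\<lambda>v. K v / M v)" using g(2) by (rule nonzero_rat_funsE)
  have "(\<lambda>v. G v * K v / (H v * M v)) \<in> nonzero_rat_funs"
    by (rule nonzero_rat_funsI[OF form_mult[OF GH(1) KM(1)] form_mult[OF GH(2) KM(2)]
      forms_nonzero_mult[OF GH(1) KM(1) GH(3) KM(3)] forms_nonzero_mult[OF GH(2) KM(2) GH(4) KM(4)]])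
  then have fg: "(\<lambda>v. f v * g v) \<in> nonzero_rat_funs" by (simp add: GH(5) KM(5))
  show ?thesis
  proof (rule PrinI[OF _ fg])
    show "support (D + E) \<subseteq> F4" using f(1) g(1) Poly_Mapping.keys_add[of D E] by blast
    show "has_ord (\<lambda>v. f v * g v) P (lookup (D + E) P)" if "P \<in> F4" for P
      unfolding lookup_add using has_ord_mult f(3) g(3) that by blast
  qed
qed

lemma Prin_minus:
  assumes "D \<in> Prin" shows "- D \<in> Prin"
proof -
  obtain f where f: "support D \<subseteq> F4" "f \<in> nonzero_rat_funs" "\<forall>P\<in>F4. has_ord f P (lookup D P)"
    using assms(1) by (rule PrinE)
  obtain d G H where GH: "form d G" "form d H" "nonvanishing G" "nonvanishing H"
    "f = (\<lambda>v. G v / H v)" using f(2) by (rule nonzero_rat_funsE)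
  have "(\<lambda>v. H v / G v) \<in> nonzero_rat_funs"
    by (intro nonzero_rat_funsI[OF GH(2) GH(1)] GH)
  then have "(\<lambda>v. inverse (f v)) \<in> nonzero_rat_funs" by (simp add: GH(5))
  then show ?thesis
  proof (rule PrinI[rotated])
    show "has_ord (\<lambda>v. inverse (f v)) P (lookup (- D) P)" if "P \<in> F4" for P
      unfolding lookup_uminus using has_ord_inverse f(3) that by blast
  qed (use f(1) in simp)
qed

lemma Prin_diff: "D \<in> Prin \<Longrightarrow> E \<in> Prin \<Longrightarrow> D - E \<in> Prin"
  using Prin_add[of D "- E"] Prin_minus by simp

lemma Prin_cmul:
  assumes "D \<in> Prin" shows "frag_cmul k D \<in> Prin"
proof -
  have n: "frag_cmul (int n) D \<in> Prin" for n
  proof (induction n)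
    case (Suc n)
    have "frag_cmul (int (Suc n)) D = D + frag_cmul (int n) D"
      by (simp add: frag_cmul_distrib)
    then show ?case using Prin_add[OF assms Suc] by simp
  qed (simp add: Prin_0)
  show ?thesis
  proof (cases "k \<ge> 0")
    case True
    then show ?thesis using n[of "nat k"] by simp
  next
    case False
    then show ?thesis using Prin_minus[OF n[of "nat (- k)"]] by simp
  qed
qed

section \<open>Push-forward by linear automorphisms\<close>

lemma form_subst:
  assumes "form (Suc 0) p" "form (Suc 0) q" "form (Suc 0) r"
  shows "form d G \<Longrightarrow> form d (\<lambda>v. G (p v, q v, r v))"
proof (induction d arbitrary: G)
  case 0
  then show ?case by (auto simp: form_0_iff)
next
  case (Suc d)
  obtain G1 G2 G3 where f: "form d G1" "form d G2" "form d G3"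
    and G: "\<forall>x y z. G (x, y, z) = x * G1 (x, y, z) + y * G2 (x, y, z) + z * G3 (x, y, z)"
    using Suc.prems by (rule form_SucE)
  have "form (Suc 0 + d) (\<lambda>v. p v * G1 (p v, q v, r v) + q v * G2 (p v, q v, r v) + r v * G3 (p v, q v, r v))"
    by (intro form_add form_mult assms Suc.IH f)
  then show ?case by (simp add: G)
qed

text \<open>The inverse substitution is a parameter because it transports functions: the
  push-forward of the divisor of f is the divisor of
  \<open>\<lambda>v. f (\<theta>' v)\<close>.\<close>

locale curve_aut =
  fixes \<theta> \<theta>' :: "triple \<Rightarrow> triple"
  assumes form_theta: "form d G \<Longrightarrow> form d (\<lambda>v. G (\<theta> v))"
    and form_theta': "form d G \<Longrightarrow> form d (\<lambda>v. G (\<theta>' v))"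
    and theta_coords: "v \<in> F4_coords \<Longrightarrow> \<theta> v \<in> F4_coords"
    and theta'_coords: "v \<in> F4_coords \<Longrightarrow> \<theta>' v \<in> F4_coords"
    and theta_theta': "\<theta> (\<theta>' v) = v"
    and theta'_theta: "\<theta>' (\<theta> v) = v"
    and theta_proj: "\<theta> ` proj v = proj (\<theta> v)"
begin

lemma theta'_image: "\<theta>' ` \<theta> ` P = P"
  by (simp add: image_image theta'_theta)

lemma theta_image: "\<theta> ` \<theta>' ` P = P"
  by (simp add: image_image theta_theta')

lemma theta'_proj: "\<theta>' ` proj v = proj (\<theta>' v)"
  by (metis theta'_image theta_proj theta_theta')

lemma inverse_aut: "curve_aut \<theta>' \<theta>"
  by unfold_locales
    (auto intro: form_theta form_theta' theta_coords theta'_coords simp: theta_theta' theta'_theta theta'_proj)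

lemma theta_F4: "P \<in> F4 \<Longrightarrow> \<theta> ` P \<in> F4"
  by (erule F4E) (simp add: theta_proj proj_in_F4 theta_coords)

lemma theta_image_eq_iff: "\<theta> ` P = \<theta> ` Q \<longleftrightarrow> P = Q"
  by (metis theta'_image)

lemma rat_eq_theta':
  assumes "rat_eq f g" shows "rat_eq (\<lambda>v. f (\<theta>' v)) (\<lambda>v. g (\<theta>' v))"
proof -
  obtain d E where E: "form d E" "nonvanishing E" "\<forall>v\<in>F4_coords. E v \<noteq> 0 \<longrightarrow> f v = g v"
    using assms unfolding rat_eq_def by blast
  obtain v where v: "v \<in> F4_coords" "E v \<noteq> 0" using E(2) by blast
  show ?thesis
  proof (rule rat_eqI[OF form_theta'[OF E(1)]])
    show "nonvanishing (\<lambda>v. E (\<theta>' v))"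
      by (rule bexI[of _ "\<theta> v"]) (use v theta_coords in \<open>simp_all add: theta'_theta\<close>)
    show "f (\<theta>' w) = g (\<theta>' w)" if "w \<in> F4_coords" "E (\<theta>' w) \<noteq> 0" for w
      using E(3) theta'_coords[OF that(1)] that(2) by blast
  qed
qed

lemma local_ring_theta':
  assumes "f \<in> local_ring P" shows "(\<lambda>v. f (\<theta>' v)) \<in> local_ring (\<theta> ` P)"
proof -
  obtain d G H where GH: "form d G" "form d H" "\<forall>v\<in>P. H v \<noteq> 0" "f = (\<lambda>v. G v / H v)"
    using assms by (rule local_ringE)
  show ?thesis
    unfolding GH(4) by (rule local_ringI[OF form_theta'[OF GH(1)] form_theta'[OF GH(2)]])
      (use GH(3) in \<open>simp add: theta'_theta\<close>)
qed

lemma max_ideal_theta': "f \<in> max_ideal P \<Longrightarrow> (\<lambda>v. f (\<theta>' v)) \<in> max_ideal (\<theta> ` P)"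
  unfolding max_ideal_def using local_ring_theta'[of f P] by (simp add: theta'_theta)

lemma local_units_theta': "f \<in> local_units P \<Longrightarrow> (\<lambda>v. f (\<theta>' v)) \<in> local_units (\<theta> ` P)"
  unfolding local_units_def using local_ring_theta'[of f P] by (simp add: theta'_theta)

end

context curve_aut
begin

lemma uniformizer_theta':
  assumes "uniformizer P t" shows "uniformizer (\<theta> ` P) (\<lambda>v. t (\<theta>' v))"
  unfolding uniformizer_def
proof (intro conjI ballI)
  interpret inv: curve_aut \<theta>' \<theta> by (rule inverse_aut)
  show "(\<lambda>v. t (\<theta>' v)) \<in> max_ideal (\<theta> ` P)"
    using assms max_ideal_theta' unfolding uniformizer_def by blast
  fix g assume "g \<in> max_ideal (\<theta> ` P)"
  then have "(\<lambda>v. g (\<theta> v)) \<in> max_ideal P"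
    using inv.max_ideal_theta'[of g "\<theta> ` P"] by (simp add: theta'_image)
  then obtain h where h: "h \<in> local_ring P" "rat_eq (\<lambda>v. g (\<theta> v)) (\<lambda>v. t v * h v)"
    using assms unfolding uniformizer_def by blast
  from rat_eq_theta'[OF h(2)] have "rat_eq g (\<lambda>v. t (\<theta>' v) * h (\<theta>' v))"
    by (simp add: theta_theta')
  then show "\<exists>h\<in>local_ring (\<theta> ` P). rat_eq g (\<lambda>v. t (\<theta>' v) * h v)"
    using bexI[OF _ local_ring_theta'[OF h(1)], of "\<lambda>h. rat_eq g (\<lambda>v. t (\<theta>' v) * h v)"] by simp
qed

lemma has_ord_theta':
  assumes "has_ord f P n" shows "has_ord (\<lambda>v. f (\<theta>' v)) (\<theta> ` P) n"
proof -
  obtain t u where t: "uniformizer P t" "u \<in> local_units P" "rat_eq f (\<lambda>w. u w * t w powi n)"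
    using assms unfolding has_ord_def by blast
  show ?thesis
    unfolding has_ord_def
    using uniformizer_theta'[OF t(1)] local_units_theta'[OF t(2)] rat_eq_theta'[OF t(3)] by blast
qed

lemma nonzero_rat_funs_theta':
  assumes "f \<in> nonzero_rat_funs" shows "(\<lambda>v. f (\<theta>' v)) \<in> nonzero_rat_funs"
proof -
  obtain d G H where GH: "form d G" "form d H" "nonvanishing G" "nonvanishing H"
    "f = (\<lambda>v. G v / H v)" using assms by (rule nonzero_rat_funsE)
  have nz: "nonvanishing (\<lambda>v. K (\<theta>' v))" if K: "nonvanishing K" for K :: "triple \<Rightarrow> complex"
  proof -
    obtain v where "v \<in> F4_coords" "K v \<noteq> 0" using K by blast
    then show ?thesis by (intro bexI[of _ "\<theta> v"]) (simp_all add: theta'_theta theta_coords)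
  qed
  show ?thesis
    unfolding GH(5) by (rule nonzero_rat_funsI[OF form_theta'[OF GH(1)] form_theta'[OF GH(2)] nz[OF GH(3)] nz[OF GH(4)]])
qed

lemma push_div_simps:
  "push_div \<theta> 0 = 0" "push_div \<theta> (frag_of P) = frag_of (\<theta> ` P)"
  "push_div \<theta> (D + E) = push_div \<theta> D + push_div \<theta> E" "push_div \<theta> (D - E) = push_div \<theta> D - push_div \<theta> E"
  "push_div \<theta> (- D) = - push_div \<theta> D" "push_div \<theta> (frag_cmul k D) = frag_cmul k (push_div \<theta> D)"
  by (simp_all add: push_div_def frag_extend_add frag_extend_diff frag_extend_minus frag_extend_cmul)

lemma lookup_push_div: "lookup (push_div \<theta> D) (\<theta> ` P) = lookup D P"
proof -
  have "support D \<subseteq> UNIV" by simp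
  then show ?thesis
    by (induction D rule: frag_induction)
      (auto simp: push_div_simps lookup_minus theta_image_eq_iff)
qed

lemma keys_push_div: "support D \<subseteq> F4 \<Longrightarrow> support (push_div \<theta> D) \<subseteq> F4"
  unfolding push_div_def using keys_frag_extend[of "\<lambda>P. frag_of (\<theta> ` P)" D] theta_F4 by fastforce

lemma push_div_Prin:
  assumes "D \<in> Prin" shows "push_div \<theta> D \<in> Prin"
proof -
  obtain f where f: "support D \<subseteq> F4" "f \<in> nonzero_rat_funs" "\<forall>P\<in>F4. has_ord f P (lookup D P)"
    using assms by (rule PrinE)
  show ?thesis
  proof (rule PrinI[OF keys_push_div[OF f(1)] nonzero_rat_funs_theta'[OF f(2)]])
    fix Q assume Q: "Q \<in> F4"
    interpret inv: curve_aut \<theta>' \<theta> by (rule inverse_aut)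
    have "has_ord f (\<theta>' ` Q) (lookup D (\<theta>' ` Q))"
      using f(3) inv.theta_F4[OF Q] by blast
    from has_ord_theta'[OF this] lookup_push_div[of D "\<theta>' ` Q"]
    show "has_ord (\<lambda>v. f (\<theta>' v)) Q (lookup (push_div \<theta> D) Q)"
      by (simp add: theta_image)
  qed
qed

end

lemma proj_image_linear:
  assumes "\<And>c x y z. \<theta> (c * x, c * y, c * z) = (case \<theta> (x, y, z) of (a, b, d) \<Rightarrow> (c * a, c * b, c * d))"
  shows "\<theta> ` proj v = proj (\<theta> v)"
proof -
  obtain x y z where v: "v = (x, y, z)" by (cases v)
  obtain a b d where w: "\<theta> (x, y, z) = (a, b, d)" by (cases "\<theta> (x, y, z)")
  have "\<theta> ` proj v = {\<theta> (c * x, c * y, c * z) | c. c \<in> Qbar \<and> c \<noteq> 0}"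
    unfolding proj_def v by auto
  also have "\<dots> = proj (\<theta> v)" by (simp add: v assms w proj_def)
  finally show ?thesis .
qed

section \<open>The constants and the three automorphisms\<close>

lemma zeta_4: "zeta 4 = \<i>"
proof -
  have "2 * of_real pi * \<i> / of_nat 4 = \<i> * of_real (pi / 2)" by simp
  then show ?thesis unfolding zeta_def by (simp add: exp_eq_polar cis.ctr complex_eq_iff)
qed

text \<open>Links the two choices of roots. The equations \<open>zeta 8 ^ 2 = \<i>\<close> and
  \<open>r2 ^ 4 = 2\<close> leave the sign of r2^2 relative to \<open>zeta 8\<close> open; the
  arithmetic of the cubic depends on it, through \<open>zeta_8_r2\<close>.\<close>

lemma zeta_8: "zeta 8 = (1 + \<i>) * r2 ^ 2 / 2"
proof -
  have "2 * of_real pi * \<i> / of_nat 8 = \<i> * of_real (pi / 4)" by simp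
  then have "zeta 8 = cis (pi / 4)" unfolding zeta_def by (simp add: exp_eq_polar)
  moreover have "root 4 2 ^ 2 = sqrt 2"
    by (rule real_sqrt_unique[symmetric]) (simp_all flip: power_mult)
  then have "r2 ^ 2 = of_real (sqrt 2)" unfolding r2_def by (simp flip: of_real_power)
  ultimately show ?thesis
    by (simp add: complex_eq_iff cos_45 sin_45)
qed

lemma zeta_8_sq: "zeta 8 ^ 2 = \<i>"
proof -
  have "zeta 8 ^ 2 = exp (2 * (2 * of_real pi * \<i> / of_nat 8))"
    unfolding zeta_def by (simp only: exp_double)
  also have "2 * (2 * of_real pi * \<i> / of_nat 8) = 2 * of_real pi * \<i> / of_nat 4" by simp
  finally show ?thesis using zeta_4 unfolding zeta_def by simp
qed

lemma r2_power4: "r2 ^ 4 = 2"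
  by (simp add: r2_def flip: of_real_power)

lemma zeta_Qbar: "zeta 4 \<in> Qbar" "zeta 8 \<in> Qbar" "r2 \<in> Qbar"
proof -
  show "zeta 4 \<in> Qbar" by (simp add: zeta_4)
  have "zeta 8 ^ 2 \<in> Qbar" by (simp add: zeta_8_sq)
  then show "zeta 8 \<in> Qbar" by (rule Qbar_powerD) simp
  have "r2 ^ 4 \<in> Qbar" by (simp add: r2_power4)
  then show "r2 \<in> Qbar" by (rule Qbar_powerD) simp
qed

lemma i_powers: "\<i> ^ 3 = - \<i>" "\<i> ^ 4 = 1"
  by (simp_all add: eval_nat_numeral)

lemma zeta_8_power7: "zeta 8 ^ 7 = - \<i> * zeta 8"
proof -
  have "zeta 8 ^ 7 = (zeta 8 ^ 2) ^ 3 * zeta 8" by (simp flip: power_mult power_Suc2)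
  then show ?thesis by (simp add: zeta_8_sq i_powers)
qed

lemma zeta_8_power4: "zeta 8 ^ 4 = -1"
proof -
  have "zeta 8 ^ 4 = (zeta 8 ^ 2) ^ 2" by (simp flip: power_mult)
  then show ?thesis by (simp add: zeta_8_sq)
qed

lemma zeta_r2_nonzero: "zeta 8 \<noteq> 0" "r2 \<noteq> 0"
  using zeta_8_power4 r2_power4 by auto

lemma form_linear_subst:
  assumes "form d G" "a1 \<in> Qbar" "a2 \<in> Qbar" "a3 \<in> Qbar" "b1 \<in> Qbar" "b2 \<in> Qbar" "b3 \<in> Qbar"
    "c1 \<in> Qbar" "c2 \<in> Qbar" "c3 \<in> Qbar"
  shows "form d (\<lambda>(x, y, z). G (a1 * x + a2 * y + a3 * z, b1 * x + b2 * y + b3 * z, c1 * x + c2 * y + c3 * z))"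
  by (rule form_cong[OF form_subst[OF form_linear form_linear form_linear assms(1)], of a1 a2 a3 b1 b2 b3 c1 c2 c3])
    (simp_all add: assms)

interpretation theta1: curve_aut theta1 "\<lambda>(x, y, z). (- \<i> * x, y, z)"
proof
  show "form d (\<lambda>v. G (theta1 v))" if "form d G" for d G
    by (rule form_cong[OF form_linear_subst[OF that, of \<i> 0 0 0 1 0 0 0 1]]) (simp_all add: theta1_def zeta_4)
  show "form d (\<lambda>v. G ((\<lambda>(x, y, z). (- \<i> * x, y, z)) v))" if "form d G" for d G
    by (rule form_cong[OF form_linear_subst[OF that, of "- \<i>" 0 0 0 1 0 0 0 1]]) (simp_all add: Qbar_minus)
  show "theta1 ` proj v = proj (theta1 v)" for v
    by (rule proj_image_linear) (simp add: theta1_def)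
qed (auto simp: F4_coords_def theta1_def zeta_4 power_mult_distrib i_powers)

interpretation theta2: curve_aut theta2 theta2
proof
  show "form d (\<lambda>v. G (theta2 v))" if "form d G" for d G
    by (rule form_cong[OF form_linear_subst[OF that, of 0 1 0 1 0 0 0 0 1]]) (simp_all add: theta2_def)
  show "theta2 ` proj v = proj (theta2 v)" for v
    by (rule proj_image_linear) (simp add: theta2_def)
qed (auto simp: F4_coords_def theta2_def add.commute)

lemma theta3_eq: "theta3 (x, y, z) = (- \<i> * zeta 8 * y, - \<i> * z, x)"
  by (simp add: theta3_def zeta_4 zeta_8_power7 i_powers)

lemma zeta_8_mult: "zeta 8 * zeta 8 = \<i>" "zeta 8 * (zeta 8 * x) = \<i> * x"
  using zeta_8_sq by (simp_all add: power2_eq_square flip: mult.assoc)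

interpretation theta3: curve_aut theta3 "\<lambda>(x, y, z). (z, zeta 8 * x, \<i> * y)"
proof
  show "form d (\<lambda>v. G (theta3 v))" if "form d G" for d G
    by (rule form_cong[OF form_linear_subst[OF that, of 0 "- \<i> * zeta 8" 0 0 0 "- \<i>" 1 0 0]])
      (simp_all add: theta3_eq Qbar_minus Qbar_mult zeta_Qbar)
  show "form d (\<lambda>v. G ((\<lambda>(x, y, z). (z, zeta 8 * x, \<i> * y)) v))" if "form d G" for d G
    by (rule form_cong[OF form_linear_subst[OF that, of 0 0 1 "zeta 8" 0 0 0 \<i> 0]]) (simp_all add: zeta_Qbar)
  show "theta3 ` proj v = proj (theta3 v)" for v
    by (rule proj_image_linear) (simp add: theta3_eq)
  show "theta3 v \<in> F4_coords" if "v \<in> F4_coords" for v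
  proof -
    obtain x y z where v: "v = (x, y, z)" by (cases v)
    have "x ^ 4 = z ^ 4 - y ^ 4" using F4_coordsD that v by (simp add: eq_diff_eq)
    then show ?thesis using that
      by (auto simp: v F4_coords_def theta3_eq power_mult_distrib i_powers zeta_8_power4 zeta_Qbar zeta_r2_nonzero
          intro!: Qbar_minus Qbar_mult)
  qed
  show "(\<lambda>(x, y, z). (z, zeta 8 * x, \<i> * y)) v \<in> F4_coords" if "v \<in> F4_coords" for v
  proof -
    obtain x y z where v: "v = (x, y, z)" by (cases v)
    have "z ^ 4 = x ^ 4 + y ^ 4" using F4_coordsD that v by simp
    then show ?thesis using that
      by (auto simp: v F4_coords_def power_mult_distrib i_powers zeta_8_power4 zeta_Qbar zeta_r2_nonzero)
  qed
  show "theta3 ((\<lambda>(x, y, z). (z, zeta 8 * x, \<i> * y)) v) = v" for v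
    by (cases v) (simp add: theta3_eq zeta_8_mult mult.assoc)
  show "(\<lambda>(x, y, z). (z, zeta 8 * x, \<i> * y)) (theta3 v) = v" for v
    by (cases v) (simp add: theta3_eq zeta_8_mult mult.assoc mult.left_commute)
qed

section \<open>Linear equivalence with multiples of \<open>4 B0\<close>\<close>

lemma deg_superset:
  assumes "finite S" "support D \<subseteq> S"
  shows "deg D = (\<Sum>P\<in>S. lookup D P)"
  unfolding deg_def using assms by (intro sum.mono_neutral_left) (auto simp: in_keys_iff)

lemma deg_add: "deg (D + E) = deg D + deg E"
proof -
  let ?S = "support D \<union> support E"
  have "support (D + E) \<subseteq> ?S" by (rule Poly_Mapping.keys_add)
  then have "deg (D + E) = (\<Sum>P\<in>?S. lookup (D + E) P)"
    by (intro deg_superset) auto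
  also have "\<dots> = (\<Sum>P\<in>?S. lookup D P) + (\<Sum>P\<in>?S. lookup E P)"
    by (simp add: lookup_add sum.distrib)
  also have "\<dots> = deg D + deg E"
    using deg_superset[of ?S D] deg_superset[of ?S E] by simp
  finally show ?thesis .
qed

lemma deg_cmul: "deg (frag_cmul k D) = k * deg D"
  using deg_superset[of "support D" "frag_cmul k D"] keys_cmul[of k D]
  by (simp add: deg_def sum_distrib_left)

lemma deg_0: "deg 0 = 0"
  by (simp add: deg_def)

lemma deg_frag_of: "deg (frag_of P) = 1"
  by (simp add: deg_def)

lemma deg_minus: "deg (- D) = - deg D"
  using deg_cmul[of "-1" D] by simp

lemma deg_diff: "deg (D - E) = deg D - deg E"
  using deg_add[of D "- E"] by (simp add: deg_minus)

lemma (in curve_aut) deg_push_div: "deg (push_div \<theta> D) = deg D"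
proof -
  have "support D \<subseteq> UNIV" by simp
  then show ?thesis
    by (induction D rule: frag_induction) (auto simp: push_div_simps deg_0 deg_frag_of deg_diff)
qed

text \<open>The group generated by the sections is handled through the property D ~ (deg D) B0. The
  condition that 4 divides the degree makes it stable under the automorphisms: only the fourfold of
  the image of B0 is known to be equivalent to 4 B0. In degree 0 the property is
  principality.\<close>

definition plane_sections :: "divisor set" where
  "plane_sections = {D. support D \<subseteq> F4 \<and> 4 dvd deg D \<and> D - frag_cmul (deg D) (frag_of (ptB 0)) \<in> Prin}"

lemma keys_add_F4: "support D \<subseteq> F4 \<Longrightarrow> support E \<subseteq> F4 \<Longrightarrow> support (D + E) \<subseteq> F4"
  using Poly_Mapping.keys_add[of D E] by blast

lemma keys_cmul_F4: "support D \<subseteq> F4 \<Longrightarrow> support (frag_cmul k D) \<subseteq> F4"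
  using keys_cmul[of k D] by blast

lemma frag_cmul_diff_distrib2: "frag_cmul c (D - E) = frag_cmul c D - frag_cmul c E"
  by (rule poly_mapping_eqI) (simp add: lookup_minus algebra_simps)

lemma plane_sections_0: "0 \<in> plane_sections"
  by (simp add: plane_sections_def deg_0 Prin_0)

lemma plane_sections_add:
  assumes "D \<in> plane_sections" "E \<in> plane_sections" shows "D + E \<in> plane_sections"
proof -
  have "D + E - frag_cmul (deg (D + E)) (frag_of (ptB 0)) =
    (D - frag_cmul (deg D) (frag_of (ptB 0))) + (E - frag_cmul (deg E) (frag_of (ptB 0)))"
    by (simp add: deg_add frag_cmul_distrib)
  also have "\<dots> \<in> Prin" using assms by (intro Prin_add) (auto simp: plane_sections_def)
  finally show ?thesis
    using assms by (simp add: plane_sections_def keys_add_F4 deg_add)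
qed

lemma plane_sections_cmul:
  assumes "D \<in> plane_sections" shows "frag_cmul k D \<in> plane_sections"
proof -
  have "frag_cmul k D - frag_cmul (deg (frag_cmul k D)) (frag_of (ptB 0)) =
    frag_cmul k (D - frag_cmul (deg D) (frag_of (ptB 0)))"
    by (simp add: deg_cmul frag_cmul_diff_distrib2)
  also have "\<dots> \<in> Prin" using assms by (intro Prin_cmul) (auto simp: plane_sections_def)
  finally show ?thesis
    using assms by (simp add: plane_sections_def keys_cmul_F4 deg_cmul)
qed

lemma (in curve_aut) plane_sections_push:
  assumes "D \<in> plane_sections"
    and B: "frag_cmul 4 (frag_of (\<theta> ` ptB 0)) - frag_cmul 4 (frag_of (ptB 0)) \<in> Prin"
  shows "push_div \<theta> D \<in> plane_sections"
proof -
  obtain m where m: "deg D = m * 4" using assms(1) by (auto simp: plane_sections_def)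
  have "push_div \<theta> (D - frag_cmul (deg D) (frag_of (ptB 0))) \<in> Prin"
    using assms by (intro push_div_Prin) (simp add: plane_sections_def)
  from Prin_add[OF this Prin_cmul[OF B, of m]]
  have "push_div \<theta> D - frag_cmul (deg D) (frag_of (ptB 0)) \<in> Prin"
    by (simp add: push_div_simps m frag_cmul_diff_distrib2 del: minus_frag_cmul)
  then show ?thesis
    using assms(1) by (simp add: plane_sections_def deg_push_div keys_push_div)
qed

section \<open>Formal sums of labelled points\<close>

text \<open>Besides the cusps, the points \<open>P1, P2, P3\<close> have 48 conjugates under the group generated by
  the three automorphisms: \<open>LU a b\<close>, \<open>LV a b\<close>, \<open>LW a b\<close> stand for the conjugates of
  \<open>P1, P2, P3\<close> respectively, exponents being taken modulo 4.\<close>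

datatype lab = LA nat | LB nat | LC nat | LU nat nat | LV nat nat | LW nat nat

fun co :: "lab \<Rightarrow> triple" where
  "co (LA a) = (0, \<i> ^ a, 1)"
| "co (LB a) = (\<i> ^ a, 0, 1)"
| "co (LC a) = (zeta 8 * \<i> ^ a, 1, 0)"
| "co (LU a b) = (r2 * \<i> ^ a, zeta 8 * \<i> ^ b, 1)"
| "co (LV a b) = (zeta 8 * \<i> ^ a, r2 * \<i> ^ b, 1)"
| "co (LW a b) = (inverse r2 * \<i> ^ a, inverse r2 * \<i> ^ b, 1)"

definition pt :: "lab \<Rightarrow> point" where "pt l = proj (co l)"

fun act1 :: "lab \<Rightarrow> lab" where
  "act1 (LA a) = LA a"
| "act1 (LB a) = LB ((a + 1) mod 4)"
| "act1 (LC a) = LC ((a + 1) mod 4)"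
| "act1 (LU a b) = LU ((a + 1) mod 4) b"
| "act1 (LV a b) = LV ((a + 1) mod 4) b"
| "act1 (LW a b) = LW ((a + 1) mod 4) b"

text \<open>Modulo 4, \<open>3 * a\<close> stands for -a. The constants in \<open>act2\<close> and
  \<open>act3\<close> come from rescaling an image vector to the shape used in \<open>co\<close>: 1
  / zeta 8 = zeta 8 \<i>^3, and the coefficients of theta3 contribute -\<i> = \<i>^3.\<close>

fun act2 :: "lab \<Rightarrow> lab" where
  "act2 (LA a) = LB a"
| "act2 (LB a) = LA a"
| "act2 (LC a) = LC ((3 + 3 * a) mod 4)"
| "act2 (LU a b) = LV b a"
| "act2 (LV a b) = LU b a"
| "act2 (LW a b) = LW b a"

fun act3 :: "lab \<Rightarrow> lab" where
  "act3 (LA a) = LC a"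
| "act3 (LB a) = LA ((3 + 3 * a) mod 4)"
| "act3 (LC a) = LB ((3 + 3 * a) mod 4)"
| "act3 (LU a b) = LW ((b + 3 * a) mod 4) ((3 + 3 * a) mod 4)"
| "act3 (LV a b) = LU ((3 + b + 3 * a) mod 4) ((2 + 3 * a) mod 4)"
| "act3 (LW a b) = LV ((3 + b + 3 * a) mod 4) ((3 + 3 * a) mod 4)"

lemma i_power_mod: "\<i> ^ (n mod 4) = \<i> ^ n"
proof -
  have "\<i> ^ n = \<i> ^ (4 * (n div 4) + n mod 4)" by simp
  also have "\<dots> = \<i> ^ (n mod 4)" unfolding power_add power_mult by (simp add: i_powers)
  finally show ?thesis by simp
qed

lemma i_power_inverse: "\<i> ^ a * \<i> ^ (3 * a) = 1"
proof -
  have "\<i> ^ a * \<i> ^ (3 * a) = \<i> ^ (4 * a)" by (simp flip: power_add)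
  then show ?thesis by (simp add: power_mult i_powers)
qed

lemma i_power_Qbar: "\<i> ^ a \<in> Qbar"
  by (intro Qbar_power Qbar_ii)

lemma proj_scaledI:
  assumes "c \<in> Qbar" "c \<noteq> 0" "x' = c * x" "y' = c * y" "z' = c * z"
  shows "proj (x', y', z') = proj (x, y, z)"
  unfolding assms by (rule proj_scale[OF assms(1,2)])

lemma theta1_pt: "theta1 ` pt l = pt (act1 l)"
  unfolding pt_def theta1.theta_proj
  by (cases l) (simp_all add: theta1_def zeta_4 i_power_mod mult_ac)

lemma theta2_pt: "theta2 ` pt l = pt (act2 l)"
proof -
  have "proj (1, zeta 8 * \<i> ^ a, 0) = proj (zeta 8 * \<i> ^ (3 + 3 * a), 1, 0)" for a
  proof (rule proj_scaledI[of "zeta 8 * \<i> ^ a"])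
    have "zeta 8 * \<i> ^ a * (zeta 8 * \<i> ^ (3 + 3 * a)) = zeta 8 ^ 2 * \<i> ^ 3 * (\<i> ^ a * \<i> ^ (3 * a))"
      by (simp add: power_add power2_eq_square)
    then show "1 = zeta 8 * \<i> ^ a * (zeta 8 * \<i> ^ (3 + 3 * a))"
      by (simp add: i_power_inverse zeta_8_sq i_powers)
  qed (auto simp: zeta_r2_nonzero zeta_Qbar i_power_Qbar)
  then show ?thesis
    unfolding pt_def theta2.theta_proj by (cases l) (simp_all add: theta2_def i_power_mod del: power_Suc)
qed

text \<open>The rescalings behind \<open>theta3_pt\<close>, in letters: J and K stand for \<i>^a and
  its inverse \<i>^(3a), B for \<i>^b, R for 1 / r2. With the actual constants, simplification would
  rewrite them before the factors could be matched.\<close>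

lemma theta3_scalars:
  fixes J K B r R z I :: complex
  assumes "J * K = 1" "r * R = 1" "z * z = I" "I * I = -1"
  shows "- I * z * 1 = z * J * (- I * K)"
    "- I * z * (z * B) = r * J * (R * (B * K))" "- I * 1 = r * J * (R * (- I * K))"
    "- I * z * (r * B) = z * J * (r * (- I * (B * K)))" "- I * 1 = z * J * (z * - K)"
    "- I * z * (R * B) = R * J * (z * (- I * (B * K)))" "- I * 1 = R * J * (r * (- I * K))"
proof -
  have II: "- I * I = 1" using assms(4) by simp
  have e: "z * J * (- I * K) = - I * z * (J * K)" "r * J * (R * (B * K)) = (r * R) * (J * K) * B"
    "r * J * (R * (- I * K)) = - I * (r * R) * (J * K)"
    "z * J * (r * (- I * (B * K))) = - I * z * (r * B) * (J * K)" "z * J * (z * - K) = - ((z * z) * (J * K))"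
    "R * J * (z * (- I * (B * K))) = - I * z * (R * B) * (J * K)"
    "R * J * (r * (- I * K)) = - I * (r * R) * (J * K)" "- I * z * (z * B) = - I * (z * z) * B"
    by (simp_all add: mult_ac)
  show "- I * z * 1 = z * J * (- I * K)"
    "- I * z * (z * B) = r * J * (R * (B * K))" "- I * 1 = r * J * (R * (- I * K))"
    "- I * z * (r * B) = z * J * (r * (- I * (B * K)))" "- I * 1 = z * J * (z * - K)"
    "- I * z * (R * B) = R * J * (z * (- I * (B * K)))" "- I * 1 = R * J * (r * (- I * K))"
    unfolding e assms(1-3) II by simp_all
qed

lemma theta3_pt: "theta3 ` pt l = pt (act3 l)"
proof -
  have e: "\<i> ^ (3 + n) = - \<i> * \<i> ^ n" "\<i> ^ (3 + b + n) = - \<i> * (\<i> ^ b * \<i> ^ n)"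
    "\<i> ^ (2 + n) = - (\<i> ^ n)" for b n by (simp_all add: power_add i_powers)
  have r: "r2 * inverse r2 = 1" using zeta_r2_nonzero by simp
  note alg = theta3_scalars[OF i_power_inverse r zeta_8_mult(1) i_squared]
  note side = zeta_r2_nonzero zeta_Qbar i_power_Qbar Qbar_mult Qbar_inverse
  have "proj (theta3 (co l)) = proj (co (act3 l))"
  proof (cases l)
    case (LA a)
    have "proj (- \<i> * zeta 8 * \<i> ^ a, - \<i> * 1, 0) = proj (zeta 8 * \<i> ^ a, 1, 0)"
      by (rule proj_scaledI[of "- \<i>"]) auto
    then show ?thesis by (simp add: LA theta3_eq)
  next
    case (LB a)
    have "proj (- \<i> * zeta 8 * 0, - \<i> * 1, \<i> ^ a) = proj (0, - \<i> * \<i> ^ (3 * a), 1)"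
      by (rule proj_scaledI[of "\<i> ^ a"]) (use i_power_inverse[of a] in \<open>simp_all add: side mult_ac\<close>)
    then show ?thesis by (simp add: LB theta3_eq i_power_mod e)
  next
    case (LC a)
    have "proj (- \<i> * zeta 8 * 1, - \<i> * 0, zeta 8 * \<i> ^ a) = proj (- \<i> * \<i> ^ (3 * a), 0, 1)"
    proof (rule proj_scaledI[of "zeta 8 * \<i> ^ a"])
      show "- \<i> * zeta 8 * 1 = zeta 8 * \<i> ^ a * (- \<i> * \<i> ^ (3 * a))"
        by (rule alg)
    qed (simp_all add: side)
    then show ?thesis by (simp add: LC theta3_eq i_power_mod e)
  next
    case (LU a b)
    have "proj (- \<i> * zeta 8 * (zeta 8 * \<i> ^ b), - \<i> * 1, r2 * \<i> ^ a) =
      proj (inverse r2 * (\<i> ^ b * \<i> ^ (3 * a)), inverse r2 * (- \<i> * \<i> ^ (3 * a)), 1)"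
    proof (rule proj_scaledI[of "r2 * \<i> ^ a"])
      show "- \<i> * zeta 8 * (zeta 8 * \<i> ^ b) = r2 * \<i> ^ a * (inverse r2 * (\<i> ^ b * \<i> ^ (3 * a)))"
        by (rule alg)
      show "- \<i> * 1 = r2 * \<i> ^ a * (inverse r2 * (- \<i> * \<i> ^ (3 * a)))"
        by (rule alg)
    qed (simp_all add: side)
    then show ?thesis by (simp add: LU theta3_eq i_power_mod e) (simp add: power_add)
  next
    case (LV a b)
    have "proj (- \<i> * zeta 8 * (r2 * \<i> ^ b), - \<i> * 1, zeta 8 * \<i> ^ a) =
      proj (r2 * (- \<i> * (\<i> ^ b * \<i> ^ (3 * a))), zeta 8 * - (\<i> ^ (3 * a)), 1)"
    proof (rule proj_scaledI[of "zeta 8 * \<i> ^ a"])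
      show "- \<i> * zeta 8 * (r2 * \<i> ^ b) = zeta 8 * \<i> ^ a * (r2 * (- \<i> * (\<i> ^ b * \<i> ^ (3 * a))))"
        by (rule alg)
      show "- \<i> * 1 = zeta 8 * \<i> ^ a * (zeta 8 * - (\<i> ^ (3 * a)))"
        by (rule alg)
    qed (simp_all add: side)
    then show ?thesis by (simp add: LV theta3_eq i_power_mod e)
  next
    case (LW a b)
    have "proj (- \<i> * zeta 8 * (inverse r2 * \<i> ^ b), - \<i> * 1, inverse r2 * \<i> ^ a) =
      proj (zeta 8 * (- \<i> * (\<i> ^ b * \<i> ^ (3 * a))), r2 * (- \<i> * \<i> ^ (3 * a)), 1)"
    proof (rule proj_scaledI[of "inverse r2 * \<i> ^ a"])
      show "- \<i> * zeta 8 * (inverse r2 * \<i> ^ b) = inverse r2 * \<i> ^ a * (zeta 8 * (- \<i> * (\<i> ^ b * \<i> ^ (3 * a))))"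
        by (rule alg)
      show "- \<i> * 1 = inverse r2 * \<i> ^ a * (r2 * (- \<i> * \<i> ^ (3 * a)))"
        by (rule alg)
    qed (simp_all add: side)
    then show ?thesis by (simp add: LW theta3_eq i_power_mod e)
  qed
  then show ?thesis unfolding pt_def theta3.theta_proj .
qed

lemma co_F4_coords: "co l \<in> F4_coords"
proof -
  have p4: "(\<i> ^ a) ^ 4 = 1" for a by (metis i_powers(2) mult.commute power_mult power_one)
  have w: "inverse r2 ^ 4 + inverse r2 ^ 4 = 1" by (simp add: power_inverse r2_power4)
  show ?thesis
    by (cases l)
      (use w in \<open>auto simp: F4_coords_def zeta_Qbar i_power_Qbar Qbar_mult Qbar_inverse power_mult_distrib p4
         zeta_8_power4 r2_power4\<close>)
qed

lemma pt_F4: "pt l \<in> F4"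
  unfolding pt_def by (rule proj_in_F4[OF co_F4_coords])

type_synonym formal = "(int \<times> lab) list"

definition DD :: "formal \<Rightarrow> divisor" where
  "DD xs = sum_list (map (\<lambda>(k, l). frag_cmul k (frag_of (pt l))) xs)"

definition coef :: "formal \<Rightarrow> lab \<Rightarrow> int" where
  "coef xs l = sum_list (map (\<lambda>(k, m). if m = l then k else 0) xs)"

definition scale :: "int \<Rightarrow> formal \<Rightarrow> formal" where
  "scale k xs = map (\<lambda>(c, l). (k * c, l)) xs"

definition relabel :: "(lab \<Rightarrow> lab) \<Rightarrow> formal \<Rightarrow> formal" where
  "relabel f xs = map (\<lambda>(c, l). (c, f l)) xs"

lemma DD_simps: "DD [] = 0" "DD ((k, l) # xs) = frag_cmul k (frag_of (pt l)) + DD xs"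
  "DD (xs @ ys) = DD xs + DD ys"
  by (simp_all add: DD_def)

lemma DD_scale: "DD (scale k xs) = frag_cmul k (DD xs)"
  by (induction xs) (auto simp: scale_def DD_simps frag_cmul_distrib2)

lemma relabel_relabel: "relabel f (relabel g xs) = relabel (\<lambda>l. f (g l)) xs"
  by (induction xs) (auto simp: relabel_def)

lemma keys_DD: "support (DD xs) \<subseteq> F4"
proof (induction xs)
  case (Cons x xs)
  obtain k l where x: "x = (k, l)" by (cases x)
  have "support (frag_cmul k (frag_of (pt l))) \<subseteq> F4"
    by (rule keys_cmul_F4) (simp add: pt_F4)
  then show ?case unfolding x DD_simps by (rule keys_add_F4[OF _ Cons])
qed (simp add: DD_simps)

lemma deg_DD: "deg (DD xs) = sum_list (map fst xs)"
  by (induction xs) (auto simp: DD_simps deg_0 deg_add deg_cmul deg_frag_of)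

lemma DD_eq_coef:
  assumes "finite S" "snd ` set xs \<subseteq> S"
  shows "DD xs = (\<Sum>l\<in>S. frag_cmul (coef xs l) (frag_of (pt l)))"
  using assms(2)
proof (induction xs)
  case Nil
  then show ?case by (simp add: DD_simps coef_def)
next
  case (Cons x xs)
  obtain k m where x: "x = (k, m)" by (cases x)
  have "coef (x # xs) l = (if m = l then k else 0) + coef xs l" for l
    by (simp add: coef_def x)
  then have "(\<Sum>l\<in>S. frag_cmul (coef (x # xs) l) (frag_of (pt l))) =
     (\<Sum>l\<in>S. frag_cmul (if m = l then k else 0) (frag_of (pt l))) + DD xs"
    using Cons by (simp add: frag_cmul_distrib sum.distrib)
  also have "(\<Sum>l\<in>S. frag_cmul (if m = l then k else 0) (frag_of (pt l))) =
     (\<Sum>l\<in>S. if m = l then frag_cmul k (frag_of (pt l)) else 0)"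
    by (intro sum.cong) auto
  also have "\<dots> = frag_cmul k (frag_of (pt m))"
    using Cons.prems assms(1) by (simp add: x)
  finally show ?case by (simp add: x DD_simps)
qed

text \<open>Labels rather than points are compared, which turns an equality of divisors into a
  finite integer computation.\<close>

lemma DD_eqI:
  assumes "list_all (\<lambda>l. coef xs l = coef ys l) (map snd (xs @ ys))"
  shows "DD xs = DD ys"
proof -
  let ?S = "set (map snd (xs @ ys))"
  have "DD xs = (\<Sum>l\<in>?S. frag_cmul (coef xs l) (frag_of (pt l)))"
    by (rule DD_eq_coef) auto
  also have "\<dots> = (\<Sum>l\<in>?S. frag_cmul (coef ys l) (frag_of (pt l)))"
    using assms by (intro sum.cong) (auto simp: list_all_iff)
  also have "\<dots> = DD ys"
    by (rule DD_eq_coef[symmetric]) auto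
  finally show ?thesis .
qed

lemma push_DD:
  assumes "curve_aut \<theta> \<theta>'" "\<And>l. \<theta> ` pt l = pt (f l)"
  shows "push_div \<theta> (DD xs) = DD (relabel f xs)"
proof -
  interpret curve_aut \<theta> \<theta>' by fact
  show ?thesis
    by (induction xs) (auto simp: DD_simps relabel_def push_div_simps assms(2))
qed

lemmas push_DD_thetas = push_DD[OF theta1.curve_aut_axioms theta1_pt]
  push_DD[OF theta2.curve_aut_axioms theta2_pt] push_DD[OF theta3.curve_aut_axioms theta3_pt]

text \<open>The intersections of the curve with the tangent at \<open>A0\<close>, the line \<open>x = 0\<close>, a conic and a cubic.\<close>

fun gen :: "nat \<Rightarrow> formal" where
  "gen n = (if n = 0 then [(4, LA 0)]
    else if n = 1 then [(1, LA 0), (1, LA 1), (1, LA 2), (1, LA 3)]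
    else if n = 2 then [(2, LA 0), (2, LA 1), (1, LB 0), (1, LB 2), (1, LC 1), (1, LC 3)]
    else [(1, LA 0), (1, LA 1), (1, LA 2), (1, LB 1), (1, LB 2), (1, LB 3),
      (1, LU 1 0), (1, LV 0 1), (1, LW 0 0), (1, LU 2 3), (1, LV 1 0), (1, LW 1 3)])"

definition act :: "nat \<Rightarrow> lab \<Rightarrow> lab" where
  "act k = (if k = 1 then act1 else if k = 2 then act2 else act3)"

text \<open>In a triple (k, n, w), w is a word in the automorphisms 1, 2, 3 whose last letter acts
  first on the generator n.\<close>

definition combination :: "(int \<times> nat \<times> nat list) list \<Rightarrow> formal" where
  "combination cs = concat (map (\<lambda>(k, n, w). scale k (relabel (foldr act w) (gen n))) cs)"

section \<open>Divisors of the generating forms\<close>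

lemma i_power_eq_iff: "a < 4 \<Longrightarrow> b < 4 \<Longrightarrow> \<i> ^ a = \<i> ^ b \<longleftrightarrow> a = b"
proof -
  assume "a < 4" "b < 4"
  then have "a \<in> {0, 1, 2, 3}" "b \<in> {0, 1, 2, 3}" by auto
  then show ?thesis by (auto simp: i_powers complex_eq_iff)
qed

lemma fourth_root_of_unity:
  assumes "x ^ 4 = (1 :: complex)" obtains a where "a < 4" "x = \<i> ^ a"
proof -
  have "(x - 1) * (x - \<i>) * (x + 1) * (x + \<i>) = x ^ 4 - 1"
    by (simp add: algebra_simps eval_nat_numeral)
  then have "x = 1 \<or> x = \<i> \<or> x = - 1 \<or> x = - \<i>"
    using assms by (auto simp: add_eq_0_iff2)
  then show ?thesis
    using that[of 0] that[of 1] that[of 2] that[of 3] by (auto simp: i_powers)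
qed

fun normal :: "lab \<Rightarrow> bool" where
  "normal (LA a) = (a < 4)"
| "normal (LB a) = (a < 4)"
| "normal (LC a) = (a < 4)"
| "normal (LU a b) = (a < 4 \<and> b < 4)"
| "normal (LV a b) = (a < 4 \<and> b < 4)"
| "normal (LW a b) = (a < 4 \<and> b < 4)"

text \<open>The vanishing coordinates separate the cusps from each other and from the rest. The
  other families differ in the fourth powers -1, 2 and 1/2 of \<open>zeta 8\<close>,
  \<open>r2\<close> and its inverse; inside a family the exponents of \<i> decide.\<close>

lemma pt_inj:
  assumes "pt l = pt m" "normal l" "normal m" shows "l = m"
proof -
  have "co l \<in> proj (co m)" using assms(1) proj_self[of "co l"] by (simp add: pt_def)
  moreover obtain x y z where m: "co m = (x, y, z)" by (cases "co m")
  ultimately obtain c where c: "c \<noteq> 0" "co l = (c * x, c * y, c * z)"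
    by (auto elim: projE)
  have p4: "(\<i> ^ a) ^ 4 = 1" for a by (metis i_powers(2) mult.commute power_mult power_one)
  note nz = zeta_r2_nonzero r2_power4 zeta_8_power4
  have "u * \<i> ^ a \<noteq> w * \<i> ^ b" if "u ^ 4 \<noteq> w ^ 4" for u w a b
  proof
    assume "u * \<i> ^ a = w * \<i> ^ b"
    then have "(u * \<i> ^ a) ^ 4 = (w * \<i> ^ b) ^ 4" by simp
    then show False using that by (simp add: power_mult_distrib p4)
  qed
  from this[of "zeta 8" r2] this[of "zeta 8" "inverse r2"] this[of r2 "inverse r2"]
  have ne: "zeta 8 * \<i> ^ a \<noteq> r2 * \<i> ^ b" "zeta 8 * \<i> ^ a \<noteq> inverse r2 * \<i> ^ b"
    "r2 * \<i> ^ a \<noteq> inverse r2 * \<i> ^ b" for a b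
    by (simp_all add: power_inverse nz)
  show ?thesis
    using assms(2,3) c m nz ne[symmetric] ne
    by (cases l; cases m) (auto simp: i_power_eq_iff)
qed

text \<open>The number 4 d is the one in Bezout's theorem. It is part of the definition, checked on
  each explicit list, and determines the multiple of B0 in
  \<open>has_divisor_plane_section\<close>.\<close>

definition has_divisor :: "nat \<Rightarrow> (triple \<Rightarrow> complex) \<Rightarrow> formal \<Rightarrow> bool" where
  "has_divisor d G xs \<longleftrightarrow> form d G \<and> nonvanishing G \<and> sum_list (map fst xs) = 4 * int d \<and>
    (\<forall>v\<in>F4_coords. \<exists>n. ford d G v n \<and> lookup (DD xs) (proj v) = int n)"

lemma lookup_DD: "lookup (DD xs) P = sum_list (map (\<lambda>(k, l). if pt l = P then k else 0) xs)"
  by (induction xs) (auto simp: DD_simps lookup_add)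

lemma lookup_DD_pt:
  assumes "list_all normal (map snd xs)" "normal l"
  shows "lookup (DD xs) (pt l) = coef xs l"
  unfolding lookup_DD coef_def
  using assms pt_inj by (intro arg_cong[of _ _ sum_list] map_cong) (auto simp: list_all_iff)

lemma coef_simps: "coef [] l = 0" "coef ((k, m) # xs) l = (if m = l then k else 0) + coef xs l"
  by (simp_all add: coef_def)

lemma coef_absent: "l \<notin> snd ` set xs \<Longrightarrow> coef xs l = 0"
  by (induction xs) (auto simp: coef_simps)

lemma coef_distinct: "distinct (map snd xs) \<Longrightarrow> (k, l) \<in> set xs \<Longrightarrow> coef xs l = k"
proof (induction xs)
  case (Cons x xs)
  obtain k' m where x: "x = (k', m)" by (cases x)
  show ?case
  proof (cases "m = l")
    case True
    then have "l \<notin> snd ` set xs" using Cons.prems(1) by (simp add: x)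
    moreover from this have "(k, l) \<notin> set xs" by (metis image_eqI snd_conv)
    ultimately show ?thesis using Cons.prems(2) True by (simp add: x coef_simps coef_absent)
  next
    case False
    then show ?thesis using Cons by (simp add: x coef_simps)
  qed
qed simp

lemma ford_scale_point:
  assumes "ford d G v n" "w \<in> proj v"
  shows "ford d G w n"
proof -
  obtain l e a U A where 1: "unif v l" "form e U" "form a A" "e + d = n + a" "U v \<noteq> 0" "A v \<noteq> 0"
    "\<forall>w\<in>F4_coords. U w * G w = l w ^ n * A w"
    using assms(1) unfolding ford_def by blast
  have z: "form k K \<Longrightarrow> K w = 0 \<longleftrightarrow> K v = 0" for k K using form_zero_proj[OF _ assms(2)] .
  have "unif w l"
    unfolding unif_def
  proof (intro conjI allI impI)
    show "form (Suc 0) l" "nonvanishing l" using unifD[OF 1(1)] by auto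
    show "l w = 0" using z[OF unifD(1)[OF 1(1)]] unifD(2)[OF 1(1)] by simp
    fix k K assume "form k K \<and> K w = 0"
    then have K: "form k K" "K v = 0" using z by auto
    obtain e h U H where "form e U" "form h H" "e + k = Suc h" "U v \<noteq> 0" "\<forall>w\<in>F4_coords. U w * K w = l w * H w"
      using unifE[OF 1(1) K] .
    then show "\<exists>e h U H. form e U \<and> form h H \<and> e + k = Suc h \<and> U w \<noteq> 0 \<and> (\<forall>w\<in>F4_coords. U w * K w = l w * H w)"
      using z by blast
  qed
  then show ?thesis
    by (rule fordI[OF _ 1(2-4)]) (use 1(5-7) z[OF 1(2)] z[OF 1(3)] in auto)
qed

lemma has_divisorI:
  assumes G: "form d G" and deg: "sum_list (map fst xs) = 4 * int d"
    and normal: "list_all normal (map snd xs)" and dist: "distinct (map snd xs)"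
    and pos: "\<And>k l. (k, l) \<in> set xs \<Longrightarrow> 0 \<le> k \<and> ford d G (co l) (nat k)"
    and zero: "\<And>v. v \<in> F4_coords \<Longrightarrow> G v = 0 \<Longrightarrow> proj v \<in> pt ` snd ` set xs"
    and nz: "nonvanishing G"
  shows "has_divisor d G xs"
  unfolding has_divisor_def
proof (intro conjI ballI G deg nz)
  fix v assume v: "v \<in> F4_coords"
  show "\<exists>n. ford d G v n \<and> lookup (DD xs) (proj v) = int n"
  proof (cases "proj v \<in> pt ` snd ` set xs")
    case False
    then have "G v \<noteq> 0" using zero[OF v] by auto
    moreover have "pt (snd x) \<noteq> proj v" if "x \<in> set xs" for x
      using False imageI[OF imageI[OF that, of snd], of pt] by force
    then have "lookup (DD xs) (proj v) = 0"
      unfolding lookup_DD by (induction xs) (simp_all add: split_beta)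
    ultimately show ?thesis using ford_0[OF v G] by (intro exI[of _ 0]) simp
  next
    case True
    then obtain k l where kl: "(k, l) \<in> set xs" "proj v = pt l" by auto
    have "l \<in> set (map snd xs)" using imageI[OF kl(1), of snd] by simp
    then have nl: "normal l" using normal unfolding list_all_iff by blast
    have "coef xs l = k"
      using dist kl(1) by (rule coef_distinct)
    then have "lookup (DD xs) (proj v) = k"
      using lookup_DD_pt[OF normal nl] kl(2) by simp
    moreover have "ford d G v (nat k)"
      using pos[OF kl(1)] ford_scale_point[of d G "co l" "nat k" v] proj_self[of v] kl(2)
      by (simp add: pt_def)
    ultimately show ?thesis using pos[OF kl(1)] by (intro exI[of _ "nat k"]) simp
  qed
qed

lemma has_divisor_Prin:
  assumes "has_divisor d G xs" "has_divisor d H ys" shows "DD xs - DD ys \<in> Prin"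
proof (rule PrinI)
  show "support (DD xs - DD ys) \<subseteq> F4"
    using keys_DD[of xs] keys_DD[of ys] Poly_Mapping.keys_diff[of "DD xs" "DD ys"] by blast
  show "(\<lambda>v. G v / H v) \<in> nonzero_rat_funs"
    using assms unfolding has_divisor_def by (intro nonzero_rat_funsI[of d]) auto
  fix P assume "P \<in> F4"
  then obtain v where v: "v \<in> F4_coords" "P = proj v" by (rule F4E)
  obtain m where m: "ford d G v m" "lookup (DD xs) (proj v) = int m"
    using assms(1) v(1) unfolding has_divisor_def by blast
  obtain n where n: "ford d H v n" "lookup (DD ys) (proj v) = int n" "form d H"
    using assms(2) v(1) unfolding has_divisor_def by blast
  show "has_ord (\<lambda>v. G v / H v) P (lookup (DD xs - DD ys) P)"
    using has_ord_quotient[OF m(1) n(1,3) v(1)] by (simp add: v(2) lookup_minus m n)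
qed

lemma has_divisor_power:
  assumes "has_divisor d G xs" shows "has_divisor (k * d) (\<lambda>v. G v ^ k) (scale (int k) xs)"
  unfolding has_divisor_def
proof (intro conjI ballI)
  have G: "form d G" "nonvanishing G" "sum_list (map fst xs) = 4 * int d"
    using assms unfolding has_divisor_def by auto
  show "form (k * d) (\<lambda>v. G v ^ k)" by (rule form_power[OF G(1)])
  show "nonvanishing (\<lambda>v. G v ^ k)" using G(2) by auto
  have "sum_list (map fst (scale (int k) xs)) = int k * sum_list (map fst xs)"
    by (induction xs) (auto simp: scale_def algebra_simps)
  then show "sum_list (map fst (scale (int k) xs)) = 4 * int (k * d)" using G(3) by simp
  fix v assume v: "v \<in> F4_coords"
  obtain n where n: "ford d G v n" "lookup (DD xs) (proj v) = int n"
    using assms v unfolding has_divisor_def by blast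
  show "\<exists>n. ford (k * d) (\<lambda>v. G v ^ k) v n \<and> lookup (DD (scale (int k) xs)) (proj v) = int n"
    using ford_power[OF n(1) v, of k] n(2) by (intro exI[of _ "k * n"]) (simp add: DD_scale)
qed

text \<open>The form is compared with the d-th power of the flex tangent at B0: the quotient G / L^d
  has divisor D - 4d B0.\<close>

lemma has_divisor_plane_section:
  assumes "has_divisor d G xs" "has_divisor 1 L [(4, LB 0)]"
  shows "DD xs \<in> plane_sections"
proof -
  have "has_divisor d (\<lambda>v. L v ^ d) (scale (int d) [(4, LB 0)])"
    using has_divisor_power[OF assms(2), of d] by simp
  from has_divisor_Prin[OF assms(1) this]
  have "DD xs - frag_cmul (4 * int d) (frag_of (ptB 0)) \<in> Prin"
    by (simp add: scale_def DD_simps ptB_def pt_def zeta_4 mult.commute)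
  moreover have "deg (DD xs) = 4 * int d"
    using assms(1) by (simp add: has_divisor_def deg_DD)
  ultimately show ?thesis
    by (simp add: plane_sections_def keys_DD)
qed

section \<open>Orders of forms from identities on the curve\<close>

definition xc :: "triple \<Rightarrow> complex" where "xc = fst"
definition yc :: "triple \<Rightarrow> complex" where "yc v = fst (snd v)"
definition zc :: "triple \<Rightarrow> complex" where "zc v = snd (snd v)"

lemma coords_simps [simp]: "xc (x, y, z) = x" "yc (x, y, z) = y" "zc (x, y, z) = z"
  by (simp_all add: xc_def yc_def zc_def)

lemma form_xc: "form (Suc 0) xc" and form_yc: "form (Suc 0) yc" and form_zc: "form (Suc 0) zc"
  using form_coords by (simp_all add: xc_def yc_def[abs_def] zc_def[abs_def])

lemma form_multI: "form d G \<Longrightarrow> form e H \<Longrightarrow> n = d + e \<Longrightarrow> form n (\<lambda>v. G v * H v)"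
  using form_mult by simp

lemma form_powerI: "form d G \<Longrightarrow> n = k * d \<Longrightarrow> form n (\<lambda>v. G v ^ k)"
  using form_power by simp

lemma F4_curve_eq: "v \<in> F4_coords \<Longrightarrow> xc v ^ 4 + yc v ^ 4 = zc v ^ 4"
  by (cases v) (simp add: F4_coordsD)

lemma F4_coords_nonzero: "(x, y, z) \<in> F4_coords \<Longrightarrow> (x, y, z) \<noteq> (0, 0, 0)"
  by (simp add: F4_coords_def)

text \<open>The pattern of every order computation below: an identity V G = l^n K on the curve, with
  V and K nonzero at the point and l a local parameter there.\<close>

lemma ford_witness:
  assumes "v \<in> F4_coords" "form e V" "V v \<noteq> 0" "ford (Suc 0) l v (Suc 0)" "form m K" "K v \<noteq> 0"
    "e + d = n + m" "\<And>w. w \<in> F4_coords \<Longrightarrow> V w * G w = l w ^ n * K w"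
  shows "ford d G v n"
proof (rule ford_cofactor[OF _ assms(2,3,1)])
  have "ford (n * Suc 0 + m) (\<lambda>w. l w ^ n * K w) v (n * Suc 0 + 0)"
    by (intro ford_mult ford_power assms ford_0)
  then have "ford (e + d) (\<lambda>w. l w ^ n * K w) v n"
    by (simp add: assms(7))
  then show "ford (e + d) (\<lambda>w. V w * G w) v n"
    by (rule ford_cong) (simp add: assms(8))
qed

lemma ford_linear:
  assumes "(x0, y0, 1) \<in> F4_coords" "a \<in> Qbar" "b \<in> Qbar" "a * y0 ^ 3 \<noteq> b * x0 ^ 3" "c = - (a * x0 + b * y0)"
  shows "ford (Suc 0) (\<lambda>v. a * xc v + b * yc v + c * zc v) (x0, y0, 1) (Suc 0)"
proof -
  have "unif (x0, y0, 1) (\<lambda>(x, y, z). 1 * (a * x + b * y + c * z))"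
    by (rule unif_affine) (use assms in auto)
  moreover have "(\<lambda>(x, y, z). 1 * (a * x + b * y + c * z)) = (\<lambda>v. a * xc v + b * yc v + c * zc v)"
    by auto
  ultimately have "unif (x0, y0, 1) (\<lambda>v. a * xc v + b * yc v + c * zc v)" by (simp only:)
  then show ?thesis by (rule ford_unif)
qed

lemma ford_xc: "(0, y0, 1) \<in> F4_coords \<Longrightarrow> ford (Suc 0) xc (0, y0, 1) (Suc 0)"
  using ford_linear[of 0 y0 1 0 0] by (cases "y0 = 0") (auto simp: F4_coords_def)

lemma ford_yc: "(x0, 0, 1) \<in> F4_coords \<Longrightarrow> ford (Suc 0) yc (x0, 0, 1) (Suc 0)"
  using ford_linear[of x0 0 0 1 0] by (cases "x0 = 0") (auto simp: F4_coords_def)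

lemma ford_zc:
  assumes "(x0, 1, 0) \<in> F4_coords" shows "ford (Suc 0) zc (x0, 1, 0) (Suc 0)"
proof -
  have "(\<lambda>(x, y, z). 1 * z) = zc" by auto
  then show ?thesis using ford_unif[OF unif_infinity[OF assms]] by simp
qed

lemma co_F4_coords_unfold:
  "a < 4 \<Longrightarrow> (0, \<i> ^ a, 1) \<in> F4_coords" "a < 4 \<Longrightarrow> (\<i> ^ a, 0, 1) \<in> F4_coords"
  "a < 4 \<Longrightarrow> (zeta 8 * \<i> ^ a, 1, 0) \<in> F4_coords"
  using co_F4_coords[of "LA a"] co_F4_coords[of "LB a"] co_F4_coords[of "LC a"] by simp_all

lemma pt_of_coords:
  assumes "(x, y, z) \<in> F4_coords"
  shows "c * x0 = x \<Longrightarrow> c * y0 = y \<Longrightarrow> c * z0 = z \<Longrightarrow> c \<in> Qbar \<Longrightarrow> proj (x, y, z) = proj (x0, y0, z0)"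
  using F4_coords_nonzero[OF assms] by (cases "c = 0") (auto simp: proj_scale)

lemma fourth_root_multiple:
  assumes "u ^ 4 = w ^ 4" "w \<noteq> (0 :: complex)" obtains a where "a < 4" "u = \<i> ^ a * w"
proof -
  have "(u / w) ^ 4 = 1" using assms by (simp add: power_divide)
  then obtain a where "a < 4" "u / w = \<i> ^ a" by (rule fourth_root_of_unity)
  then show ?thesis using that[of a] assms(2) by (simp add: nonzero_divide_eq_eq)
qed

lemma x_zero_points:
  assumes "(0, y, z) \<in> F4_coords" obtains a where "a < 4" "y = \<i> ^ a * z" "proj (0, y, z) = pt (LA a)" "z \<noteq> 0"
proof -
  have z: "z \<noteq> 0" using assms by (auto simp: F4_coords_def)
  have "y ^ 4 = z ^ 4" using F4_coordsD[OF assms] by simp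
  then obtain a where a: "a < 4" and y: "y = \<i> ^ a * z" using z by (rule fourth_root_multiple)
  have "proj (0, y, z) = proj (0, \<i> ^ a, 1)"
    by (rule pt_of_coords[OF assms, of z]) (use y F4_coords_Qbar[OF assms] in auto)
  then show ?thesis using that a y z by (simp add: pt_def)
qed

lemma y_zero_points:
  assumes "(x, 0, z) \<in> F4_coords" obtains a where "a < 4" "x = \<i> ^ a * z" "proj (x, 0, z) = pt (LB a)" "z \<noteq> 0"
proof -
  have z: "z \<noteq> 0" using assms by (auto simp: F4_coords_def)
  have "x ^ 4 = z ^ 4" using F4_coordsD[OF assms] by simp
  then obtain a where a: "a < 4" and x: "x = \<i> ^ a * z" using z by (rule fourth_root_multiple)
  have "proj (x, 0, z) = proj (\<i> ^ a, 0, 1)"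
    by (rule pt_of_coords[OF assms, of z]) (use x F4_coords_Qbar[OF assms] in auto)
  then show ?thesis using that a x z by (simp add: pt_def)
qed

lemma z_zero_points:
  assumes "(x, y, 0) \<in> F4_coords" obtains a where "a < 4" "x = zeta 8 * \<i> ^ a * y" "proj (x, y, 0) = pt (LC a)" "y \<noteq> 0"
proof -
  have y: "y \<noteq> 0" using assms by (auto simp: F4_coords_def)
  have "x ^ 4 = (zeta 8 * y) ^ 4"
    using F4_coordsD[OF assms] by (simp add: power_mult_distrib zeta_8_power4 eq_neg_iff_add_eq_0)
  then obtain a where a: "a < 4" "x = \<i> ^ a * (zeta 8 * y)"
    using y zeta_r2_nonzero by (auto elim: fourth_root_multiple)
  then have x: "x = zeta 8 * \<i> ^ a * y" by (simp add: mult_ac)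
  have "proj (x, y, 0) = proj (zeta 8 * \<i> ^ a, 1, 0)"
    by (rule pt_of_coords[OF assms, of y]) (use x F4_coords_Qbar[OF assms] in \<open>auto simp: mult_ac\<close>)
  then show ?thesis using that a x y by (simp add: pt_def)
qed

section \<open>Divisors of the line x = 0, two flex tangents and the conic\<close>

lemma has_divisor_x: "has_divisor 1 xc [(1, LA 0), (1, LA 1), (1, LA 2), (1, LA 3)]" (is "has_divisor _ _ ?D")
proof (rule has_divisorI)
  show "form 1 xc" using form_xc by simp
  have "ford 1 xc (0, \<i> ^ a, 1) 1" if "a < 4" for a
    using ford_xc[OF co_F4_coords_unfold(1)[OF that]] by simp
  from this[of 0] this[of 1] this[of 2] this[of 3]
  show "0 \<le> k \<and> ford 1 xc (co l) (nat k)"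
    if "(k, l) \<in> set ?D" for k l
    using that by auto
  fix v assume v: "v \<in> F4_coords" "xc v = 0"
  obtain y z where v': "v = (0, y, z)" using v(2) by (cases v) simp
  obtain a where a: "a < 4" "proj v = pt (LA a)"
    using x_zero_points v(1) v' by metis
  then have "a \<in> {0, 1, 2, 3}" by auto
  then show "proj v \<in> pt ` snd ` set ?D"
    using a(2) by auto
next
  show "nonvanishing xc"
    by (rule bexI[of _ "(1, 0, 1)"]) (auto simp: F4_coords_def)
qed auto

text \<open>The other factors of y^4 - z^4 = -x^4 are nonzero at A0, and x is a local parameter
  there, so y - z has order 4.\<close>

lemma has_divisor_tangent_A: "has_divisor 1 (\<lambda>v. yc v - zc v) [(4, LA 0)]"
proof (rule has_divisorI)
  show "form 1 (\<lambda>v. yc v - zc v)" using form_diff[OF form_yc form_zc] by simp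
  have p: "(0, 1, 1) \<in> F4_coords" by (rule F4_coords_nonempty)
  have "ford 1 (\<lambda>v. yc v - zc v) (0, 1, 1) 4"
  proof (rule ford_witness[OF p _ _ ford_xc[OF p]])
    show "form 3 (\<lambda>v. (yc v + zc v) * (yc v ^ 2 + zc v ^ 2))"
      by (rule form_multI form_add form_powerI form_yc form_zc | simp)+
    show "form 0 (\<lambda>_. -1)" by (intro form_const Qbar_minus Qbar_1)
    fix w assume "w \<in> F4_coords"
    then have "xc w ^ 4 = zc w ^ 4 - yc w ^ 4" using F4_curve_eq by (simp add: eq_diff_eq)
    then show "(yc w + zc w) * (yc w ^ 2 + zc w ^ 2) * (yc w - zc w) = xc w ^ 4 * -1"
      by (simp add: algebra_simps eval_nat_numeral)
  qed auto
  then show "0 \<le> k \<and> ford 1 (\<lambda>v. yc v - zc v) (co l) (nat k)" if "(k, l) \<in> set [(4, LA 0)]" for k l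
    using that by auto
  fix v assume v: "v \<in> F4_coords" "yc v - zc v = 0"
  obtain x z where v': "v = (x, z, z)" using v(2) by (cases v) simp
  then have "x = 0" using v(1) by (auto simp: F4_coords_def)
  then obtain a where "a < 4" "z = \<i> ^ a * z" "proj (0, z, z) = pt (LA a)" "z \<noteq> 0"
    using x_zero_points v(1) v' by metis
  then show "proj v \<in> pt ` snd ` set [(4, LA 0)]"
    using i_power_eq_iff[of a 0] v' \<open>x = 0\<close> by auto
next
  show "nonvanishing (\<lambda>v. yc v - zc v)"
    by (rule bexI[of _ "(1, 0, 1)"]) (auto simp: F4_coords_def)
qed auto

lemma has_divisor_tangent_B: "has_divisor 1 (\<lambda>v. xc v - zc v) [(4, LB 0)]"
proof (rule has_divisorI)
  show "form 1 (\<lambda>v. xc v - zc v)" using form_diff[OF form_xc form_zc] by simp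
  have p: "(1, 0, 1) \<in> F4_coords" by (simp add: F4_coords_def)
  have "ford 1 (\<lambda>v. xc v - zc v) (1, 0, 1) 4"
  proof (rule ford_witness[OF p _ _ ford_yc[OF p]])
    show "form 3 (\<lambda>v. (xc v + zc v) * (xc v ^ 2 + zc v ^ 2))"
      by (rule form_multI form_add form_powerI form_xc form_zc | simp)+
    show "form 0 (\<lambda>_. -1)" by (intro form_const Qbar_minus Qbar_1)
    fix w assume "w \<in> F4_coords"
    then have "zc w ^ 4 = xc w ^ 4 + yc w ^ 4" using F4_curve_eq by simp
    then show "(xc w + zc w) * (xc w ^ 2 + zc w ^ 2) * (xc w - zc w) = yc w ^ 4 * -1"
      by (simp add: algebra_simps eval_nat_numeral)
  qed auto
  then show "0 \<le> k \<and> ford 1 (\<lambda>v. xc v - zc v) (co l) (nat k)" if "(k, l) \<in> set [(4, LB 0)]" for k l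
    using that by auto
  fix v assume v: "v \<in> F4_coords" "xc v - zc v = 0"
  obtain y z where v': "v = (z, y, z)" using v(2) by (cases v) simp
  then have "y = 0" using v(1) by (auto simp: F4_coords_def)
  then obtain a where "a < 4" "z = \<i> ^ a * z" "proj (z, 0, z) = pt (LB a)" "z \<noteq> 0"
    using y_zero_points v(1) v' by metis
  then show "proj v \<in> pt ` snd ` set [(4, LB 0)]"
    using i_power_eq_iff[of a 0] v' \<open>y = 0\<close> by auto
next
  show "nonvanishing (\<lambda>v. xc v - zc v)"
    by (rule bexI[of _ "(0, 1, 1)"]) (auto simp: F4_coords_def)
qed auto

text \<open>By x^4 = -(y - z)(y - \<i> z)(y + z)(y + \<i> z) the product has the factor (y - z)(y -
  \<i> z), and what is left is (y - z)(y - \<i> z) - (y + z)(y + \<i> z) = -2(1 + \<i>) y z. Up to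
  sign, the conjugate arises from the conic by x -> \<i> x.\<close>

lemma conic_product:
  fixes x y z :: complex
  assumes "x ^ 4 + y ^ 4 = z ^ 4"
  shows "(x ^ 2 - \<i> * ((y - z) * (y - \<i> * z))) * (x ^ 2 + \<i> * ((y - z) * (y - \<i> * z))) =
    - 2 * (1 + \<i>) * (y * (z * ((y - z) * (y - \<i> * z))))"
proof -
  have x4: "x ^ 4 = z ^ 4 - y ^ 4" using assms by (simp add: eq_diff_eq)
  have "(x ^ 2 - \<i> * ((y - z) * (y - \<i> * z))) * (x ^ 2 + \<i> * ((y - z) * (y - \<i> * z))) =
    x ^ 4 + ((y - z) * (y - \<i> * z)) ^ 2"
    by (simp add: algebra_simps eval_nat_numeral)
  also have "\<dots> = - 2 * (1 + \<i>) * (y * (z * ((y - z) * (y - \<i> * z))))"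
    unfolding x4 by (simp add: algebra_simps eval_nat_numeral)
  finally show ?thesis .
qed

abbreviation conic :: "triple \<Rightarrow> complex" where
  "conic \<equiv> \<lambda>v. xc v ^ 2 + \<i> * ((yc v - zc v) * (yc v - \<i> * zc v))"

abbreviation conic_conj :: "triple \<Rightarrow> complex" where
  "conic_conj \<equiv> \<lambda>v. xc v ^ 2 - \<i> * ((yc v - zc v) * (yc v - \<i> * zc v))"

lemma form_conic: "form 2 conic" "form 2 conic_conj"
  by (rule form_add form_diff form_scale[OF Qbar_ii] form_powerI[OF form_xc] form_multI form_yc form_zc | simp)+

lemma has_divisor_conic:
  "has_divisor 2 conic [(2, LA 0), (2, LA 1), (1, LB 0), (1, LB 2), (1, LC 1), (1, LC 3)]" (is "has_divisor _ _ ?D")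
proof (rule has_divisorI)
  show "form 2 conic" by (rule form_conic)
  \<comment> \<open>The conjugate conic also passes through A0 and A1 and is no use as a cofactor.
    The complementary factors of y^4 - z^4 are used instead: they turn one linear factor of the
    conic into -x^4, so that x^2 splits off.\<close>
  have A0: "ford 2 conic (0, 1, 1) 2"
  proof (rule ford_witness)
    show p: "(0, 1, 1) \<in> F4_coords" by (rule F4_coords_nonempty)
    show "ford (Suc 0) xc (0, 1, 1) (Suc 0)" by (rule ford_xc[OF p])
    show "form 3 (\<lambda>v. (yc v + zc v) * (yc v ^ 2 + zc v ^ 2))"
      by (rule form_multI form_add form_powerI form_yc form_zc | simp)+
    show "form 3 (\<lambda>v. (yc v + zc v) * (yc v ^ 2 + zc v ^ 2) - \<i> * (xc v ^ 2 * (yc v - \<i> * zc v)))"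
      by (rule form_diff form_scale[OF Qbar_ii] form_multI form_add form_powerI form_xc form_yc form_zc | simp)+
    fix w assume "w \<in> F4_coords"
    then have x4: "zc w ^ 4 = xc w ^ 4 + yc w ^ 4" using F4_curve_eq by simp
    have "(yc w + zc w) * (yc w ^ 2 + zc w ^ 2) * conic w =
      xc w ^ 2 * ((yc w + zc w) * (yc w ^ 2 + zc w ^ 2)) + \<i> * (yc w ^ 4 - zc w ^ 4) * (yc w - \<i> * zc w)"
      by (simp add: algebra_simps eval_nat_numeral)
    also have "\<dots> = xc w ^ 2 * ((yc w + zc w) * (yc w ^ 2 + zc w ^ 2) - \<i> * (xc w ^ 2 * (yc w - \<i> * zc w)))"
      unfolding x4 by (simp add: algebra_simps eval_nat_numeral)
    finally show "(yc w + zc w) * (yc w ^ 2 + zc w ^ 2) * conic w =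
      xc w ^ 2 * ((yc w + zc w) * (yc w ^ 2 + zc w ^ 2) - \<i> * (xc w ^ 2 * (yc w - \<i> * zc w)))" .
  qed auto
  have A1: "ford 2 conic (0, \<i>, 1) 2"
  proof (rule ford_witness)
    show p: "(0, \<i>, 1) \<in> F4_coords" using co_F4_coords_unfold(1)[of 1] by simp
    show "ford (Suc 0) xc (0, \<i>, 1) (Suc 0)" by (rule ford_xc[OF p])
    show "form 3 (\<lambda>v. (yc v + \<i> * zc v) * (yc v ^ 2 - zc v ^ 2))"
      by (rule form_scale[OF Qbar_ii] form_multI form_add form_diff form_powerI form_yc form_zc | simp)+
    show "form 3 (\<lambda>v. (yc v + \<i> * zc v) * (yc v ^ 2 - zc v ^ 2) - \<i> * (xc v ^ 2 * (yc v - zc v)))"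
      by (rule form_diff form_scale[OF Qbar_ii] form_multI form_add form_powerI form_xc form_yc form_zc | simp)+
    fix w assume "w \<in> F4_coords"
    then have x4: "zc w ^ 4 = xc w ^ 4 + yc w ^ 4" using F4_curve_eq by simp
    have "(yc w + \<i> * zc w) * (yc w ^ 2 - zc w ^ 2) * conic w =
      xc w ^ 2 * ((yc w + \<i> * zc w) * (yc w ^ 2 - zc w ^ 2)) + \<i> * (yc w ^ 4 - zc w ^ 4) * (yc w - zc w)"
      by (simp add: algebra_simps eval_nat_numeral)
    also have "\<dots> = xc w ^ 2 * ((yc w + \<i> * zc w) * (yc w ^ 2 - zc w ^ 2) - \<i> * (xc w ^ 2 * (yc w - zc w)))"
      unfolding x4 by (simp add: algebra_simps eval_nat_numeral)
    finally show "(yc w + \<i> * zc w) * (yc w ^ 2 - zc w ^ 2) * conic w =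
      xc w ^ 2 * ((yc w + \<i> * zc w) * (yc w ^ 2 - zc w ^ 2) - \<i> * (xc w ^ 2 * (yc w - zc w)))" .
  qed (auto simp: complex_eq_iff)
  \<comment> \<open>At the four simple zeros the conjugate is nonzero, and of the four lines in
    \<open>conic_product\<close> only y = 0, respectively z = 0, passes through the point.\<close>
  have B: "ford 2 conic (x, 0, 1) 1" if x: "x ^ 2 = 1" "x \<in> Qbar" for x
  proof (rule ford_witness)
    have "x ^ 4 = (x ^ 2) ^ 2" by (simp flip: power_mult)
    then show p: "(x, 0, 1) \<in> F4_coords" using x by (simp add: F4_coords_def)
    show "ford (Suc 0) yc (x, 0, 1) (Suc 0)" by (rule ford_yc[OF p])
    show "form 2 conic_conj" by (rule form_conic)
    show "form 3 (\<lambda>v. - 2 * (1 + \<i>) * (zc v * ((yc v - zc v) * (yc v - \<i> * zc v))))"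
      by (rule form_diff form_scale[OF Qbar_ii] form_scale[of "- 2 * (1 + \<i>)"] form_multI form_add form_yc form_zc
        Qbar_mult Qbar_add Qbar_minus Qbar_numeral | simp)+
    show "conic_conj w * conic w =
      yc w ^ 1 * (- 2 * (1 + \<i>) * (zc w * ((yc w - zc w) * (yc w - \<i> * zc w))))" if "w \<in> F4_coords" for w
      unfolding conic_product[OF F4_curve_eq[OF that]] by simp
  qed (use x in \<open>auto simp: complex_eq_iff\<close>)
  have C: "ford 2 conic (x, 1, 0) 1" if x: "x ^ 2 = - \<i>" "x \<in> Qbar" for x
  proof (rule ford_witness)
    have "x ^ 4 = (x ^ 2) ^ 2" by (simp flip: power_mult)
    then show p: "(x, 1, 0) \<in> F4_coords" using x by (simp add: F4_coords_def)
    show "ford (Suc 0) zc (x, 1, 0) (Suc 0)" by (rule ford_zc[OF p])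
    show "form 2 conic_conj" by (rule form_conic)
    show "form 3 (\<lambda>v. - 2 * (1 + \<i>) * (yc v * ((yc v - zc v) * (yc v - \<i> * zc v))))"
      by (rule form_diff form_scale[OF Qbar_ii] form_scale[of "- 2 * (1 + \<i>)"] form_multI form_add form_yc form_zc
        Qbar_mult Qbar_add Qbar_minus Qbar_numeral | simp)+
    show "conic_conj w * conic w =
      zc w ^ 1 * (- 2 * (1 + \<i>) * (yc w * ((yc w - zc w) * (yc w - \<i> * zc w))))" if "w \<in> F4_coords" for w
      unfolding conic_product[OF F4_curve_eq[OF that]] by simp
  qed (use x in \<open>auto simp: complex_eq_iff\<close>)
  have z3: "(zeta 8 * \<i>) ^ 2 = - \<i>" "(zeta 8 * \<i> ^ 3) ^ 2 = - \<i>"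
    by (simp_all add: power_mult_distrib zeta_8_sq i_powers)
  have "zeta 8 * \<i> \<in> Qbar" "zeta 8 * \<i> ^ 3 \<in> Qbar"
    by (intro Qbar_mult Qbar_power Qbar_ii zeta_Qbar)+
  then show "0 \<le> k \<and> ford 2 conic (co l) (nat k)" if "(k, l) \<in> set ?D" for k l
    using that A0 A1 B[of 1] B[of "-1"] C[OF z3(1)] C[OF z3(2)] Qbar_minus[OF Qbar_1] by auto
  fix v assume v: "v \<in> F4_coords" "conic v = 0"
  obtain x y z where v': "v = (x, y, z)" by (cases v)
  have c: "x ^ 2 + \<i> * ((y - z) * (y - \<i> * z)) = 0" using v by (simp add: v')
  have vF: "(x, y, z) \<in> F4_coords" using v v' by simp
  have "- 2 * (1 + \<i>) * (y * (z * ((y - z) * (y - \<i> * z)))) = 0"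
    using conic_product[OF F4_coordsD[OF vF]] c by simp
  moreover have "\<i> \<noteq> - 1" by (simp add: complex_eq_iff)
  ultimately consider "y = 0" | "z = 0" | "y = z" | "y = \<i> * z"
    by auto
  then show "proj v \<in> pt ` snd ` set ?D"
  proof cases
    case 1
    then obtain a where a: "a < 4" "x = \<i> ^ a * z" "proj v = pt (LB a)" "z \<noteq> 0"
      using y_zero_points[of x z] vF v' by metis
    have "(\<i> ^ a) ^ 2 * z ^ 2 = z ^ 2"
      using c 1 a(2) by (simp add: power_mult_distrib power2_eq_square algebra_simps)
    then have "(\<i> ^ a) ^ 2 = 1" using a(4) by simp
    then have "a \<noteq> 1" "a \<noteq> 3" by (auto simp: i_powers)
    then have "a \<in> {0, 2}" using a(1) by auto
    then show ?thesis using a(3) by auto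
  next
    case 2
    then obtain a where a: "a < 4" "x = zeta 8 * \<i> ^ a * y" "proj v = pt (LC a)" "y \<noteq> 0"
      using z_zero_points[of x y] vF v' by metis
    have "\<i> * (\<i> ^ a) ^ 2 * y ^ 2 + \<i> * y ^ 2 = 0"
      using c 2 a(2) zeta_8_sq by (simp add: power_mult_distrib power2_eq_square algebra_simps)
    then have "\<i> * y ^ 2 * ((\<i> ^ a) ^ 2 + 1) = 0" by (simp add: algebra_simps)
    then have "(\<i> ^ a) ^ 2 + 1 = 0" using a(4) by simp
    then have "a \<noteq> 0 \<and> a \<noteq> 2" by (intro conjI notI) auto
    then have "a \<in> {1, 3}" using a(1) by auto
    then show ?thesis using a(3) by auto
  next
    case 3
    then have "x = 0" using c by simp
    then obtain a where a: "a < 4" "y = \<i> ^ a * z" "proj v = pt (LA a)" "z \<noteq> 0"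
      using x_zero_points[of y z] vF v' by metis
    then show ?thesis using 3 i_power_eq_iff[of a 0] by auto
  next
    case 4
    then have "x = 0" using c by simp
    then obtain a where a: "a < 4" "y = \<i> ^ a * z" "proj v = pt (LA a)" "z \<noteq> 0"
      using x_zero_points[of y z] vF v' by metis
    then have "\<i> ^ a = \<i> ^ 1" using 4 by simp
    then show ?thesis using a i_power_eq_iff[of a 1] by auto
  qed
next
  show "nonvanishing conic"
    by (rule bexI[of _ "(\<i>, 0, 1)"]) (use co_F4_coords_unfold(2)[of 1] in \<open>auto simp: complex_eq_iff\<close>)
qed auto

section \<open>The action on the 4-torsion\<close>

lemma cls_eq: "cls D = {E. E - D \<in> Prin}"
proof -
  have "cls D = {E. \<exists>P\<in>Prin. E = P + D}" by (auto simp: cls_def r_coset_def)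
  also have "\<dots> = {E. E - D \<in> Prin}" by (auto intro!: bexI[of _ "_ - D"])
  finally show ?thesis .
qed

lemma cls_eqI: "D - E \<in> Prin \<Longrightarrow> cls D = cls E"
  unfolding cls_eq
proof (rule Set.set_eqI)
  fix F assume DE: "D - E \<in> Prin"
  show "F \<in> {F. F - D \<in> Prin} \<longleftrightarrow> F \<in> {F. F - E \<in> Prin}"
    using Prin_add[OF _ DE, of "F - D"] Prin_diff[OF _ DE, of "F - E"] by auto
qed

lemma cls_0: "cls 0 = Prin"
  by (simp add: cls_eq)

lemma cls_eq_Prin_iff: "cls D = Prin \<longleftrightarrow> D \<in> Prin"
proof
  assume "cls D = Prin"
  moreover have "D \<in> cls D" by (simp add: cls_eq Prin_0)
  ultimately show "D \<in> Prin" by simp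
qed (use cls_eqI[of D 0] cls_0 in simp)

lemma cls_mult: "cls D <#>\<^bsub>Div\<^esub> cls E = cls (D + E)"
proof (rule Set.set_eqI)
  fix F
  have "F \<in> cls D <#>\<^bsub>Div\<^esub> cls E \<longleftrightarrow> (\<exists>G H. G - D \<in> Prin \<and> H - E \<in> Prin \<and> F = G + H)"
    by (auto simp: set_mult_def cls_eq)
  also have "\<dots> \<longleftrightarrow> F - (D + E) \<in> Prin"
  proof
    assume "\<exists>G H. G - D \<in> Prin \<and> H - E \<in> Prin \<and> F = G + H"
    then obtain G H where "G - D \<in> Prin" "H - E \<in> Prin" "F = G + H" by blast
    then show "F - (D + E) \<in> Prin" using Prin_add[of "G - D" "H - E"] by (simp add: algebra_simps)
  next
    assume "F - (D + E) \<in> Prin"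
    then have "(F - E) - D \<in> Prin \<and> E - E \<in> Prin \<and> F = (F - E) + E"
      by (simp add: algebra_simps Prin_0)
    then show "\<exists>G H. G - D \<in> Prin \<and> H - E \<in> Prin \<and> F = G + H" by blast
  qed
  finally show "F \<in> cls D <#>\<^bsub>Div\<^esub> cls E \<longleftrightarrow> F \<in> cls (D + E)" by (simp add: cls_eq)
qed

abbreviation Jac4 :: "divisor set monoid" where "Jac4 \<equiv> torsion Jac 4"

definition torsion_divisors :: "divisor set" where
  "torsion_divisors = {D. support D \<subseteq> F4 \<and> deg D = 0 \<and> frag_cmul 4 D \<in> Prin}"

lemma torsion_divisors_closed:
  "0 \<in> torsion_divisors"
  "D \<in> torsion_divisors \<Longrightarrow> E \<in> torsion_divisors \<Longrightarrow> D + E \<in> torsion_divisors"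
  "D \<in> torsion_divisors \<Longrightarrow> frag_cmul k D \<in> torsion_divisors"
proof -
  show "frag_cmul k D \<in> torsion_divisors" if "D \<in> torsion_divisors" for k D
    using that Prin_cmul[of "frag_cmul 4 D" k]
    by (auto simp: torsion_divisors_def deg_cmul mult.commute intro: keys_cmul_F4[THEN subsetD])
  show "D + E \<in> torsion_divisors" if "D \<in> torsion_divisors" "E \<in> torsion_divisors"
    using that by (simp add: torsion_divisors_def deg_add keys_add_F4 frag_cmul_distrib2 Prin_add)
qed (simp add: torsion_divisors_def deg_0 Prin_0)

lemma Jac4_simps: "\<one>\<^bsub>Jac4\<^esub> = Prin" "A \<otimes>\<^bsub>Jac4\<^esub> B = A <#>\<^bsub>Div\<^esub> B"
  by (simp_all add: torsion_def Jac_def)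

lemma cls_nat_pow: "cls D [^]\<^bsub>Jac\<^esub> n = cls (frag_cmul (int n) D)" "cls D [^]\<^bsub>Jac4\<^esub> n = cls (frag_cmul (int n) D)"
  by (induction n)
    (simp_all add: torsion_def Jac_def cls_mult cls_0 frag_cmul_distrib add.commute)

lemma carrier_Jac4: "carrier Jac4 = cls ` torsion_divisors"
proof -
  have "carrier Jac4 = {A. (\<exists>D. A = cls D \<and> support D \<subseteq> F4 \<and> deg D = 0) \<and> A [^]\<^bsub>Jac\<^esub> (4::nat) = Prin}"
    by (simp add: torsion_def Jac_def)
  also have "\<dots> = cls ` torsion_divisors"
  proof (rule Set.set_eqI)
    have "cls D [^]\<^bsub>Jac\<^esub> (4::nat) = Prin \<longleftrightarrow> frag_cmul 4 D \<in> Prin" for D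
      by (simp add: cls_nat_pow cls_eq_Prin_iff)
    then show "A \<in> {A. (\<exists>D. A = cls D \<and> support D \<subseteq> F4 \<and> deg D = 0) \<and> A [^]\<^bsub>Jac\<^esub> (4::nat) = Prin} \<longleftrightarrow>
      A \<in> cls ` torsion_divisors" for A
      unfolding torsion_divisors_def image_iff mem_Collect_eq Bex_def by metis
  qed
  finally show ?thesis .
qed

lemma comm_group_Jac4: "comm_group Jac4"
proof (rule comm_groupI)
  note simps = carrier_Jac4 Jac4_simps cls_mult torsion_divisors_closed
  show "A \<otimes>\<^bsub>Jac4\<^esub> B \<in> carrier Jac4" if "A \<in> carrier Jac4" "B \<in> carrier Jac4" for A B
    using that by (auto simp: simps)
  show "\<one>\<^bsub>Jac4\<^esub> \<in> carrier Jac4"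
    unfolding simps(1,2) cls_0[symmetric] by (rule imageI, rule torsion_divisors_closed)
  show "A \<otimes>\<^bsub>Jac4\<^esub> B \<otimes>\<^bsub>Jac4\<^esub> C = A \<otimes>\<^bsub>Jac4\<^esub> (B \<otimes>\<^bsub>Jac4\<^esub> C)"
    if "A \<in> carrier Jac4" "B \<in> carrier Jac4" "C \<in> carrier Jac4" for A B C
    using that by (auto simp: simps add.assoc)
  show "A \<otimes>\<^bsub>Jac4\<^esub> B = B \<otimes>\<^bsub>Jac4\<^esub> A" if "A \<in> carrier Jac4" "B \<in> carrier Jac4" for A B
    using that by (auto simp: simps add.commute)
  show "\<one>\<^bsub>Jac4\<^esub> \<otimes>\<^bsub>Jac4\<^esub> A = A" if "A \<in> carrier Jac4" for A
    unfolding simps(2) cls_0[symmetric] using that by (auto simp: simps)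
  show "\<exists>B\<in>carrier Jac4. B \<otimes>\<^bsub>Jac4\<^esub> A = \<one>\<^bsub>Jac4\<^esub>" if A: "A \<in> carrier Jac4" for A
  proof -
    obtain D where D: "D \<in> torsion_divisors" "A = cls D" using A unfolding carrier_Jac4 by blast
    have "- D \<in> torsion_divisors" using torsion_divisors_closed(3)[OF D(1), of "-1"] by simp
    then show ?thesis
      by (intro bexI[of _ "cls (- D)"]) (simp_all add: simps D(2) cls_0)
  qed
qed

text \<open>With exponents k i \<ge> 0, as in the three matrices, integer powers are natural powers
  and \<open>cls_nat_pow\<close> evaluates them.\<close>

lemma finprod_cls:
  assumes "finite I" "\<And>i. i \<in> I \<Longrightarrow> F i \<in> torsion_divisors \<and> 0 \<le> k i"
  shows "(\<Otimes>\<^bsub>Jac4\<^esub>i\<in>I. cls (F i) [^]\<^bsub>Jac4\<^esub> (k i :: int)) = cls (\<Sum>i\<in>I. frag_cmul (k i) (F i))"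
  using assms
proof (induction I rule: finite_induct)
  case empty
  interpret comm_group Jac4 by (rule comm_group_Jac4)
  show ?case by (simp add: cls_0 Jac4_simps)
next
  case (insert i I)
  interpret comm_group Jac4 by (rule comm_group_Jac4)
  have p: "cls (F j) [^]\<^bsub>Jac4\<^esub> k j = cls (frag_cmul (k j) (F j))" if "j \<in> insert i I" for j
    using insert.prems[OF that] by (simp add: int_pow_def2 cls_nat_pow)
  have c: "cls (F j) [^]\<^bsub>Jac4\<^esub> k j \<in> carrier Jac4" if "j \<in> insert i I" for j
    unfolding p[OF that] using insert.prems[OF that] by (auto simp: carrier_Jac4 torsion_divisors_closed)
  have "(\<Otimes>\<^bsub>Jac4\<^esub>j\<in>insert i I. cls (F j) [^]\<^bsub>Jac4\<^esub> k j) =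
      cls (F i) [^]\<^bsub>Jac4\<^esub> k i \<otimes>\<^bsub>Jac4\<^esub> (\<Otimes>\<^bsub>Jac4\<^esub>j\<in>I. cls (F j) [^]\<^bsub>Jac4\<^esub> k j)"
    by (rule finprod_insert) (use insert.hyps c in auto)
  then show ?case
    using insert p[of i] by (simp add: Jac4_simps cls_mult)
qed

context curve_aut
begin

lemma push_div_inverse: "push_div \<theta> (push_div \<theta>' D) = D"
proof -
  interpret inv: curve_aut \<theta>' \<theta> by (rule inverse_aut)
  have "support D \<subseteq> UNIV" by simp
  then show ?thesis
    by (induction D rule: frag_induction)
      (auto simp: push_div_simps inv.push_div_simps theta_image)
qed

text \<open>The image of a coset is all of the target coset because the inverse substitution also
  preserves principal divisors.\<close>

lemma push_cls: "push_cls \<theta> (cls D) = cls (push_div \<theta> D)"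
proof (rule Set.set_eqI)
  fix E
  interpret inv: curve_aut \<theta>' \<theta> by (rule inverse_aut)
  show "E \<in> push_cls \<theta> (cls D) \<longleftrightarrow> E \<in> cls (push_div \<theta> D)"
  proof
    assume "E \<in> push_cls \<theta> (cls D)"
    then show "E \<in> cls (push_div \<theta> D)"
      using push_div_Prin by (auto simp: push_cls_def cls_eq simp flip: push_div_simps(4))
  next
    assume "E \<in> cls (push_div \<theta> D)"
    then have "push_div \<theta>' (E - push_div \<theta> D) \<in> Prin"
      by (intro inv.push_div_Prin) (simp add: cls_eq)
    then have "push_div \<theta>' E \<in> cls D"
      by (simp add: inv.push_div_simps inv.push_div_inverse cls_eq)
    then show "E \<in> push_cls \<theta> (cls D)"
      unfolding push_cls_def by (rule rev_image_eqI) (simp add: push_div_inverse)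
  qed
qed

lemma push_div_torsion: "D \<in> torsion_divisors \<Longrightarrow> push_div \<theta> D \<in> torsion_divisors"
  using push_div_Prin[of "frag_cmul 4 D"]
  by (simp add: torsion_divisors_def keys_push_div deg_push_div push_div_simps)

lemma push_cls_hom: "push_cls \<theta> \<in> hom Jac4 Jac4"
  by (rule homI) (auto simp: carrier_Jac4 push_cls push_div_torsion Jac4_simps cls_mult push_div_simps)

lemma acts_by_matrixI:
  assumes M: "M \<in> carrier_mat n n" "\<And>i j. i < n \<Longrightarrow> j < n \<Longrightarrow> 0 \<le> M $$ (i, j)"
    and e: "\<And>j. j < n \<Longrightarrow> e j = cls (F j)" "\<And>j. j < n \<Longrightarrow> F j \<in> torsion_divisors"
    and rel: "\<And>j. j < n \<Longrightarrow> push_div \<theta> (F j) - (\<Sum>i<n. frag_cmul (M $$ (i, j)) (F i)) \<in> Prin"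
  shows "acts_by_matrix Jac4 n e (push_cls \<theta>) M"
  unfolding acts_by_matrix_def
proof (intro conjI allI impI)
  fix j assume j: "j < n"
  show "e j \<in> carrier Jac4" using e j by (simp add: carrier_Jac4)
  interpret comm_group Jac4 by (rule comm_group_Jac4)
  have "cls (F i) [^]\<^bsub>Jac4\<^esub> M $$ (i, j) \<in> carrier Jac4" if "i < n" for i
    by (rule int_pow_closed) (use e(2)[OF that] in \<open>simp add: carrier_Jac4\<close>)
  then have "(\<Otimes>\<^bsub>Jac4\<^esub>i\<in>{..<n}. e i [^]\<^bsub>Jac4\<^esub> M $$ (i, j)) = (\<Otimes>\<^bsub>Jac4\<^esub>i\<in>{..<n}. cls (F i) [^]\<^bsub>Jac4\<^esub> M $$ (i, j))"
    by (intro finprod_cong') (use e(1) in auto)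
  also have "\<dots> = cls (\<Sum>i<n. frag_cmul (M $$ (i, j)) (F i))"
    by (rule finprod_cls) (use e M(2) j in auto)
  also have "\<dots> = push_cls \<theta> (e j)"
    using cls_eqI[OF rel[OF j]] by (simp add: e j push_cls)
  finally show "push_cls \<theta> (e j) = (\<Otimes>\<^bsub>Jac4\<^esub>i\<in>{..<n}. e i [^]\<^bsub>Jac4\<^esub> M $$ (i, j))" ..
qed (rule M push_cls_hom)+

end

text \<open>With \<open>s = x + \<i>y\<close> and \<open>q = \<i>xy\<close> the curve is \<open>s\<^sup>4 - z\<^sup>4 = 2q(2s\<^sup>2 - q)\<close>, and the
  cubic is linear in \<open>q\<close>, say \<open>\<alpha> + q\<beta>\<close>.  Its product with the conjugate \<open>\<alpha> + (2s\<^sup>2 - q)\<beta>\<close>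
  is a binary form in \<open>s\<close> and \<open>z\<close> which splits into linear factors; each value of \<open>s/z\<close> belongs
  to a pair of zeros interchanged by \<open>(x, y) \<mapsto> (\<i>y, -\<i>x)\<close>.\<close>

locale cubic_constants =
  fixes z r I :: complex
  assumes zz: "z * z = I" and II: "I * I = -1" and rr: "r * r = z - I * z"
begin

lemma zz': "z * (z * x) = I * x" using zz by (metis mult.assoc)
lemma II': "I * (I * x) = - x" using II by (metis mult.assoc mult_minus1)
lemma rr': "r * (r * x) = (z - I * z) * x" using rr by (metis mult.assoc)

text \<open>Rewriting to normal form in Q(zeta_8, r2): every polynomial in z, I, r becomes a
  combination of the eight products of distinct factors among z, I, r. The primed rules apply inside
  products nested to the right.\<close>

lemmas reduce = power2_eq_square power3_eq_cube power4_eq_xxxx algebra_simps zz zz' II II' rr rr'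

text \<open>c1, c2, c3 are the values of s / t at P1, P2, P3, where t is the third coordinate, and q
  / t^2 has there the values -z r, -z r, (z + I z) / 2. The constants b1 and b2 solve the linear
  conditions that \<alpha> + q \<beta> vanish at these points, see \<open>cubic_values\<close>; the
  cusps on the cubic have q = 0 and are the roots -1, I, -I of \<alpha>. Finally 2 k is the leading
  coefficient in \<open>cofactor\<close>.\<close>

definition b1 :: complex where "b1 = z + I * z - 4"
definition b2 :: complex where "b2 = z + I * z - 2 + 2 * (z * r)"
definition c1 :: complex where "c1 = I * z + I * r"
definition c2 :: complex where "c2 = z - r"
definition c3 :: complex where "c3 = z * r"
definition k :: complex where "k = - 2 * (z + I * z)"
definition \<alpha> :: "complex \<Rightarrow> complex \<Rightarrow> complex" where "\<alpha> s t = s ^ 3 + s ^ 2 * t + s * t ^ 2 + t ^ 3"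
definition \<beta> :: "complex \<Rightarrow> complex \<Rightarrow> complex" where "\<beta> s t = b1 * s + b2 * t"

lemma alpha_factor: "\<alpha> s t = (s + t) * ((s - I * t) * (s + I * t))"
  unfolding \<alpha>_def by (simp add: reduce)

lemma cofactor:
  "2 * \<alpha> s t + 4 * s ^ 2 * \<beta> s t + (s - t) * \<beta> s t ^ 2 =
   2 * k * ((s - c1 * t) * ((s - c2 * t) * (s - c3 * t)))"
  unfolding \<alpha>_def \<beta>_def b1_def b2_def c1_def c2_def c3_def k_def by (simp add: reduce)

text \<open>Doubling the product makes 2q(2s^2 - q) = s^4 - t^4 the coefficient of \<beta>^2. This
  is (s - t) \<alpha>, so \<alpha> divides the whole expression and the binary cubic of
  \<open>cofactor\<close> remains.\<close>

lemma norm_cubic: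
  assumes "2 * (q * (2 * s ^ 2 - q)) = s ^ 4 - t ^ 4"
  shows "(\<alpha> s t + (2 * s ^ 2 - q) * \<beta> s t) * (\<alpha> s t + q * \<beta> s t) =
    k * ((s + t) * ((s - I * t) * ((s + I * t) * ((s - c1 * t) * ((s - c2 * t) * (s - c3 * t))))))"
proof -
  have a: "(s - t) * \<alpha> s t = s ^ 4 - t ^ 4"
    unfolding \<alpha>_def by (simp add: algebra_simps eval_nat_numeral)
  have "2 * ((\<alpha> s t + (2 * s ^ 2 - q) * \<beta> s t) * (\<alpha> s t + q * \<beta> s t)) =
    2 * \<alpha> s t ^ 2 + 4 * s ^ 2 * \<beta> s t * \<alpha> s t + 2 * (q * (2 * s ^ 2 - q)) * \<beta> s t ^ 2"
    by (simp add: algebra_simps power2_eq_square)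
  also have "\<dots> = \<alpha> s t * (2 * \<alpha> s t + 4 * s ^ 2 * \<beta> s t + (s - t) * \<beta> s t ^ 2)"
    unfolding assms a[symmetric] by (simp add: algebra_simps power2_eq_square)
  also have "\<dots> = 2 * (k * ((s + t) * ((s - I * t) * ((s + I * t) * ((s - c1 * t) * ((s - c2 * t) * (s - c3 * t)))))))"
    unfolding cofactor by (subst alpha_factor) (simp only: mult_ac)
  finally show ?thesis by simp
qed

lemma k_nonzero: "k \<noteq> 0"
proof -
  have "k * (- (z + I * z)) = - 4" unfolding k_def by (simp add: reduce)
  then show ?thesis by auto
qed

text \<open>Nonvanishing is certified by an explicit inverse in Q(zeta_8, r2) up to an integer
  factor; likewise in \<open>discriminants\<close> and \<open>roots_distinct\<close>. It means that
  on the cubic the value of s determines q.\<close>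

lemma beta_nonzero: "\<beta> (-1) 1 \<noteq> 0" "\<beta> I 1 \<noteq> 0" "\<beta> (- I) 1 \<noteq> 0" "\<beta> c1 1 \<noteq> 0" "\<beta> c2 1 \<noteq> 0" "\<beta> c3 1 \<noteq> 0"
proof -
  note d = \<beta>_def b1_def b2_def c1_def c2_def c3_def
  have "\<beta> (-1) 1 * (1 + z + z ^ 3 + r - z * r - z ^ 2 * r) = 6"
    unfolding d by (simp add: reduce)
  then show "\<beta> (-1) 1 \<noteq> 0" by auto
  have "\<beta> I 1 * (-2 - z + 2 * z ^ 2 + z ^ 3 - r + z ^ 3 * r) = 12"
    unfolding d by (simp add: reduce)
  then show "\<beta> I 1 \<noteq> 0" by auto
  have "\<beta> (- I) 1 * (-2 + z - 2 * z ^ 2 - z ^ 3 + z ^ 2 * r - z ^ 3 * r) = 12"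
    unfolding d by (simp add: reduce)
  then show "\<beta> (- I) 1 \<noteq> 0" by auto
  have "\<beta> c1 1 * (2 - 4 * z - 6 * z ^ 2 + 2 * z ^ 3 - r + 7 * z * r + z ^ 2 * r + 3 * z ^ 3 * r) = 12"
    unfolding d by (simp add: reduce)
  then show "\<beta> c1 1 \<noteq> 0" by auto
  have "\<beta> c2 1 * (2 + 2 * z + 6 * z ^ 2 - 4 * z ^ 3 - r + 7 * z * r + z ^ 2 * r - 3 * z ^ 3 * r) = 12"
    unfolding d by (simp add: reduce)
  then show "\<beta> c2 1 \<noteq> 0" by auto
  have "\<beta> c3 1 * (- z - z ^ 3 - r + z ^ 2 * r) = 6"
    unfolding d by (simp add: reduce)
  then show "\<beta> c3 1 \<noteq> 0" by auto
qed

lemma cubic_values: "\<alpha> (-1) 1 = 0" "\<alpha> I 1 = 0" "\<alpha> (- I) 1 = 0"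
  "\<alpha> c1 1 - z * r * \<beta> c1 1 = 0" "\<alpha> c2 1 - z * r * \<beta> c2 1 = 0" "2 * \<alpha> c3 1 + (z + I * z) * \<beta> c3 1 = 0"
  unfolding \<alpha>_def \<beta>_def b1_def b2_def c1_def c2_def c3_def by (simp_all add: reduce)

text \<open>q \<noteq> s^2 says that the two values q and 2s^2 - q over the same s differ, so that
  the conjugate cubic does not vanish at the point in question.\<close>

lemma discriminants: "c1 ^ 2 \<noteq> - (z * r)" "c2 ^ 2 \<noteq> - (z * r)" "2 * c3 ^ 2 \<noteq> z + I * z"
proof -
  have "(c1 ^ 2 + z * r) * (- 2 * z + z ^ 2 + 2 * z ^ 3 + r + z * r - z ^ 2 * r) = 3"
    unfolding c1_def by (simp add: reduce)
  then show "c1 ^ 2 \<noteq> - (z * r)" by auto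
  have "(c2 ^ 2 + z * r) * (2 * z - z ^ 2 - 2 * z ^ 3 + r + z * r - z ^ 2 * r) = 3"
    unfolding c2_def by (simp add: reduce)
  then show "c2 ^ 2 \<noteq> - (z * r)" by auto
  have "(2 * c3 ^ 2 - (z + I * z)) * (- z - z ^ 3) = 2"
    unfolding c3_def by (simp add: reduce)
  then show "2 * c3 ^ 2 \<noteq> z + I * z" by auto
qed

lemma alpha_nonzero: "\<alpha> c1 1 \<noteq> 0" "\<alpha> c2 1 \<noteq> 0" "\<alpha> c3 1 \<noteq> 0"
proof -
  have "z \<noteq> 0" "I \<noteq> 1" using II zz by auto
  then have "z - I * z \<noteq> 0" by (simp add: algebra_simps)
  then have "r \<noteq> 0" using rr by auto
  moreover have "z + I * z \<noteq> 0" using k_nonzero unfolding k_def mult_eq_0_iff by blast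
  moreover note \<open>z \<noteq> 0\<close>
  ultimately show "\<alpha> c1 1 \<noteq> 0" "\<alpha> c2 1 \<noteq> 0" "\<alpha> c3 1 \<noteq> 0"
    using cubic_values(4-6) beta_nonzero(4-6) by auto
qed

lemma roots_distinct: "distinct [-1, I, - I, c1, c2, c3]"
proof -
  have "(c2 - c1) * (z + 2 * z ^ 2 - z ^ 3 + r + z ^ 2 * r + 2 * z ^ 3 * r) = 6"
    unfolding c1_def c2_def by (simp add: reduce)
  moreover have "(c3 - c1) * (z + 2 * z ^ 2 + 2 * z ^ 3 + r - 2 * z ^ 2 * r - z ^ 3 * r) = 3"
    unfolding c1_def c3_def by (simp add: reduce)
  moreover have "(c3 - c2) * (2 * z - 2 * z ^ 2 + z ^ 3 + 2 * r - z ^ 2 * r + z ^ 3 * r) = 3"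
    unfolding c2_def c3_def by (simp add: reduce)
  ultimately have "c1 \<noteq> c2" "c1 \<noteq> c3" "c2 \<noteq> c3" by auto
  \<comment> \<open>-1, I, -I are roots of \<alpha>, while c1, c2, c3 are not.\<close>
  moreover have "c \<notin> {-1, I, - I}" if "\<alpha> c 1 \<noteq> 0" for c
    using that cubic_values(1-3) by auto
  then have "c1 \<notin> {-1, I, - I}" "c2 \<notin> {-1, I, - I}" "c3 \<notin> {-1, I, - I}"
    using alpha_nonzero by blast+
  moreover have "I \<noteq> -1" "I \<noteq> 1" "I \<noteq> 0" using II by auto
  ultimately show ?thesis by auto
qed

end

lemma zeta_8_r2: "r2 * r2 = zeta 8 - \<i> * zeta 8"
proof -
  have "zeta 8 - \<i> * zeta 8 = (1 - \<i>) * zeta 8" by (simp add: algebra_simps)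
  also have "\<dots> = ((1 - \<i>) * (1 + \<i>)) * (r2 ^ 2 / 2)"
    unfolding zeta_8 by (simp only: times_divide_eq_right mult.assoc)
  also have "(1 - \<i>) * (1 + \<i>) = 2" by (simp add: algebra_simps)
  finally show ?thesis by (simp add: power2_eq_square)
qed

section \<open>The cubic through P1, P2, P3 and its divisor\<close>

context
begin

interpretation cubic_constants "zeta 8" r2 "\<i>"
  by unfold_locales (simp_all add: zeta_8_mult zeta_8_r2)

definition sc :: "triple \<Rightarrow> complex" where "sc v = xc v + \<i> * yc v"
definition qc :: "triple \<Rightarrow> complex" where "qc v = \<i> * (xc v * yc v)"
definition cubic :: "triple \<Rightarrow> complex" where "cubic v = \<alpha> (sc v) (zc v) + qc v * \<beta> (sc v) (zc v)"
definition cubic_conj :: "triple \<Rightarrow> complex" where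
  "cubic_conj v = \<alpha> (sc v) (zc v) + (2 * sc v ^ 2 - qc v) * \<beta> (sc v) (zc v)"
definition cubic_roots :: "complex set" where "cubic_roots = {-1, \<i>, - \<i>, c1, c2, c3}"

lemma constants_Qbar: "b1 \<in> Qbar" "b2 \<in> Qbar" "c1 \<in> Qbar" "c2 \<in> Qbar" "c3 \<in> Qbar" "k \<in> Qbar"
  unfolding b1_def b2_def c1_def c2_def c3_def k_def
  by (intro Qbar_add Qbar_mult Qbar_diff Qbar_minus Qbar_ii Qbar_1 Qbar_numeral zeta_Qbar)+

lemma form_sc: "form (Suc 0) sc"
  unfolding sc_def[abs_def] by (intro form_add form_scale Qbar_ii form_xc form_yc)

lemma form_qc: "form 2 qc"
  unfolding qc_def[abs_def] by (rule form_scale[OF Qbar_ii] form_multI[OF form_xc form_yc] | simp)+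

lemma form_alpha: "form 3 (\<lambda>v. \<alpha> (sc v) (zc v))"
  unfolding \<alpha>_def by (rule form_add form_multI form_powerI form_sc form_zc | simp)+

lemma form_beta: "form 1 (\<lambda>v. \<beta> (sc v) (zc v))"
  unfolding \<beta>_def by (rule form_add form_scale constants_Qbar form_sc form_zc | simp)+

lemma form_cubic: "form 3 cubic" "form 3 cubic_conj"
proof -
  have "form 3 (\<lambda>v. qc v * \<beta> (sc v) (zc v))"
    by (rule form_multI[OF form_qc form_beta]) simp
  then show "form 3 cubic" unfolding cubic_def[abs_def] by (rule form_add[OF form_alpha])
  have "form 2 (\<lambda>v. 2 * sc v ^ 2)" by (intro form_scale form_powerI[OF form_sc] Qbar_numeral) simp
  then have "form 2 (\<lambda>v. 2 * sc v ^ 2 - qc v)" by (rule form_diff[OF _ form_qc])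
  then have "form 3 (\<lambda>v. (2 * sc v ^ 2 - qc v) * \<beta> (sc v) (zc v))"
    by (rule form_multI[OF _ form_beta]) simp
  then show "form 3 cubic_conj" unfolding cubic_conj_def[abs_def] by (rule form_add[OF form_alpha])
qed

lemma finite_cubic_roots: "finite cubic_roots" "card cubic_roots = 6"
  using distinct_card[OF roots_distinct] by (simp_all add: cubic_roots_def)

lemma cubic_norm:
  assumes "w \<in> F4_coords"
  shows "cubic_conj w * cubic w = k * (\<Prod>c\<in>cubic_roots. sc w - c * zc w)"
proof -
  have z4: "zc w ^ 4 = xc w ^ 4 + yc w ^ 4" using F4_curve_eq[OF assms] by simp
  have "2 * (qc w * (2 * sc w ^ 2 - qc w)) = sc w ^ 4 - zc w ^ 4"
    unfolding z4 qc_def sc_def by (simp add: algebra_simps eval_nat_numeral)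
  then have "cubic_conj w * cubic w = k * ((sc w + zc w) * ((sc w - \<i> * zc w) * ((sc w + \<i> * zc w) *
      ((sc w - c1 * zc w) * ((sc w - c2 * zc w) * (sc w - c3 * zc w))))))"
    unfolding cubic_conj_def cubic_def by (rule norm_cubic)
  also have "(sc w + zc w) * ((sc w - \<i> * zc w) * ((sc w + \<i> * zc w) *
      ((sc w - c1 * zc w) * ((sc w - c2 * zc w) * (sc w - c3 * zc w))))) = (\<Prod>c\<in>cubic_roots. sc w - c * zc w)"
    unfolding cubic_roots_def using roots_distinct by simp
  finally show ?thesis .
qed

lemma form_prod:
  "finite C \<Longrightarrow> (\<And>c. c \<in> C \<Longrightarrow> form (Suc 0) (f c)) \<Longrightarrow> form (card C) (\<lambda>v. \<Prod>c\<in>C. f c v)"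
proof (induction C rule: finite_induct)
  case empty
  then show ?case using form_const[OF Qbar_1] by simp
next
  case (insert c C)
  then have "form (Suc 0 + card C) (\<lambda>v. f c v * (\<Prod>c\<in>C. f c v))" by (intro form_mult) auto
  then show ?case using insert by simp
qed

text \<open>In \<open>cubic_norm\<close> the conjugate is nonzero by \<open>disc\<close> and
  \<open>b\<close>, and of the six linear factors only s - c z vanishes at the point. Since that
  line is not tangent by \<open>nt\<close>, it is a local parameter, and the order is 1.\<close>

lemma ford_cubic:
  assumes p: "(x, y, 1) \<in> F4_coords" and c: "x + \<i> * y = c" "c \<in> cubic_roots"
    and q: "\<i> * (x * y) = q" and val: "\<alpha> c 1 + q * \<beta> c 1 = 0" and b: "\<beta> c 1 \<noteq> 0"
    and disc: "c ^ 2 \<noteq> q" and nt: "y ^ 3 \<noteq> \<i> * x ^ 3"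
  shows "ford 3 cubic (x, y, 1) 1"
proof (rule ford_witness[OF p])
  show "form 3 cubic_conj" by (rule form_cubic)
  have "cubic_conj (x, y, 1) = 2 * (c ^ 2 - q) * \<beta> c 1 + (\<alpha> c 1 + q * \<beta> c 1)"
    using c(1) q by (simp add: cubic_conj_def sc_def qc_def algebra_simps)
  then show "cubic_conj (x, y, 1) \<noteq> 0" using val b disc by simp
  have "ford (Suc 0) (\<lambda>v. 1 * xc v + \<i> * yc v + (- c) * zc v) (x, y, 1) (Suc 0)"
    by (rule ford_linear[OF p]) (use c nt in auto)
  then show "ford (Suc 0) (\<lambda>v. sc v - c * zc v) (x, y, 1) (Suc 0)"
    by (rule ford_cong) (simp add: sc_def)
  have "form (card (cubic_roots - {c})) (\<lambda>v. \<Prod>d\<in>cubic_roots - {c}. sc v - d * zc v)"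
    using finite_cubic_roots(1) constants_Qbar
    by (intro form_prod form_diff form_sc form_scale form_zc) (auto simp: cubic_roots_def intro!: Qbar_minus)
  then have "form 5 (\<lambda>v. \<Prod>d\<in>cubic_roots - {c}. sc v - d * zc v)"
    using finite_cubic_roots c(2) by simp
  then show "form 5 (\<lambda>v. k * (\<Prod>d\<in>cubic_roots - {c}. sc v - d * zc v))"
    by (rule form_scale[OF constants_Qbar(6)])
  show "k * (\<Prod>d\<in>cubic_roots - {c}. sc (x, y, 1) - d * zc (x, y, 1)) \<noteq> 0"
    using k_nonzero finite_cubic_roots(1) c(1) by (auto simp: sc_def)
  fix w assume w: "w \<in> F4_coords"
  show "cubic_conj w * cubic w = (sc w - c * zc w) ^ 1 * (k * (\<Prod>d\<in>cubic_roots - {c}. sc w - d * zc w))"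
    unfolding cubic_norm[OF w] prod.remove[OF finite_cubic_roots(1) c(2)] by (simp only: power_one_right mult.left_commute)
qed simp

text \<open>As \<beta> is nonzero, s determines q = x1 w1. Then x and \<i> y are the two roots of
  T^2 - s T + q, that is, x1 and w1 in either order.\<close>

lemma cubic_zero_pair:
  assumes "cubic (x, y, 1) = 0" "x + \<i> * y = x1 + w1" "\<alpha> (x1 + w1) 1 + x1 * w1 * \<beta> (x1 + w1) 1 = 0"
    "\<beta> (x1 + w1) 1 \<noteq> 0"
  shows "x = x1 \<and> y = - \<i> * w1 \<or> x = w1 \<and> y = - \<i> * x1"
proof -
  have "\<alpha> (x1 + w1) 1 + \<i> * (x * y) * \<beta> (x1 + w1) 1 = 0"
    using assms(1,2) by (simp add: cubic_def sc_def qc_def)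
  moreover have "(\<i> * (x * y) - x1 * w1) * \<beta> (x1 + w1) 1 =
    (\<alpha> (x1 + w1) 1 + \<i> * (x * y) * \<beta> (x1 + w1) 1) - (\<alpha> (x1 + w1) 1 + x1 * w1 * \<beta> (x1 + w1) 1)"
    by (simp add: algebra_simps)
  ultimately have "(\<i> * (x * y) - x1 * w1) * \<beta> (x1 + w1) 1 = 0"
    using assms(3) by (simp only: diff_self)
  then have q: "\<i> * (x * y) = x1 * w1" using assms(4) by simp
  have y: "\<i> * y = x1 + w1 - x" using assms(2) by (simp add: algebra_simps)
  have "(x - x1) * (x - w1) = x1 * w1 - x * (x1 + w1 - x)" by (simp add: algebra_simps)
  also have "\<dots> = 0" using q unfolding y[symmetric] by (simp add: algebra_simps)
  finally have "x = x1 \<or> x = w1" by auto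
  moreover have "y = - \<i> * (\<i> * y)" by simp
  then have "y = - \<i> * (x1 + w1 - x)" by (simp only: y)
  ultimately show ?thesis by auto
qed

lemma inverse_r2_sq: "\<i> * (inverse r2 * inverse r2) = (zeta 8 + \<i> * zeta 8) / 2"
proof -
  have e: "\<i> * (inverse r * inverse r) = w / 2" if "w * (r * r) = 2 * \<i>" "r \<noteq> 0" for w r :: complex
  proof -
    have "r * r \<noteq> 0" using that(2) by simp
    from nonzero_eq_divide_eq[OF this, THEN iffD2, OF that(1)] have "w = 2 * \<i> / (r * r)" .
    then show ?thesis by (simp only: divide_inverse) simp
  qed
  have "(zeta 8 + \<i> * zeta 8) * (r2 * r2) = 2 * \<i>"
    unfolding rr by (simp add: reduce)
  then show ?thesis using zeta_r2_nonzero by (intro e) auto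
qed

lemma c3_eq: "inverse r2 + \<i> * inverse r2 = c3"
proof -
  have "c3 * r2 = 1 + \<i>" unfolding c3_def by (simp add: reduce)
  then have "c3 = (1 + \<i>) / r2" by (rule nonzero_eq_divide_eq[OF zeta_r2_nonzero(2), THEN iffD2])
  then show ?thesis by (simp add: divide_inverse distrib_right)
qed

text \<open>Fourth powers remove the roots of unity; for the conjugates of P1 and P2 only -1 and 8
  have to be told apart.\<close>

lemma not_tangent:
  assumes "(y ^ 4) ^ 3 \<noteq> (x ^ 4) ^ 3" shows "y ^ 3 \<noteq> \<i> * (x :: complex) ^ 3"
proof
  assume "y ^ 3 = \<i> * x ^ 3"
  then have "(y ^ 3) ^ 4 = (\<i> * x ^ 3) ^ 4" by simp
  also have "\<dots> = (x ^ 3) ^ 4" by (simp only: power_mult_distrib i_powers) simp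
  finally have "(y ^ 4) ^ 3 = (x ^ 4) ^ 3" by (simp only: mult.commute flip: power_mult)
  with assms show False ..
qed

abbreviation cubic_divisor :: formal where
  "cubic_divisor \<equiv> [(1, LA 0), (1, LA 1), (1, LA 2), (1, LB 1), (1, LB 2), (1, LB 3),
      (1, LU 1 0), (1, LV 0 1), (1, LW 0 0), (1, LU 2 3), (1, LV 1 0), (1, LW 1 3)]"

lemma ford_cubic_points:
  assumes "(m, l) \<in> set cubic_divisor" shows "ford 3 cubic (co l) 1"
proof -
  note mem = cubic_roots_def
  note F = co_F4_coords
  have val: "\<alpha> c1 1 + - (zeta 8 * r2) * \<beta> c1 1 = 0" "\<alpha> c2 1 + - (zeta 8 * r2) * \<beta> c2 1 = 0"
    using cubic_values(4,5) by simp_all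
  have val3: "\<alpha> c3 1 + (zeta 8 + \<i> * zeta 8) / 2 * \<beta> c3 1 = 0"
    using cubic_values(6) by (simp add: field_simps)
  have disc3: "c3 ^ 2 \<noteq> (zeta 8 + \<i> * zeta 8) / 2"
    using discriminants(3) by (simp add: field_simps)
  have A: "ford 3 cubic (co (LA a)) 1" if "\<i> * \<i> ^ a \<in> cubic_roots" "\<alpha> (\<i> * \<i> ^ a) 1 = 0" "\<beta> (\<i> * \<i> ^ a) 1 \<noteq> 0" for a
    using ford_cubic[of 0 "\<i> ^ a" "\<i> * \<i> ^ a" 0] that F[of "LA a"] by simp
  have B: "ford 3 cubic (co (LB a)) 1" if "\<i> ^ a \<in> cubic_roots" "\<alpha> (\<i> ^ a) 1 = 0" "\<beta> (\<i> ^ a) 1 \<noteq> 0" for a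
    using ford_cubic[of "\<i> ^ a" 0 "\<i> ^ a" 0] that F[of "LB a"] by simp
  have nt: "(zeta 8 * a) ^ 3 \<noteq> \<i> * (r2 * b) ^ 3" "(r2 * a) ^ 3 \<noteq> \<i> * (zeta 8 * b) ^ 3"
    if "a ^ 4 = 1" "b ^ 4 = 1" for a b
    by (rule not_tangent, simp add: power_mult_distrib[of _ _ 4] that zeta_8_power4 r2_power4)+
  have i1: "\<i> ^ Suc 0 = \<i>" "\<i> ^ 2 = - 1" "\<i> ^ 3 = - \<i>" by (simp_all add: i_powers)
  have U: "ford 3 cubic (co (LU 1 0)) 1"
    using ford_cubic[of "r2 * \<i>" "zeta 8" c1 "- (zeta 8 * r2)"] F[of "LU 1 0"] val(1) beta_nonzero(4)
      discriminants(1) nt(1)[of 1 \<i>] by (simp add: mem c1_def i_powers algebra_simps)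
  have V: "ford 3 cubic (co (LV 0 1)) 1"
    using ford_cubic[of "zeta 8" "r2 * \<i>" c2 "- (zeta 8 * r2)"] F[of "LV 0 1"] val(2) beta_nonzero(5)
      discriminants(2) nt(2)[of \<i> 1] by (simp add: mem c2_def i_powers algebra_simps)
  have U': "ford 3 cubic (co (LU 2 3)) 1"
    using ford_cubic[of "- r2" "- (zeta 8 * \<i>)" c2 "- (zeta 8 * r2)"] F[of "LU 2 3"] val(2) beta_nonzero(5)
      discriminants(2) nt(1)[of "- \<i>" "- 1"] by (simp add: mem c2_def i_powers algebra_simps)
  have V': "ford 3 cubic (co (LV 1 0)) 1"
    using ford_cubic[of "zeta 8 * \<i>" r2 c1 "- (zeta 8 * r2)"] F[of "LV 1 0"] val(1) beta_nonzero(4)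
      discriminants(1) nt(2)[of 1 \<i>] by (simp add: mem c1_def i_powers algebra_simps)
  \<comment> \<open>At the two conjugates of P3 the fourth powers of x and y agree and
    \<open>not_tangent\<close> fails; there y = x or y = -x, and tangency is excluded
    directly.\<close>
  have ne: "a \<noteq> \<i> * a" "- a \<noteq> \<i> * a" if "a \<noteq> 0" for a :: complex
  proof -
    have "a = 0" if "- a = \<i> * a"
    proof -
      have "(1 + \<i>) * a = 0" unfolding distrib_right that[symmetric] by simp
      then show ?thesis by (auto simp: complex_eq_iff)
    qed
    with that show "a \<noteq> \<i> * a" "- a \<noteq> \<i> * a" by auto
  qed
  have c3: "c3 \<in> cubic_roots" by (simp add: mem)
  have W: "ford 3 cubic (co (LW 0 0)) 1"
  proof -
    have "inverse r2 ^ 3 \<noteq> \<i> * inverse r2 ^ 3" by (rule ne) (simp add: zeta_r2_nonzero)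
    then show ?thesis
      using ford_cubic[OF _ c3_eq c3 inverse_r2_sq val3 beta_nonzero(6) disc3] F[of "LW 0 0"] by simp
  qed
  have W': "ford 3 cubic (co (LW 1 3)) 1"
  proof -
    have e: "inverse r2 * \<i> + \<i> * - (inverse r2 * \<i>) = c3"
      unfolding c3_eq[symmetric] by (simp add: mult.commute[of _ \<i>])
    have q: "\<i> * ((inverse r2 * \<i>) * - (inverse r2 * \<i>)) = (zeta 8 + \<i> * zeta 8) / 2"
      unfolding inverse_r2_sq[symmetric] by (simp add: mult.assoc mult.left_commute[of "inverse r2" \<i>] mult.commute[of "inverse r2" \<i>])
    have "(- (inverse r2 * \<i>)) ^ 3 = - ((inverse r2 * \<i>) ^ 3)" by (rule power_minus_odd) simp
    then have "(- (inverse r2 * \<i>)) ^ 3 \<noteq> \<i> * (inverse r2 * \<i>) ^ 3"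
      by (simp only:) (rule ne, simp add: zeta_r2_nonzero)
    then show ?thesis
      using ford_cubic[OF _ e c3 q val3 beta_nonzero(6) disc3] F[of "LW 1 3"] by (simp add: i_powers)
  qed
  show ?thesis
    using assms A[of 0] A[of 1] A[of 2] B[of 1] B[of 2] B[of 3] U V U' V' W W' cubic_values(1-3) beta_nonzero(1-3)
    by (auto simp: mem i_powers)
qed

text \<open>The norm leaves six values of s, and each gives two zeros: -1 gives B2 and A1, \<i>
  gives B1 and A0, -\<i> gives B3 and A2, while c1, c2, c3 give P1, P2, P3 with one further
  conjugate each.\<close>

lemma cubic_zeros_affine:
  assumes "(x, y, 1) \<in> F4_coords" "cubic (x, y, 1) = 0"
  shows "\<exists>l\<in>snd ` set cubic_divisor. (x, y, 1) = co l"
proof -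
  have "k * (\<Prod>c\<in>cubic_roots. x + \<i> * y - c) = 0"
    using cubic_norm[OF assms(1)] assms(2) by (simp add: sc_def)
  then have "x + \<i> * y \<in> cubic_roots"
    using k_nonzero finite_cubic_roots(1) by auto
  then consider "x + \<i> * y = -1" | "x + \<i> * y = \<i>" | "x + \<i> * y = - \<i>"
    | "x + \<i> * y = c1" | "x + \<i> * y = c2" | "x + \<i> * y = c3"
    by (auto simp: cubic_roots_def)
  then show ?thesis
  proof cases
    case 1
    then show ?thesis
      using cubic_zero_pair[OF assms(2), of "-1" 0] cubic_values(1) beta_nonzero(1) by (auto simp: i_powers)
  next
    case 2
    then show ?thesis
      using cubic_zero_pair[OF assms(2), of \<i> 0] cubic_values(2) beta_nonzero(2) by (auto simp: i_powers)
  next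
    case 3
    then show ?thesis
      using cubic_zero_pair[OF assms(2), of "- \<i>" 0] cubic_values(3) beta_nonzero(3) by (auto simp: i_powers)
  next
    case 4
    have "r2 * \<i> + \<i> * zeta 8 = c1" "r2 * \<i> * (\<i> * zeta 8) = - (zeta 8 * r2)"
      by (simp_all add: c1_def algebra_simps)
    then have "x = r2 * \<i> \<and> y = - \<i> * (\<i> * zeta 8) \<or> x = \<i> * zeta 8 \<and> y = - \<i> * (r2 * \<i>)"
      using cubic_zero_pair[OF assms(2), of "r2 * \<i>" "\<i> * zeta 8"] 4 cubic_values(4) beta_nonzero(4) by simp
    then have "(x, y, 1) = co (LU 1 0) \<or> (x, y, 1) = co (LV 1 0)"
      by (elim disjE conjE) (simp_all add: mult.commute[of _ \<i>] i_powers)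
    then show ?thesis by (elim disjE) (erule bexI, simp)+
  next
    case 5
    have "zeta 8 + - r2 = c2" "zeta 8 * - r2 = - (zeta 8 * r2)"
      by (simp_all add: c2_def)
    then have "x = zeta 8 \<and> y = - \<i> * - r2 \<or> x = - r2 \<and> y = - \<i> * zeta 8"
      using cubic_zero_pair[OF assms(2), of "zeta 8" "- r2"] 5 cubic_values(5) beta_nonzero(5) by simp
    then have "(x, y, 1) = co (LV 0 1) \<or> (x, y, 1) = co (LU 2 3)"
      by (elim disjE conjE) (simp_all add: mult.commute[of _ \<i>] i_powers)
    then show ?thesis by (elim disjE) (erule bexI, simp)+
  next
    case 6
    have e: "inverse r2 * (\<i> * inverse r2) = (zeta 8 + \<i> * zeta 8) / 2"
      by (subst mult.left_commute) (rule inverse_r2_sq)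
    have val: "\<alpha> c3 1 + inverse r2 * (\<i> * inverse r2) * \<beta> c3 1 = 0"
      unfolding e using cubic_values(6) by (simp add: field_simps)
    have "x = inverse r2 \<and> y = - \<i> * (\<i> * inverse r2) \<or> x = \<i> * inverse r2 \<and> y = - \<i> * inverse r2"
      by (rule cubic_zero_pair[OF assms(2), of "inverse r2" "\<i> * inverse r2", unfolded c3_eq, OF 6 val beta_nonzero(6)])
    then have "(x, y, 1) = co (LW 0 0) \<or> (x, y, 1) = co (LW 1 3)"
      by (elim disjE conjE) (simp_all add: mult.commute[of _ \<i>] i_powers)
    then show ?thesis by (elim disjE) (erule bexI, simp)+
  qed
qed

lemma has_divisor_cubic: "has_divisor 3 cubic cubic_divisor"
proof (rule has_divisorI)
  show "form 3 cubic" by (rule form_cubic)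
  show "0 \<le> m \<and> ford 3 cubic (co l) (nat m)" if "(m, l) \<in> set cubic_divisor" for m l
  proof -
    have "m = 1" using that by auto
    then show ?thesis using ford_cubic_points[OF that] by simp
  qed
  fix v assume v: "v \<in> F4_coords" "cubic v = 0"
  obtain x y z where v': "v = (x, y, z)" by (cases v)
  have vF: "(x, y, z) \<in> F4_coords" using v v' by simp
  have z: "z \<noteq> 0"
  proof
    assume z: "z = 0"
    \<comment> \<open>At infinity the norm is k s^6, and s = 0 would give x^4 = y^4, which the curve
      equation at z = 0 excludes.\<close>
    have "k * (\<Prod>c\<in>cubic_roots. x + \<i> * y) = 0"
      using cubic_norm[OF v(1)] v(2) by (simp add: v' z sc_def)
    then have "x + \<i> * y = 0" using k_nonzero by simp
    then have "x = - (\<i> * y)" by (simp add: eq_neg_iff_add_eq_0)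
    moreover from this have "x ^ 4 = y ^ 4" by (simp add: power_mult_distrib i_powers)
    ultimately show False using vF z by (auto simp: F4_coords_def)
  qed
  have zQ: "z \<in> Qbar" using F4_coords_Qbar[OF vF] by simp
  have e: "proj (x, y, z) = proj (x / z, y / z, 1)"
    by (rule pt_of_coords[OF vF, of z]) (use z zQ in auto)
  have p: "(x / z, y / z, 1) \<in> F4_coords"
    using F4_coords_scale[OF vF Qbar_inverse[OF zQ]] z by (simp add: field_simps)
  have "cubic (x / z, y / z, 1) = 0"
    using form_zero_proj[OF form_cubic(1), of "(x / z, y / z, 1)" v] v(2) e proj_self[of "(x / z, y / z, 1)"] v' by simp
  from cubic_zeros_affine[OF p this] show "proj v \<in> pt ` snd ` set cubic_divisor"
    unfolding v' e pt_def by (metis image_eqI)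
next
  show "nonvanishing cubic"
  proof -
    have "cubic (0, - \<i>, 1) = 4"
      by (simp add: cubic_def sc_def qc_def \<alpha>_def)
    moreover have "(0, - \<i>, 1) \<in> F4_coords" by (simp add: F4_coords_def i_powers Qbar_minus)
    ultimately show ?thesis by (metis zero_neq_numeral)
  qed
qed auto

end

section \<open>Images of the generating sections under the automorphisms\<close>

lemma gen_plane_sections: "DD (gen n) \<in> plane_sections"
  using has_divisor_plane_section[OF has_divisor_tangent_A has_divisor_tangent_B]
    has_divisor_plane_section[OF has_divisor_x has_divisor_tangent_B]
    has_divisor_plane_section[OF has_divisor_conic has_divisor_tangent_B]
    has_divisor_plane_section[OF has_divisor_cubic has_divisor_tangent_B]
  by simp

text \<open>A0, B1 and A3 are the images of B0 under theta2, theta1 and theta3, as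
  \<open>plane_sections_push\<close> requires. Only the tangents at A0 and B0 are computed; theta1
  fixes A0 and rotates the points B, and theta2 carries the result over to A3.\<close>

lemma tangent_points:
  "frag_cmul 4 (frag_of (pt (LA 0))) - frag_cmul 4 (frag_of (pt (LB 0))) \<in> Prin"
  "frag_cmul 4 (frag_of (pt (LB 1))) - frag_cmul 4 (frag_of (pt (LB 0))) \<in> Prin"
  "frag_cmul 4 (frag_of (pt (LA 3))) - frag_cmul 4 (frag_of (pt (LB 0))) \<in> Prin"
proof -
  let ?t = "\<lambda>l. frag_cmul 4 (frag_of (pt l))"
  show A0: "?t (LA 0) - ?t (LB 0) \<in> Prin"
    using has_divisor_Prin[OF has_divisor_tangent_A has_divisor_tangent_B] by (simp add: DD_simps)
  have push: "?t (act1 l) - ?t (act1 m) \<in> Prin" "?t (act2 l) - ?t (act2 m) \<in> Prin"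
    if "?t l - ?t m \<in> Prin" for l m
    using theta1.push_div_Prin[OF that] theta2.push_div_Prin[OF that]
    by (simp_all add: theta1.push_div_simps theta2.push_div_simps theta1_pt theta2_pt del: minus_frag_cmul)
  have trans: "?t l - ?t n \<in> Prin" if "?t l - ?t m \<in> Prin" "?t m - ?t n \<in> Prin" for l m n
    using Prin_add[OF that] by (simp del: minus_frag_cmul)
  have sym: "?t m - ?t l \<in> Prin" if "?t l - ?t m \<in> Prin" for l m
    using Prin_minus[OF that] by simp
  have a: "act1 (LB 0) = LB 1" "act1 (LB 1) = LB 2" "act1 (LB 2) = LB 3" "act1 (LA 0) = LA 0"
    "act2 (LB 3) = LA 3" "act2 (LA 0) = LB 0" by simp_all
  have B0: "?t (LB 0) - ?t (LA 0) \<in> Prin" by (rule sym[OF A0])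
  have B1: "?t (LB 1) - ?t (LA 0) \<in> Prin" using push(1)[OF B0] by (simp only: a)
  have B2: "?t (LB 2) - ?t (LA 0) \<in> Prin" using push(1)[OF B1] by (simp only: a)
  have B3: "?t (LB 3) - ?t (LA 0) \<in> Prin" using push(1)[OF B2] by (simp only: a)
  show "?t (LB 1) - ?t (LB 0) \<in> Prin" by (rule trans[OF B1 A0])
  show "?t (LA 3) - ?t (LB 0) \<in> Prin" using push(2)[OF B3] by (simp only: a)
qed

lemma combination_plane_sections: "DD (combination cs) \<in> plane_sections"
proof -
  have B0: "ptB 0 = pt (LB 0)" by (simp add: ptB_def pt_def)
  have act: "DD (relabel (act k) xs) \<in> plane_sections" if "DD xs \<in> plane_sections" for k xs
  proof -
    have "push_div theta1 (DD xs) \<in> plane_sections"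
      by (rule theta1.plane_sections_push[OF that]) (use tangent_points(2) in \<open>simp add: B0 theta1_pt\<close>)
    moreover have "push_div theta2 (DD xs) \<in> plane_sections"
      by (rule theta2.plane_sections_push[OF that]) (use tangent_points(1) in \<open>simp add: B0 theta2_pt\<close>)
    moreover have "push_div theta3 (DD xs) \<in> plane_sections"
      by (rule theta3.plane_sections_push[OF that]) (use tangent_points(3) in \<open>simp add: B0 theta3_pt\<close>)
    ultimately show ?thesis by (simp add: push_DD_thetas act_def)
  qed
  have "DD (relabel (foldr act w) xs) \<in> plane_sections" if "DD xs \<in> plane_sections" for w xs
  proof (induction w)
    case Nil
    then show ?case using that by (simp add: relabel_def case_prod_eta)
  next
    case (Cons k w)
    then show ?case using act[of "relabel (foldr act w) xs" k]
      by (simp add: relabel_relabel comp_def)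
  qed
  then show ?thesis
    using gen_plane_sections by (induction cs)
      (auto simp: combination_def DD_simps DD_scale plane_sections_0 simp del: gen.simps
        intro!: plane_sections_add plane_sections_cmul)
qed

section \<open>Certificates for the torsion and matrix relations\<close>

definition certified :: "formal \<Rightarrow> (int \<times> nat \<times> nat list) list \<Rightarrow> bool" where
  "certified xs cs \<longleftrightarrow> sum_list (map fst xs) = 0 \<and>
     list_all (\<lambda>l. coef xs l = coef (combination cs) l) (map snd (xs @ combination cs))"

text \<open>The combination is equivalent to its degree times B0, and the degree is 0.\<close>

lemma certified_Prin:
  assumes "certified xs cs" shows "DD xs \<in> Prin"
proof -
  have "DD xs = DD (combination cs)" "deg (DD xs) = 0"
    using assms by (simp_all add: certified_def DD_eqI deg_DD)
  then show ?thesis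
    using combination_plane_sections[of cs] by (simp add: plane_sections_def)
qed

definition e_formal :: "nat \<Rightarrow> formal" where
  "e_formal j =
    [[(1, LA 1), (-1, LB 0)], [(1, LA 2), (-1, LB 0)], [(1, LB 1), (-1, LB 0)], [(1, LB 2), (-1, LB 0)],
     [(1, LC 1), (-1, LB 0)], [(1, LU 1 0), (1, LV 0 1), (1, LW 0 0), (-3, LB 0)]] ! j"

lemma less_6_iff: "j < 6 \<longleftrightarrow> j = 0 \<or> j = 1 \<or> j = 2 \<or> j = 3 \<or> j = 4 \<or> j = (5 :: nat)"
  by auto

lemma e_basis_eq:
  assumes "j < 6" shows "e_basis j = cls (DD (e_formal j))"
proof -
  have "frag_cmul (- 3) D = - frag_cmul 3 D" for D :: divisor by simp
  then show ?thesis
    using assms unfolding less_6_iff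
    by (elim disjE) (simp_all add: e_basis_def e_formal_def DD_simps ptA_def ptB_def ptC_def P1_def P2_def P3_def
        pt_def zeta_4 add.assoc add_diff_eq del: minus_frag_cmul)
qed

text \<open>The certificates were found by solving integral linear systems.\<close>

definition torsion_certs :: "(int \<times> nat \<times> nat list) list list" where
  "torsion_certs =
    [[(1, 0, [2, 1, 2]), (-1, 0, [2])],
     [(1, 0, [3, 1, 2]), (-1, 0, [2])],
     [(1, 0, [1, 2]), (-1, 0, [2])],
     [(1, 0, [1, 1, 2]), (-1, 0, [2])],
     [(1, 0, [1, 3]), (-1, 0, [2])],
     [(2, 3, [1, 1, 2, 1, 3]), (-2, 3, [3, 2]), (2, 3, []), (1, 2, []), (-1, 2, [3]), (-1, 2,
     [2, 1]), (-3, 0, [2]), (-1, 0, [1, 1, 2]), (-1, 0, [3, 3]), (1, 0, [1, 3]), (1, 0, [3, 2]),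
     (-1, 0, [])]]"

text \<open>The points A, B, C are flexes, so for the first five classes the certificate is a
  difference of two flex tangents; the sixth needs the cubic and the conic.\<close>

lemma e_formal_torsion:
  assumes "j < 6" shows "DD (e_formal j) \<in> torsion_divisors"
proof -
  have "list_all (\<lambda>j. sum_list (map fst (e_formal j)) = 0 \<and> certified (scale 4 (e_formal j)) (torsion_certs ! j)) [0..<6]"
    by code_simp
  then have "sum_list (map fst (e_formal j)) = 0" "certified (scale 4 (e_formal j)) (torsion_certs ! j)"
    using assms by (auto simp: list_all_iff)
  then show ?thesis
    using keys_DD[of "e_formal j"] certified_Prin by (simp add: torsion_divisors_def deg_DD flip: DD_scale)
qed

definition column_relation :: "nat \<Rightarrow> int list list \<Rightarrow> nat \<Rightarrow> formal" where
  "column_relation k m j =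
    relabel (act k) (e_formal j) @ concat (map (\<lambda>i. scale (- (m ! i ! j)) (e_formal i)) [0..<6])"

lemma DD_column_relation:
  "DD (column_relation k m j) =
    DD (relabel (act k) (e_formal j)) - (\<Sum>i<6. frag_cmul (m ! i ! j) (DD (e_formal i)))"
proof -
  have "DD (concat (map (\<lambda>i. scale (- (m ! i ! j)) (e_formal i)) is)) =
    - sum_list (map (\<lambda>i. frag_cmul (m ! i ! j) (DD (e_formal i))) is)" for "is"
    by (induction "is") (simp_all add: DD_simps DD_scale)
  then show ?thesis
    by (simp add: column_relation_def DD_simps interv_sum_list_conv_sum_set_nat atLeast0LessThan)
qed

lemma (in curve_aut) acts_by_certified_matrix:
  assumes push: "\<And>xs. push_div \<theta> (DD xs) = DD (relabel (act k) xs)"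
    and m: "length m = 6" "list_all (\<lambda>i. list_all (\<lambda>j. 0 \<le> m ! i ! j) [0..<6]) [0..<6]"
    and cert: "list_all (\<lambda>j. certified (column_relation k m j) (certs ! j)) [0..<6]"
  shows "acts_by_matrix Jac4 6 e_basis (push_cls \<theta>) (mat_of_rows_list 6 m)"
proof (rule acts_by_matrixI)
  have M: "mat_of_rows_list 6 m $$ (i, j) = m ! i ! j" if "i < 6" "j < 6" for i j
    using that m(1) by (simp add: mat_of_rows_list_def)
  show "mat_of_rows_list 6 m \<in> carrier_mat 6 6" using m(1) by (simp add: mat_of_rows_list_def)
  show "0 \<le> mat_of_rows_list 6 m $$ (i, j)" if "i < 6" "j < 6" for i j
    using m(2) that by (simp add: M list_all_iff)
  show "push_div \<theta> (DD (e_formal j)) - (\<Sum>i<6. frag_cmul (mat_of_rows_list 6 m $$ (i, j)) (DD (e_formal i))) \<in> Prin"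
    if "j < 6" for j
  proof -
    have "DD (column_relation k m j) \<in> Prin"
      using cert that by (intro certified_Prin[of _ "certs ! j"]) (simp add: list_all_iff)
    then show ?thesis by (simp add: DD_column_relation push M that)
  qed
qed (simp_all add: e_basis_eq e_formal_torsion)

text \<open>One list per column, to be compared with \<open>column_relation\<close>. The word [2]
  takes A0 to B0, so the entries (k, 0, [2]) are multiples of 4 B0 and balance the degree.\<close>

definition theta1_certs :: "(int \<times> nat \<times> nat list) list list" where
  "theta1_certs =
    [[(-1, 0, [1, 2]), (1, 0, [2])],
     [(-1, 0, [1, 2]), (1, 0, [2])],
     [(-1, 0, [1, 2]), (1, 0, [2])],
     [(1, 1, [2]), (-1, 0, [1, 2]), (1, 0, [2]), (-1, 0, [1, 1, 2])],
     [(-1, 3, [1, 1, 2, 1, 3]), (1, 3, [3, 2]), (-1, 3, []), (1, 1, []), (1, 1, [2]), (1, 2, [3,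
     2]), (-1, 0, [1, 2]), (-1, 0, [2, 1, 2]), (4, 0, [2]), (-1, 0, [3, 1, 2]), (-1, 0, [1, 3]),
     (-1, 0, [3, 2])],
     [(1, 3, [1, 3, 1]), (-1, 3, [2]), (-1, 3, [1, 1, 2, 1, 3]), (1, 3, [3, 2]), (-1, 3, []),
     (1, 2, []), (-1, 2, [1]), (-1, 2, [1, 2, 3, 1]), (4, 0, [2]), (-1, 0, [1, 3]), (1, 0, [3]),
     (1, 0, [3, 3])]]"

definition theta2_certs :: "(int \<times> nat \<times> nat list) list list" where
  "theta2_certs =
    [[(-1, 2, []), (1, 2, [1, 2]), (-1, 0, [1, 2]), (3, 0, [2]), (-1, 0, [3, 1, 2]), (-1, 0, [1,
     1, 2])],
     [(-1, 2, []), (1, 2, [1, 2]), (2, 0, [2]), (-1, 0, [3, 1, 2]), (-1, 0, [1, 2])],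
     [(-1, 2, []), (1, 2, [1, 2]), (3, 0, [2]), (-1, 0, [3, 1, 2]), (-1, 0, [1, 2]), (-1, 0, [1,
     1, 2])],
     [(-1, 2, []), (1, 2, [1, 2]), (2, 0, [2]), (-1, 0, [1, 2]), (-1, 0, [1, 1, 2])],
     [(-1, 3, [1, 1, 2, 1, 3]), (1, 3, [3, 2]), (-1, 3, []), (-1, 1, []), (1, 2, [3, 3, 1]), (3,
     0, [2]), (-1, 0, [1, 3])],
     [(1, 2, []), (-1, 2, [1, 2]), (-1, 0, []), (-1, 0, [2, 1, 2]), (2, 0, [2])]]"

definition theta3_certs :: "(int \<times> nat \<times> nat list) list list" where
  "theta3_certs =
    [[(1, 2, [2, 1]), (-1, 2, [3, 2, 1]), (-1, 0, [2, 1, 2]), (2, 0, [2]), (-1, 0, [1, 2])],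
     [(-1, 3, [1, 1, 2, 1, 3]), (1, 3, [3, 2]), (-1, 3, []), (1, 1, []), (1, 2, [1, 3, 3]), (-1,
     0, [3, 2]), (-1, 0, [2, 1, 2]), (4, 0, [2]), (-1, 0, [3, 1, 2]), (-1, 0, [1, 3])],
     [(1, 2, [2, 1]), (-1, 2, [3, 2, 1]), (-1, 0, [2, 1, 2]), (2, 0, [2]), (-1, 0, [1, 2])],
     [(1, 2, [2, 1]), (-1, 2, [3, 2, 1]), (1, 0, [2]), (-1, 0, [1, 2])],
     [(1, 2, [2, 1]), (-1, 2, [3, 2, 1]), (-1, 0, [2, 1, 2]), (2, 0, [2]), (-1, 0, [1, 2])],
     [(2, 3, [3, 2]), (-2, 3, []), (-1, 3, [1, 1, 2, 1, 3]), (-1, 1, []), (1, 1, [3]), (-1, 2,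
     [2, 3]), (-1, 0, [3, 2]), (5, 0, [2]), (-1, 0, [1, 3]), (1, 0, []), (1, 0, [3, 3])]]"

theorem theoremC1:
  shows "acts_by_matrix (torsion Jac 4) 6 e_basis (push_cls theta1)
           (mat_of_rows_list 6
             [[1, 0, 0, 0, 3, 1],
              [0, 1, 0, 0, 1, 1],
              [3, 3, 3, 2, 2, 1],
              [0, 0, 1, 3, 1, 2],
              [0, 0, 0, 0, 3, 1],
              [0, 0, 0, 0, 2, 3]])
       \<and> acts_by_matrix (torsion Jac 4) 6 e_basis (push_cls theta2)
           (mat_of_rows_list 6
             [[2, 2, 3, 2, 1, 2],
              [3, 3, 3, 0, 0, 1],
              [3, 2, 2, 2, 1, 2],
              [3, 0, 3, 3, 0, 1],
              [0, 0, 0, 0, 3, 0],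
              [0, 0, 0, 0, 2, 1]])
       \<and> acts_by_matrix (torsion Jac 4) 6 e_basis (push_cls theta3)
           (mat_of_rows_list 6
             [[3, 2, 3, 0, 3, 1],
              [2, 3, 3, 2, 2, 2],
              [2, 1, 2, 2, 2, 3],
              [1, 2, 1, 1, 2, 3],
              [1, 3, 0, 0, 0, 1],
              [0, 2, 0, 0, 0, 3]])"
proof (intro conjI, goal_cases)
  case 1
  show ?case
    by (rule theta1.acts_by_certified_matrix[where k = 1 and certs = theta1_certs])
      (simp add: push_DD_thetas act_def, code_simp+)
next
  case 2
  show ?case
    by (rule theta2.acts_by_certified_matrix[where k = 2 and certs = theta2_certs])
      (simp add: push_DD_thetas act_def, code_simp+)
next
  case 3
  show ?case
    by (rule theta3.acts_by_certified_matrix[where k = 3 and certs = theta3_certs])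
      (simp add: push_DD_thetas act_def, code_simp+)
qed

end
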